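(* The sequence $w(i)_{i\ge 0}$ of letters of $\mathbf{w}_{5/4}$ is $6$-regular with rank $188$.
   Context: A $5/4$-power is a word of the form $xyx$ where $x,y$ are words with $|x|\ge 1$ and $|y|=3|x|$. A word is $5/4$-power-free if none of its factors (contiguous subwords) is a $5/4$-power. $\mathbf{w}_{5/4}=w(0)w(1)w(2)\cdots$ denotes the lexicographically least infinite word over the alphabet $\mathbb{N}=\{0,1,2,\dots\}$ that is $5/4$-power-free. For an integer $k\ge 2$ and a sequence $s(i)_{i\ge0}$, the $k$-kernel of $s$ is $\{ s(k^e i + j)_{i\ge 0} : e\ge 0,\ 0\le j\le k^e-1\}$; the sequence is $k$-regular if the $\mathbb{Q}$-vector space spanned by its $k$-kernel is finite-dimensional, and its rank is the dimension of this vector space. *)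

theory Defs
  imports Complex_Main "HOL-Library.Sublist" "HOL-Library.Fun_Lexorder"
    "HOL-Library.Function_Algebras"
begin

definition five_quarters_power :: "'a list \<Rightarrow> bool" where
  "five_quarters_power u \<longleftrightarrow>
     (\<exists>x y. u = x @ y @ x \<and> length x \<ge> 1 \<and> length y = 3 * length x)"

definition power_free :: "'a list \<Rightarrow> bool" where
  "power_free u \<longleftrightarrow> (\<forall>f. sublist f u \<longrightarrow> \<not> five_quarters_power f)"

definition power_free_word :: "(nat \<Rightarrow> 'a) \<Rightarrow> bool" where
  "power_free_word v \<longleftrightarrow> (\<forall>i n. \<not> five_quarters_power (map v [i..<i + n]))"

definition lex_least_power_free :: "(nat \<Rightarrow> nat) \<Rightarrow> bool" where
  "lex_least_power_free w \<longleftrightarrow>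
     power_free_word w \<and> (\<forall>v. power_free_word v \<longrightarrow> v = w \<or> less_fun w v)"

definition w54 :: "nat \<Rightarrow> nat" where
  "w54 = (THE w. lex_least_power_free w)"

text \<open>
  The definite description above is proper: the greedy construction (append the least letter that
  creates no \<open>5/4\<close>-power; a fresh letter never creates one) yields the lexicographically least word.
\<close>

lemma power_free_prefixes:
  "power_free_word v \<longleftrightarrow> (\<forall>n. power_free (map v [0..<n]))"
proof
  assume v: "power_free_word v"
  show "\<forall>n. power_free (map v [0..<n])"
    unfolding power_free_def
  proof (intro allI impI)
    fix n f
    assume "sublist f (map v [0..<n])"
    then obtain ps ss where e: "map v [0..<n] = ps @ f @ ss"
      by (auto simp: sublist_def)
    have "f = take (length f) (drop (length ps) (map v [0..<n]))"
      by (simp add: e)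
    also have "\<dots> = map v (take (length f) [length ps..<n])"
      by (simp add: drop_map take_map)
    also have "take (length f) [length ps..<n] = [length ps..<length ps + length f]"
      using arg_cong[OF e, of length] by (cases "length f = 0") auto
    finally show "\<not> five_quarters_power f"
      using v unfolding power_free_word_def by metis
  qed
next
  assume v: "\<forall>n. power_free (map v [0..<n])"
  show "power_free_word v"
    unfolding power_free_word_def
  proof (intro allI)
    fix i n
    have "map v [0..<i + n] = map v [0..<i] @ map v [i..<i + n] @ []"
      by (metis append.right_neutral le_add1 le0 map_append upt_add_eq_append)
    hence "sublist (map v [i..<i + n]) (map v [0..<i + n])"
      unfolding sublist_def by blast
    thus "\<not> five_quarters_power (map v [i..<i + n])"
      using v unfolding power_free_def by blast
  qed
qed

lemma power_free_fresh:
  assumes u: "power_free u" and c: "c \<notin> set u"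
  shows "power_free (u @ [c])"
  unfolding power_free_def
proof (intro allI impI notI)
  fix f
  assume f: "sublist f (u @ [c])" and p: "five_quarters_power f"
  have nf: "\<not> sublist f u"
    using u p unfolding power_free_def by blast
  obtain x y where xy: "f = x @ y @ x" "length x \<ge> 1"
    using p unfolding five_quarters_power_def by blast
  from f obtain ps ss where e: "u @ [c] = ps @ f @ ss"
    by (auto simp: sublist_def)
  have "ss = []"
  proof (rule ccontr)
    assume "ss \<noteq> []"
    hence "u = ps @ f @ butlast ss"
      using arg_cong[OF e, of butlast] by (simp add: butlast_append)
    thus False using nf unfolding sublist_def by blast
  qed
  have xne: "x \<noteq> []" using xy by auto
  have "c = last x"
    using arg_cong[OF e, of last] xne \<open>ss = []\<close> xy by simp
  moreover have "u = ps @ x @ y @ butlast x"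
    using arg_cong[OF e, of butlast] xne \<open>ss = []\<close> xy by (simp add: butlast_append)
  ultimately show False using c xne by simp
qed

lemma lex_least_power_free_unique: "\<exists>!w. lex_least_power_free w"
proof -
  define nxt where "nxt u = (LEAST c::nat. power_free (u @ [c]))" for u
  define pre where "pre = rec_nat [] (\<lambda>_ u. u @ [nxt u])"
  define w where "w n = nxt (pre n)" for n
  have pre: "pre n = map w [0..<n]" for n
    by (induction n) (simp_all add: pre_def w_def)
  have free: "power_free (map w [0..<n])" for n
  proof (induction n)
    case 0
    show ?case by (auto simp: power_free_def five_quarters_power_def)
  next
    case (Suc n)
    obtain c :: nat where "c \<notin> set (map w [0..<n])"
      using ex_new_if_finite[OF infinite_UNIV_nat finite_set] by blast
    hence "power_free (map w [0..<n] @ [c])"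
      using Suc.IH by (rule power_free_fresh[rotated])
    hence "power_free (map w [0..<n] @ [nxt (map w [0..<n])])"
      unfolding nxt_def by (rule LeastI)
    thus ?case by (simp add: w_def[of n] pre[of n])
  qed
  have least: "v = w \<or> less_fun w v" if v: "power_free_word v" for v
  proof (cases "v = w")
    case False
    then obtain m where "v m \<noteq> w m" by auto
    define n where "n = (LEAST m. v m \<noteq> w m)"
    have n: "v n \<noteq> w n" unfolding n_def by (rule LeastI) fact
    have eq: "v k = w k" if "k < n" for k
      using not_less_Least[of k "\<lambda>m. v m \<noteq> w m"] that unfolding n_def by blast
    have "power_free (map v [0..<Suc n])"
      using v power_free_prefixes by blast
    moreover have "map v [0..<Suc n] = map w [0..<n] @ [v n]"
      using eq by simp
    ultimately have "power_free (map w [0..<n] @ [v n])" by metis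
    hence "nxt (map w [0..<n]) \<le> v n"
      unfolding nxt_def by (simp add: Least_le)
    hence "w n < v n" using n by (simp add: w_def[of n] pre[of n])
    thus ?thesis using eq unfolding less_fun_def by auto
  qed simp
  have w: "lex_least_power_free w"
    unfolding lex_least_power_free_def power_free_prefixes using free least
    by (auto simp: power_free_prefixes)
  show ?thesis
  proof (rule ex1I[of lex_least_power_free, OF w])
    fix v assume "lex_least_power_free v"
    thus "v = w"
      using w less_fun_asym unfolding lex_least_power_free_def by metis
  qed
qed

lemma lex_least_power_free_w54: "lex_least_power_free w54"
  unfolding w54_def by (rule theI'[OF lex_least_power_free_unique])

text \<open>
  Rational sequences form a vector space over the rationals under pointwise addition (from
  \<^theory>\<open>HOL-Library.Function_Algebras\<close>) and the following scaling.
\<close>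

definition seq_scale :: "rat \<Rightarrow> (nat \<Rightarrow> rat) \<Rightarrow> (nat \<Rightarrow> rat)" where
  "seq_scale c s = (\<lambda>i. c * s i)"

interpretation ratseq: vector_space seq_scale
  by unfold_locales (auto simp: seq_scale_def fun_eq_iff algebra_simps)

definition kernel :: "nat \<Rightarrow> (nat \<Rightarrow> 'a) \<Rightarrow> (nat \<Rightarrow> 'a) set" where
  "kernel k s = {(\<lambda>i. s (k ^ e * i + j)) | e j. j < k ^ e}"

definition regular :: "nat \<Rightarrow> (nat \<Rightarrow> rat) \<Rightarrow> bool" where
  "regular k s \<longleftrightarrow> k \<ge> 2 \<and> (\<exists>B. finite B \<and> ratseq.span B = ratseq.span (kernel k s))"

text \<open>
  The library's \<open>dim\<close> also returns \<open>0\<close> for infinite-dimensional spaces, so this number is the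
  rank only in conjunction with regularity.
\<close>

definition rank :: "nat \<Rightarrow> (nat \<Rightarrow> rat) \<Rightarrow> nat" where
  "rank k s = ratseq.dim (ratseq.span (kernel k s))"

end

(*
  The letters of w at even positions are 0, 0, 1, 1 periodically, because repetitions at distance 4
  are forbidden. Hence w is governed by the sequence v of letters at odd positions, which is the least
  one without 5/4-powers and without equal letters at distance 2. After a transient of 3637 letters
  only every sixth letter of v is not periodic, namely v(6 j + 3) = y(j) + 2, and y is subject to the
  same rules as v; after a further transient y is a shifted copy of v. So v is described by two finite
  tables and a recurrence. A 5/4-power in v outside of the transients gives a shorter one in y, and
  for the minimality a power that excludes a letter of y is stretched to one in v. What remains are
  finite checks on the tables.

  For the rank, the recurrence shows that from i = 115 on every kernel sequence agrees with a
  combination of 73 explicit sequences, so the dimension is at most 73 + 115. Conversely, 188 kernel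
  sequences sampled at 188 points form a matrix of full rank modulo 3.
*)
theory Submission
  imports Defs
begin

section \<open>Reduction to the odd positions\<close>

text \<open>The transients shape the argument. A power with a long \<open>x\<close> that starts in a
  transient is reached neither by the recurrence nor by a finite check. Its second \<open>x\<close>,
  however, lies so far out that two of the three residue classes modulo 3 carry the constant letters
  0 and 1. If 3 does not divide the length of \<open>x\<close>, the shift carries a letter into a
  class where it cannot stand; if 3 divides it, a long first \<open>x\<close> contains an irregular
  position. The bounds 911 for v and 700 for y make every relevant window long enough for this.

  Freeness of v and y is one induction on the length of \<open>x\<close>: going from v to y divides
  it by 6, going back to v keeps it. Minimality is an induction on the position; the blocking powers
  must stay inside the regular part, hence the lower bounds on their starting positions.

  For the rank, sections of depth at least 3 are periodic or read y along \<open>18 * i + d\<close>,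
  up to a constant. One more section replaces \<open>d\<close> by
  \<open>(18 * j + d - 7298) / 6\<close>, a contraction, so that only finitely many offsets occur.
  Full rank modulo 3 gives independence over the rationals, since a common factor 3 can be cancelled
  from the coefficients of an integer relation.\<close>

definition rep :: "(nat \<Rightarrow> 'a) \<Rightarrow> nat \<Rightarrow> nat \<Rightarrow> bool" where
  "rep f m s \<longleftrightarrow> (\<forall>k<m. f (s + k) = f (s + k + 4 * m))"

lemma five_quarters_power_segment:
  "five_quarters_power (map f [i..<i + n]) \<longleftrightarrow> (\<exists>m\<ge>1. n = 5 * m \<and> rep f m i)"
proof
  assume "five_quarters_power (map f [i..<i + n])"
  then obtain x y where xy: "map f [i..<i + n] = x @ y @ x" "length x \<ge> 1" "length y = 3 * length x"
    unfolding five_quarters_power_def by blast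
  let ?m = "length x"
  have n: "n = 5 * ?m" using arg_cong[OF xy(1), of length] xy(3) by simp
  have "f (i + k) = f (i + k + 4 * ?m)" if "k < ?m" for k
  proof -
    have "f (i + k) = map f [i..<i + n] ! k" using n that by simp
    also have "\<dots> = x ! k" using that by (simp add: xy(1) nth_append)
    also have "\<dots> = map f [i..<i + n] ! (k + 4 * ?m)" using that xy(3) by (simp add: xy(1) nth_append)
    also have "\<dots> = f (i + k + 4 * ?m)" using n that by (simp add: ac_simps)
    finally show ?thesis .
  qed
  thus "\<exists>m\<ge>1. n = 5 * m \<and> rep f m i" using n xy(2) unfolding rep_def by blast
next
  assume "\<exists>m\<ge>1. n = 5 * m \<and> rep f m i"
  then obtain m where m: "m \<ge> 1" "n = 5 * m" "rep f m i" by blast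
  have app: "[a..<c] = [a..<b] @ [b..<c]" if "a \<le> b" "b \<le> c" for a b c :: nat
    using upt_add_eq_append[of a b "c - b"] that by simp
  have split: "[i..<i + n] = [i..<i + m] @ [i + m..<i + 4 * m] @ [i + 4 * m..<i + 5 * m]"
    using app[of i "i + m" "i + 5 * m"] app[of "i + m" "i + 4 * m" "i + 5 * m"] m(2) by simp
  have "map f [i + 4 * m..<i + 5 * m] = map f [i..<i + m]"
    using m(3) unfolding rep_def by (intro nth_equalityI) (auto simp: ac_simps)
  thus "five_quarters_power (map f [i..<i + n])"
    unfolding five_quarters_power_def split map_append using m(1)
    by (intro exI[of _ "map f [i..<i + m]"] exI[of _ "map f [i + m..<i + 4 * m]"]) simp
qed

lemma power_free_word_rep: "power_free_word f \<longleftrightarrow> (\<forall>m\<ge>1. \<forall>s. \<not> rep f m s)"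
  unfolding power_free_word_def five_quarters_power_segment by blast

text \<open>
  The letter \<open>c\<close> cannot be placed at position \<open>n\<close>: it would complete a power that starts at
  \<open>a\<close> or later.
\<close>

definition blocked :: "(nat \<Rightarrow> 'a) \<Rightarrow> nat \<Rightarrow> nat \<Rightarrow> 'a \<Rightarrow> bool" where
  "blocked f a n c \<longleftrightarrow> (\<exists>m\<ge>1. a + 5 * m \<le> n + 1 \<and> f (n - 4 * m) = c \<and>
     (\<forall>k. 1 \<le> k \<and> k < m \<longrightarrow> f (n - k) = f (n - k - 4 * m)))"

text \<open>At the first difference from a competitor \<open>u\<close>, a smaller letter of
  \<open>u\<close> is blocked in \<open>f\<close>. Apart from that letter the blocking power only
  involves earlier positions, so it occurs in \<open>u\<close> as well.\<close>

lemma lex_least_power_freeI: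
  fixes f :: "nat \<Rightarrow> nat"
  assumes free: "power_free_word f" and min: "\<And>n c. c < f n \<Longrightarrow> blocked f 0 n c"
  shows "lex_least_power_free f"
  unfolding lex_least_power_free_def
proof (intro conjI allI impI free)
  fix u :: "nat \<Rightarrow> nat" assume u: "power_free_word u"
  show "u = f \<or> less_fun f u"
  proof (cases "u = f")
    case False
    then obtain n where n: "u n \<noteq> f n" "\<And>k. k < n \<Longrightarrow> u k = f k"
      using exists_least_iff[of "\<lambda>n. u n \<noteq> f n"] by blast
    have "\<not> u n < f n"
    proof
      assume "u n < f n"
      then obtain m where m: "m \<ge> 1" "5 * m \<le> n + 1" "f (n - 4 * m) = u n"
        "\<And>k. 1 \<le> k \<Longrightarrow> k < m \<Longrightarrow> f (n - k) = f (n - k - 4 * m)"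
        using min[of "u n" n] unfolding blocked_def by auto
      \<comment> \<open>The power ends at \<open>n\<close>. Its last pair of letters contains the
        blocked letter; the other pairs are counted backwards from \<open>n\<close> by
        \<open>l\<close>.\<close>
      have "rep u m (n + 1 - 5 * m)"
        unfolding rep_def
      proof (intro allI impI)
        fix k assume k: "k < m"
        show "u (n + 1 - 5 * m + k) = u (n + 1 - 5 * m + k + 4 * m)"
        proof (cases "k = m - 1")
          case True
          have "n + 1 - 5 * m + k = n - 4 * m" "n + 1 - 5 * m + k + 4 * m = n"
            using True m(1,2) by linarith+
          thus ?thesis using n(2)[of "n - 4 * m"] m by simp
        next
          case False
          define l where "l = m - 1 - k"
          have l: "1 \<le> l" "l < m" using False k by (auto simp: l_def)
          have "n + 1 - 5 * m + k = n - l - 4 * m" "n + 1 - 5 * m + k + 4 * m = n - l"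
            using k m(1,2) unfolding l_def by linarith+
          thus ?thesis using n(2)[of "n - l"] n(2)[of "n - l - 4 * m"] m(4)[OF l] l m(2) by simp
        qed
      qed
      thus False using u m(1) unfolding power_free_word_rep by blast
    qed
    hence "f n < u n" using n(1) by simp
    thus ?thesis unfolding less_fun_def using n(2) by (auto intro!: exI[of _ n])
  qed simp
qed

lemma w54_eqI: "lex_least_power_free f \<Longrightarrow> w54 = f"
  using lex_least_power_free_unique lex_least_power_free_w54 by blast

text \<open>The even positions have period 8 with letters 0, 0, 1, 1, so a shift by
  \<open>4 * m\<close> exchanges these letters for odd \<open>m\<close> and preserves them for even
  \<open>m\<close>.\<close>

definition interleave :: "(nat \<Rightarrow> nat) \<Rightarrow> nat \<Rightarrow> nat" where
  "interleave f n = (if even n then if n mod 8 < 4 then 0 else 1 else f (n div 2))"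

text \<open>
  The even columns of \<^term>\<open>interleave f\<close> rule out all powers with period not divisible by \<open>8\<close>,
  except that period \<open>4\<close> at an odd position must be excluded by \<open>f\<close>, as a repetition at distance \<open>2\<close>.
\<close>

definition admissible :: "(nat \<Rightarrow> 'a) \<Rightarrow> nat \<Rightarrow> bool" where
  "admissible f a \<longleftrightarrow> (\<forall>i\<ge>a. f i \<noteq> f (i + 2)) \<and> (\<forall>m\<ge>1. \<forall>s\<ge>a. \<not> rep f m s)"

text \<open>Counterpart of \<open>admissible\<close> for minimality: the letters that its two rules
  forbid at \<open>n\<close>. The bound \<open>a\<close> keeps the evidence away from the transient,
  so that it can be shifted and stretched.\<close>

definition excluded :: "(nat \<Rightarrow> 'a) \<Rightarrow> nat \<Rightarrow> nat \<Rightarrow> 'a \<Rightarrow> bool" where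
  "excluded f a n c \<longleftrightarrow> a + 2 \<le> n \<and> f (n - 2) = c \<or> blocked f a n c"

lemma interleave_odd: "interleave f (2 * i + 1) = f i"
  by (simp add: interleave_def)

lemma interleave_power_free:
  assumes f: "admissible f 0"
  shows "power_free_word (interleave f)"
  unfolding power_free_word_rep
proof (intro allI impI notI)
  fix m s assume m: "m \<ge> 1" and r: "rep (interleave f) m s"
  have r': "interleave f t = interleave f (t + 4 * m)" if "s \<le> t" "t < s + m" for t
    using r that unfolding rep_def by (metis le_add_diff_inverse nat_add_left_cancel_less)
  show False
  proof (cases "even m")
    case False
    have ev: "interleave f t \<noteq> interleave f (t + 4 * m)" if "even t" for t
    proof -
      obtain b where "m = 2 * b + 1" using False by (elim oddE)
      hence "(t + 4 * m) mod 8 = (t + 4) mod 8" by (simp add: mod_simps algebra_simps) presburger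
      moreover have "(t + 4) mod 8 < 4 \<longleftrightarrow> \<not> t mod 8 < 4" by presburger
      ultimately show ?thesis using that by (simp add: interleave_def)
    qed
    show False
    proof (cases "even s")
      case True thus False using ev[of s] r'[of s] m by auto
    next
      case sodd: False
      show False
      \<comment> \<open>A single letter at an odd position is the only window without an even
        position.\<close>
      proof (cases "m = 1")
        case True
        obtain i where "s = 2 * i + 1" using sodd by (elim oddE)
        moreover from this have "s + 4 * m = 2 * (i + 2) + 1" using True by simp
        ultimately have "f i = f (i + 2)"
          using r'[of s] m interleave_odd[of f i] interleave_odd[of f "i + 2"] by (metis less_add_same_cancel1
            le_refl less_le_trans zero_less_one)
        thus False using f unfolding admissible_def by blast
      next
        case F: False
        hence "s + 1 < s + m" using m by linarith
        thus False using ev[of "s + 1"] r'[of "s + 1"] sodd by simp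
      qed
    qed
  next
    case True
    then obtain b where b: "m = 2 * b" by (elim evenE)
    \<comment> \<open>Whatever the parity of \<open>s\<close>, the odd positions among
      \<open>2 * b\<close> consecutive ones are \<open>2 * (s div 2 + k) + 1\<close> for
      \<open>k < b\<close>.\<close>
    have "rep f b (s div 2)"
      unfolding rep_def
    proof (intro allI impI)
      fix k assume "k < b"
      hence "interleave f (2 * (s div 2 + k) + 1) = interleave f (2 * (s div 2 + k) + 1 + 4 * m)"
        by (intro r') (use b in presburger)+
      moreover have "2 * (s div 2 + k) + 1 + 4 * m = 2 * (s div 2 + k + 4 * b) + 1" using b by simp
      ultimately show "f (s div 2 + k) = f (s div 2 + k + 4 * b)"
        using interleave_odd[of f "s div 2 + k"] interleave_odd[of f "s div 2 + k + 4 * b"] by metis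
    qed
    thus False using f m b unfolding admissible_def by (cases b) auto
  qed
qed

text \<open>Distance 2 in \<open>f\<close> becomes distance 4, a power with \<open>m = 1\<close>. A
  power of \<open>f\<close> with parameter \<open>m\<close> becomes one with \<open>2 * m\<close>;
  its even positions agree because the shift \<open>8 * m\<close> is a multiple of their period
  8.\<close>

lemma interleave_blocked:
  assumes f: "\<And>n c. c < f n \<Longrightarrow> excluded f 0 n c" and c: "c < interleave f n"
  shows "blocked (interleave f) 0 n c"
proof (cases "even n")
  case True
  hence n: "n mod 8 \<ge> 4" "c = 0" using c by (auto simp: interleave_def split: if_splits)
  have "n \<ge> 4" using n(1) mod_less_eq_dividend[of n 8] by linarith
  have "n - 4 = n mod 8 - 4 + 8 * (n div 8)" using n(1) mult_div_mod_eq[of 8 n] by linarith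
  hence "(n - 4) mod 8 = (n mod 8 - 4) mod 8" by (metis mod_mult_self2)
  hence "(n - 4) mod 8 < 4" by simp
  thus ?thesis using True n \<open>n \<ge> 4\<close> unfolding blocked_def
    by (intro exI[of _ 1]) (auto simp: interleave_def)
next
  case False
  then obtain i where i: "n = 2 * i + 1" by (elim oddE)
  hence "c < f i" using c interleave_odd by metis
  from f[OF this] show ?thesis
    unfolding excluded_def
  proof
    assume h: "0 + 2 \<le> i \<and> f (i - 2) = c"
    hence "n - 4 = 2 * (i - 2) + 1" using i by arith
    thus ?thesis using h i interleave_odd[of f "i - 2"] unfolding blocked_def
      by (intro exI[of _ 1]) auto
  next
    assume "blocked f 0 i c"
    then obtain m where m: "m \<ge> 1" "5 * m \<le> i + 1" "f (i - 4 * m) = c"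
      "\<And>k. 1 \<le> k \<Longrightarrow> k < m \<Longrightarrow> f (i - k) = f (i - k - 4 * m)"
      unfolding blocked_def by auto
    have e: "interleave f (n - 4 * (2 * m)) = c"
    proof -
      have "n - 4 * (2 * m) = 2 * (i - 4 * m) + 1" using i m(2) by simp
      thus ?thesis using m(3) interleave_odd by metis
    qed
    have "interleave f (n - k) = interleave f (n - k - 4 * (2 * m))" if k: "1 \<le> k" "k < 2 * m" for k
    proof (cases "even k")
      case True
      then obtain l where l: "k = 2 * l" by (elim evenE)
      have "n - k = 2 * (i - l) + 1" "n - k - 4 * (2 * m) = 2 * (i - l - 4 * m) + 1"
        using i l k m(2) by simp_all
      thus ?thesis using m(4)[of l] l k interleave_odd[of f "i - l"]
          interleave_odd[of f "i - l - 4 * m"] by simp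
    next
      case False
      have "even (n - k)" using False i k m(2) by simp
      moreover have "n - k = (n - k - 4 * (2 * m)) + m * 8" using i k m(2) by simp
      hence "(n - k) mod 8 = (n - k - 4 * (2 * m)) mod 8" by (metis mod_mult_self1)
      moreover have "even (n - k - 4 * (2 * m))" using \<open>even (n - k)\<close> i k m(2) by simp
      ultimately show ?thesis by (simp add: interleave_def)
    qed
    thus ?thesis unfolding blocked_def using e m(1,2) i by (intro exI[of _ "2 * m"]) auto
  qed
qed

section \<open>The letters at odd positions\<close>

definition v_table_0 :: "nat list" where "v_table_0 =
   [0,0,1,1,2,2,0,0,1,1,2,2,0,0,3,1,1,2,0,3,2,0,1,1,0,2,2,0,1,1,0,2,2,0,3,1,0] @
   [3,1,0,2,1,0,3,1,0,2,1,0,2,1,0,3,1,0,2,1,0,3,1,0,3,2,0,1,1,0,3,2,0,1,1,0,2] @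
   [2,0,3,1,0,2,2,0,3,1,0,3,1,0,3,2,0,1,1,0,2,2,0,1,1,0,2,2,0,3,1,0,3,1,0,2,1] @
   [0,3,1,0,2,1,0,2,1,0,3,1,0,2,1,0,3,1,0,3,2,0,1,1,0,3,2,0,1,1,0,2,2,0,3,1,0] @
   [2,2,0,3,1,0,3,1,0,3,2,0,1,1,0,2,2,0,1,1,0,2,2,0,3,1,0,3,1,0,2,1,0,3,1,0,2] @
   [1,0,2,1,0,3,1,0,2,1,0,3,1,0,3,2,0,1,1,0,3,2,0,1,1,0,2,2,0,3,1,0,2,2,0,3,1] @
   [0,3,1,0,3,2,0,1,1,0,2,2,0,1,1,0,2,2,0,3,1,0,3,1,0,2,1,0,3,1,0,2,1,0,2,1,0] @
   [3,1,0,2,1,0,3,1,0,3,2,0,1,1,0,3,2,0,1,1,0,2,2,0,3,1,0,2,2,0,3,1,0,3,1,0,3] @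
   [2,0,1,1,0,2,2,0,1,1,0,2,2,0,3,1,0,3,1,0,2,1,0,3,1,0,2,1,0,2,1,0,3,1,0,2,1] @
   [0,3,1,0,3,2,0,1,1,0,3,2,0,1,1,0,2,2,0,3,1,0,2,2,0,3,1,0,3,4,0,1,1,0,3,3,0]"

definition v_table_1 :: "nat list" where "v_table_1 =
   [1,1,0,2,3,0,1,3,0,1,2,0,1,2,0,1,2,0,1,2,0,1,3,0,1,3,0,1,3,0,1,3,0,2,2,0,1] @
   [1,0,2,2,0,1,1,0,2,3,0,1,3,0,2,3,0,1,3,0,1,2,0,1,4,0,1,2,0,1,2,0,1,3,0,1,2] @
   [0,1,3,0,1,3,0,2,2,0,1,3,0,1,2,0,1,4,0,1,2,0,3,2,0,1,1,0,2,2,0,1,1,0,2,2,0] @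
   [3,1,0,3,1,0,2,1,0,3,1,0,2,1,0,2,1,0,3,1,0,2,1,0,3,1,0,3,2,0,1,1,0,3,2,0,1] @
   [1,0,2,2,0,3,3,0,1,1,0,2,2,0,1,1,0,2,2,0,1,3,0,1,2,0,3,2,0,1,1,0,2,2,0,1,1] @
   [0,2,2,0,4,1,0,3,1,0,2,1,0,3,1,0,2,1,0,2,1,0,3,1,0,2,1,0,3,1,0,3,1,0,4,1,0] @
   [3,1,0,4,1,0,2,1,0,2,1,0,2,1,0,2,1,0,3,1,0,3,1,0,3,1,0,3,1,0,2,1,0,4,1,0,2] @
   [1,0,4,1,0,3,1,0,2,1,0,3,1,0,2,1,0,2,3,0,1,1,0,2,2,0,1,1,0,3,2,0,1,2,0,1,2] @
   [0,3,2,0,1,1,0,2,2,0,3,1,0,2,1,0,2,1,0,3,1,0,2,1,0,3,1,0,3,1,0,2,1,0,3,1,0] @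
   [2,2,0,1,1,0,3,2,0,1,1,0,3,2,0,3,1,0,2,2,0,3,1,0,2,1,0,3,3,0,1,1,0,2,2,0,1]"

definition v_table_2 :: "nat list" where "v_table_2 =
   [1,0,2,2,0,1,3,0,1,2,0,3,2,0,1,1,0,2,2,0,1,1,0,2,2,0,3,1,0,3,1,0,2,1,0,3,1] @
   [0,2,1,0,2,1,0,3,1,0,2,1,0,3,1,0,3,2,0,1,1,0,3,2,0,1,1,0,2,2,0,3,1,0,2,2,0] @
   [3,1,0,3,1,0,3,2,0,1,1,0,2,2,0,1,1,0,2,2,0,3,1,0,3,1,0,2,1,0,3,1,0,2,1,0,2] @
   [1,0,3,1,0,2,1,0,3,1,0,3,2,0,1,1,0,3,2,0,1,1,0,2,2,0,3,1,0,2,2,0,3,1,0,3,1] @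
   [0,3,2,0,1,1,0,2,2,0,1,1,0,2,2,0,3,1,0,3,1,0,2,1,0,3,1,0,2,1,0,2,1,0,3,1,0] @
   [2,1,0,3,1,2,2,0,0,1,1,2,2,0,0,1,1,2,3,0,0,3,1,1,2,0,3,2,0,1,1,0,2,2,0,1,1] @
   [0,2,2,0,3,1,0,3,1,0,2,1,0,3,1,0,2,1,0,2,1,0,3,1,0,2,1,0,3,1,0,3,2,0,1,2,0] @
   [1,2,0,1,2,0,1,2,0,3,2,0,3,1,0,2,1,0,2,3,0,1,1,0,2,2,0,1,1,0,3,2,0,1,2,0,3] @
   [2,0,3,1,0,2,1,0,2,1,0,2,1,0,2,1,0,3,1,0,3,1,0,3,1,0,3,1,0,2,2,0,1,1,0,2,2] @
   [0,1,1,0,3,3,0,1,2,0,1,2,0,3,2,0,1,1,0,2,2,0,3,1,0,2,1,0,2,1,0,3,1,0,2,1,0]"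

definition v_table_3 :: "nat list" where "v_table_3 =
   [3,1,0,3,1,0,2,1,0,3,1,0,2,2,0,1,1,0,3,2,0,1,1,0,3,2,0,3,1,0,2,2,0,3,1,0,2] @
   [1,0,3,3,0,1,1,0,2,2,0,1,1,0,2,2,0,1,3,0,1,2,0,3,2,0,1,1,0,2,2,0,1,1,0,2,2] @
   [0,3,1,0,3,1,0,2,1,0,3,1,0,2,1,0,2,1,0,3,1,0,2,1,0,3,1,0,3,2,0,1,1,0,3,2,0] @
   [1,1,0,2,2,0,3,1,0,2,2,0,3,1,0,3,1,0,3,2,0,1,1,0,2,2,0,1,1,0,2,2,0,3,1,0,3] @
   [1,0,2,1,0,3,1,0,2,1,0,2,1,0,3,1,0,2,1,0,3,1,0,3,2,0,1,1,0,3,2,0,1,1,0,2,2] @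
   [0,3,1,0,2,2,0,3,1,0,3,1,0,3,2,0,1,1,0,2,2,0,1,1,0,2,2,0,3,1,0,3,1,0,2,1,0] @
   [3,1,0,2,1,0,2,1,0,3,1,0,2,1,0,3,1,0,3,2,0,1,1,0,3,2,0,3,2,0,1,1,0,2,2,0,1] @
   [1,0,2,2,0,3,1,0,3,1,0,2,1,0,4,1,0,2,1,0,2,1,0,3,1,0,2,1,0,3,1,0,3,2,0,1,1] @
   [0,3,2,0,1,1,0,4,2,0,3,1,0,2,2,0,3,1,0,2,1,0,2,1,0,3,1,0,2,1,0,3,1,0,3,1,0] @
   [2,1,0,3,1,0,2,2,0,1,1,0,3,2,0,1,1,0,3,2,0,3,1,0,2,2,0,3,1,0,4,1,0,2,1,0,3]"

definition v_table_4 :: "nat list" where "v_table_4 =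
   [1,0,2,1,0,2,1,0,3,1,0,2,1,0,3,1,0,3,1,0,2,1,0,4,1,0,2,1,0,4,1,0,3,1,0,3,1] @
   [0,3,1,0,2,1,0,2,1,0,2,1,0,2,1,0,3,1,0,3,1,0,4,1,0,3,1,0,4,1,0,2,1,0,3,1,0] @
   [2,1,0,2,3,0,1,1,0,2,2,0,1,1,0,3,2,0,1,2,0,1,2,0,3,2,0,1,1,0,2,2,0,3,1,0,2] @
   [1,0,2,1,0,3,1,0,2,1,0,3,1,0,3,1,0,2,1,0,3,1,0,2,2,0,1,1,0,3,2,0,1,1,0,3,2] @
   [0,3,1,0,2,2,0,3,1,0,2,1,0,3,3,0,1,1,0,2,2,0,1,1,0,2,2,0,1,3,0,1,2,0,3,2,0] @
   [1,1,0,2,2,0,1,1,0,2,2,0,3,1,0,3,1,0,2,1,0,3,1,0,2,1,0,2,3,0,1,1,0,2,3,0,1] @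
   [1,0,3,2,0,1,2,0,1,2,0,1,2,0,1,2,0,3,2,0,3,1,0,2,1,0,2,1,0,2,1,0,2,1,0,3,1] @
   [0,3,1,0,3,1,0,3,1,0,2,2,0,1,1,0,2,2,0,1,1,0,3,2,0,3,1,0,3,2,0,3,1,0,2,1,0] @
   [2,3,0,1,1,0,2,2,0,1,1,0,3,2,0,1,2,0,1,2,0,3,2,0,1,1,0,2,2,0,3,1,0,2,1,0,3] @
   [1,0,3,1,0,2,1,0,3,1,0,2,1,0,2,1,0,3,1,0,2,2,0,1,1,0,3,2,0,1,1,0,3,2,0,3,1]"

definition v_table_5 :: "nat list" where "v_table_5 =
   [0,2,1,0,2,1,0,2,1,0,2,1,0,3,1,0,3,1,0,3,1,0,3,1,0,2,2,0,1,1,0,2,2,0,1,1,0] @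
   [3,2,0,3,1,0,3,2,0,3,1,0,2,1,0,3,3,0,1,1,0,2,2,0,1,1,0,2,2,0,1,3,0,1,2,0,3] @
   [2,0,1,1,0,2,2,0,1,1,0,2,2,0,3,1,0,3,1,0,2,1,0,3,1,0,2,1,0,2,1,0,3,1,0,2,1] @
   [0,3,1,0,3,2,0,1,1,0,3,2,0,1,1,0,2,2,0,3,1,0,2,2,0,3,1,0,3,1,0,3,2,0,1,1,0] @
   [2,2,0,1,1,0,2,2,0,3,1,0,3,1,0,2,1,0,3,1,0,2,1,0,2,1,0,3,1,0,2,1,0,3,1,0,3] @
   [2,0,1,1,0,3,2,0,1,1,0,2,2,0,3,1,0,2,2,0,3,1,0,3,1,0,3,2,0,1,1,0,2,2,0,1,1] @
   [0,2,2,0,3,1,0,3,1,0,2,1,0,3,1,0,2,1,0,2,1,0,3,1,0,2,1,0,3,1,0,3,2,0,1,1,0] @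
   [3,2,0,1,1,0,2,2,0,3,1,0,2,2,0,3,1,0,3,1,0,3,2,0,1,1,0,2,2,0,1,1,0,2,2,0,3] @
   [1,0,3,1,0,2,1,0,3,1,0,2,1,0,2,1,0,3,1,0,2,1,0,3,1,0,3,2,0,1,1,0,3,2,0,1,1] @
   [0,2,2,0,3,1,0,2,2,0,3,1,0,3,1,0,3,2,0,1,1,0,2,2,0,1,1,0,2,2,0,3,1,0,3,1,0]"

definition v_table_6 :: "nat list" where "v_table_6 =
   [2,1,0,3,1,0,2,1,0,2,1,0,3,1,0,2,1,0,3,1,0,3,2,0,1,1,0,3,2,0,1,1,0,2,2,0,3] @
   [1,0,2,2,0,3,1,0,3,4,0,1,1,0,3,3,0,1,1,0,2,3,0,1,3,0,1,2,0,1,2,0,1,2,0,1,2] @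
   [0,1,3,0,1,3,0,1,3,0,1,3,0,2,2,0,1,1,0,2,2,0,1,1,0,2,3,0,1,3,0,2,3,0,1,3,0] @
   [1,2,0,1,4,0,1,2,0,1,2,0,1,3,0,1,2,0,1,3,0,1,3,0,2,2,0,1,3,0,1,2,0,1,4,0,1] @
   [2,0,3,2,0,1,1,0,2,2,0,1,1,0,2,2,0,3,1,0,3,1,0,2,1,0,3,3,0,1,1,0,2,3,0,1,1] @
   [0,2,3,0,2,1,0,3,1,0,3,1,0,3,1,0,2,2,0,1,1,0,2,2,0,1,1,0,3,2,0,3,1,0,3,2,0] @
   [3,1,0,2,1,0,2,1,0,2,1,0,2,1,0,3,1,0,3,1,0,3,1,0,3,1,0,4,1,0,2,1,0,4,1,0,2] @
   [1,0,2,1,0,3,1,0,2,1,0,3,1,0,3,1,0,2,1,0,3,1,0,2,1,0,4,1,0,3,1,0,4,1,0,3,1] @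
   [0,2,1,0,2,1,0,2,1,0,2,1,0,3,3,0,1,1,0,3,2,0,1,1,0,2,2,0,1,3,0,1,2,0,3,2,0] @
   [1,1,0,2,2,0,1,1,0,2,2,0,3,1,0,3,1,0,2,1,0,3,1,0,2,1,0,2,1,0,3,1,0,2,1,0,3]"

definition v_table_7 :: "nat list" where "v_table_7 =
   [1,0,3,2,0,1,1,0,3,2,0,1,1,0,2,2,0,3,1,0,2,2,0,3,1,0,3,1,0,3,2,0,1,1,0,2,2] @
   [0,1,1,0,2,2,0,3,1,0,3,1,0,2,1,0,3,1,0,2,1,0,2,1,0,3,3,0,1,1,0,3,2,0,1,1,0] @
   [2,2,0,1,3,0,1,2,0,3,2,0,1,1,0,2,2,0,1,1,0,2,2,0,3,1,0,3,1,0,2,1,0,3,1,0,2] @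
   [1,0,2,1,0,3,1,0,2,1,0,3,1,0,3,2,0,1,1,0,3,2,0,1,1,0,2,2,0,3,1,0,2,2,0,3,1] @
   [0,3,1,0,3,2,0,1,1,0,2,2,0,1,1,0,2,2,0,3,1,0,3,1,0,2,1,0,3,1,0,2,1,0,2,1,0] @
   [3,1,0,2,1,0,3,1,0,3,2,0,1,2,0,1,2,0,1,2,0,1,2,0,3,2,0,3,1,0,2,1,0,2,3,0,1] @
   [1,0,2,2,0,1,1,0,3,2,0,1,2,0,3,2,0,3,1,0,2,1,0,2,1,0,2,1,0,2,1,0,3,1,0,3,1] @
   [0,3,1,0,3,1,0,2,2,0,1,1,0,2,2,0,1,1,0,3,3,0,1,2,0,1,2,0,3,2,0,1,1,0,2,2,0] @
   [3,1,0,2,1,0,2,1,0,3,1,0,2,1,0,3,1,0,3,1,0,2,1,0,3,1,0,2,2,0,1,1,0,3,2,0,1] @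
   [1,0,3,2,0,3,1,0,2,2,0,3,1,0,2,1,0,3,3,0,1,1,0,2,2,0,1,1,0,2,2,0,1,3,0,1,2]"

definition v_table_8 :: "nat list" where "v_table_8 =
   [0,3,2,0,1,1,0,2,2,0,1,1,0,2,2,0,3,1,0,3,1,0,2,1,0,3,1,0,2,1,0,2,1,0,3,1,0] @
   [2,1,0,3,1,0,3,2,0,1,1,0,3,2,0,1,1,0,2,2,0,4,1,0,2,1,0,2,1,0,3,1,0,2,1,0,3] @
   [1,0,3,1,0,2,1,0,3,1,0,2,1,0,4,1,0,3,1,0,4,1,0,3,1,0,2,1,0,2,1,0,2,1,0,2,1] @
   [0,3,1,0,3,1,0,3,1,0,3,1,0,4,1,0,2,1,0,4,1,0,2,1,0,2,1,0,3,1,0,2,1,0,3,3,0] @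
   [1,1,0,2,2,0,1,1,0,2,2,0,1,3,0,1,2,0,3,2,0,1,1,0,2,2,0,1,1,0,2,2,0,3,1,0,3] @
   [1,0,2,1,0,3,1,0,2,1,0,2,1,0,3,1,0,2,1,0,4,1,0,3,1,0,4,1,0,3,1,0,3,1,0,2,1] @
   [0,2,1,0,2,1,0,2,1,0,3,1,0,3,1,0,3,1,0,4,1,0,2,1,0,4,1,0,2,1,0,3,1,0,3,1,0] @
   [2,1,0,3,1,0,2,1,0,2,3,0,1,1,0,2,2,0,1,1,0,3,2,0,1,2,0,1,2,0,3,2,0,1,1,0,2] @
   [2,0,3,1,0,2,1,0,2,1,0,3,1,0,2,1,0,3,1,0,3,1,0,2,1,0,4,1,0,2,1,0,4,1,0,3,1] @
   [0,3,1,0,3,1,0,2,1,0,2,1,0,2,1,0,2,1,0,3,1,0,3,1,0,4,1,0,3,1,0,4,1,0,2,1,0]"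

definition v_table_9 :: "nat list" where "v_table_9 =
   [3,1,0,2,1,0,2,1,0,3,1,0,2,1,0,3,3,0,1,1,0,2,2,0,1,1,0,2,2,0,1,3,0,1,2,0,3] @
   [2,0,1,1,0,2,2,0,1,1,0,2,2,0,3,1,0,3,1,0,2,1,0,4,1,0,2,1,0,2,1,0,3,1,0,2,1] @
   [0,4,1,0,3,1,0,4,1,0,3,1,0,2,1,0,4,1,0,2,1,0,2,1,0,3,1,0,2,1,0,3,1,0,3,1,0] @
   [4,1,0,3,1,0,2,1,0,4,1,0,2,1,0,4,1,0,3,1,0,2,1,0,3,1,0,3,1,0,4,1,0,3,1,0,2] @
   [1,0,2,1,0,2,1,0,2,1,0,4,1,0,3,1,0,3,1,0,3,1,0,3,1,0,2,1,0,4,1,0,2,1,0,2,1] @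
   [0,3,1,0,2,1,0,3,1,0,4,1,0,2,1,0,3,1,0,2,1,0,3,1,0,3,1,0,4,1,0,4,1,0,2,1,0] @
   [2,1,0,2,1,0,2,1,0,4,1,0,4,1,0,3,1,0,3,1,0,2,1,0,3,1,0,2,1,0,4,1,0,3,1,0,2] @
   [1,0,3,1,0,2,1,0,2,1,0,4,1,0,2,1,0,3,1,0,3,1,0,3,1,0,3,1,0,4,1,0,2,1,0,2,1] @
   [0,2,1,0,2,1,0,3,1,0,4]"

definition v_table :: "nat list" where
  "v_table = v_table_0 @ v_table_1 @ v_table_2 @ v_table_3 @ v_table_4 @ v_table_5 @ v_table_6 @
    v_table_7 @ v_table_8 @ v_table_9"

lemma length_v_table:
  "length v_table_0 = 370" "length v_table_1 = 370" "length v_table_2 = 370" "length v_table_3 =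
  370" "length v_table_4 = 370" "length v_table_5 = 370" "length v_table_6 = 370" "length
  v_table_7 = 370" "length v_table_8 = 370" "length v_table_9 = 307"
  by (simp_all add: v_table_0_def v_table_1_def v_table_2_def v_table_3_def v_table_4_def v_table_5_def v_table_6_def v_table_7_def v_table_8_def v_table_9_def)

definition y_table_0 :: "nat list" where "y_table_0 =
   [0,2,2,0,1,3,0,1,2,0,1,2,0,1,2,0,3,2,0,1,1,0,2,2,0,3,1,0,2,1,0,2,1,0,3,1,0,2,1,0,3,1,0,3,1,0,2,1] @
   [0,3,1,0,2,2,0,1,1,0,3,2,0,1,1,0,3,2,0,3,1,0,2,2,0,3,1,0,2,1,0,3,3,0,1,1,0,2,2,0,1,1,0,2,2,0,1,3] @
   [0,1,2,0,3,2,0,1,1,0,2,2,0,1,1,0,2,2,0,3,1,0,3,1,0,2,1,0,3,1,0,2,1,0,2,1,0,3,1,0,2,1,0,3,1,0,3,2] @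
   [0,1,1,0,3,2,0,1,1,0,2,2,0,3,1,0,2,2,0,3,1,0,3,1,0,3,2,0,1,1,0,2,2,0,1,1,0,2,2,0,3,1,0,3,1,0,2,1] @
   [0,3,1,0,2,1,0,2,1,0,3,1,0,2,1,0,3,1,0,3,2,0,1,1,0,3,2,0,1,1,0,2,2,0,3,1,0,2,2,0,3,1,0,3,1,0,3,2] @
   [0,1,1,0,2,2,0,1,1,0,2,2,0,3,1,0,3,1,0,2,1,0,3,1,0,2,1,0,2,1,0,3,1,0,2,1,0,3,1,0,3,2,0,1,1,0,3,2] @
   [0,1,1,0,2,2,0,3,1,0,2,2,0,3,1,0,3,1,0,3,2,0,1,1,0,2,2,0,1,1,0,2,2,0,3,1,0,3,1,0,2,1,0,3,1,0,2,1] @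
   [0,2,1,0,3,1,0,2,1,0,3,1,0,3,2,0,1,1,0,3,2,0,1,1,0,2,2,0,3,1,0,2,2,0,3,1,0,3,1,0,3,2,0,1,1,0,2,2] @
   [0,1,1,0,2,2,0,3,1,0,3,1,0,2,1,0,3,1,0,2,1,0,2,1,0,3,1,0,2,1,0,3,1,0,3,2,0,1,1,0,3,2,0,1,1,0,2,2] @
   [0,3,1,0,2,2,0,3,1,0,3,4,0,1,1,0,3,3,0,1,1,0,2,3,0,1,3,0,1,2,0,1,2,0,1,2,0,1,2,0,1,3,0,1,3,0,1,3]"

definition y_table_1 :: "nat list" where "y_table_1 =
   [0,1,3,0,2,2,0,1,1,0,2,2,0,1,1,0,2,3,0,1,3,0,2,3,0,1,3,0,1,2,0,1,4,0,1,2,0,1,2,0,1,3,0,1,2,0,1,3] @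
   [0,1,3,0,2,2,0,1,3,0,1,2,0,1,4,0,1,2,0,3,2,0,1,1,0,2,2,0,1,1,0,2,2,0,3,1,0,3,1,0,2,1,0,3,1,0,2,1] @
   [0,2,1,0,3,1,0,2,1,0,3,1,0,3,2,0,1,1,0,3,2,0,1,1,0,2,2,0,3,3,0,1,1,0,2,2,0,1,1,0,2,2,0,1,3,0,1,2] @
   [0,3,2,0,1,1,0,2,2,0,1,1,0,2,2,0,4,1,0,3,1,0,2,1,0,3,1,0,2,1,0,2,1,0,3,1,0,2,1,0,3,1,0,3,1,0,4,1] @
   [0,3,1,0,4,1,0,2,1,0,2,1,0,2,1,0,2,1,0,3,1,0,3,1,0,3,1,0,3,1,0,2,1,0,4,1,0,2,1,0,4,1,0,3,1,0,2,1] @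
   [0,3,1,0,2,1,0,2,3,0,1,1,0,2,2,0,1,1,0,3,2,0,1,2,0,1,2,0,3,2,0,1,1,0,2,2,0,3,1,0,2,1,0,2,1,0,3,1] @
   [0,2,1,0,3,1,0,3,1,0,2,1,0,3,1,0,2,2,0,1,1,0,3,2,0,1,1,0,3,2,0,3,1,0,2,2,0,3,1,0,2,1,0,3,3,0,1,1] @
   [0,2,2,0,1,1,0,2,2,0,1,3,0,1,2,0,3,2,0,1,1,0,2,2,0,1,1,0,2,2,0,3,1,0,3,1,0,2,1,0,3,1,0,2,1,0,2,1] @
   [0,3,1,0,2,1,0,3,1,0,3,2,0,1,1,0,3,2,0,1,1,0,2,2,0,3,1,0,2,2,0,3,1,0,3,1,0,3,2,0,1,1,0,2,2,0,1,1] @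
   [0,2,2,0,3,1,0,3,1,0,3,2,0,1,1,0,2,2,0,1,1,0,2,2,0,3,1,0,3,1,0,2,1,0,3,1,0,2,1,0,2,1,0,3,1,0,2,1]"

definition y_table_2 :: "nat list" where "y_table_2 =
   [0,3,1,0,3,2,0,1,1,0,3,2,0,1,1,0,2,2,0,3,1,0,2,2,0,3,1,0,3,1,0,3,2,0,1,1,0,2,2,0,1,1,0,2,2,0,3,1] @
   [0,3,1,0,2,1,0,3,1,0,2,1,0,2,1,0,3,1,0,2,1,0,3,1,0,3,2,0,1,1,0,3,2,0,1,1,0,2,2,0,3,1,0,2,2,0,3,1] @
   [0,3,1,0,3,2,0,1,1,0,2,2,0,1,1,0,2,2,0,3,1,0,3,1,0,3,2,0,1,1,0,2,2,0,1,1,0,2,2,0,3,1,0,3,1,0,2,1] @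
   [0,3,1,0,2,1,0,2,1,0,3,1,0,2,1,0,3,1,0,3,2,0,1,1,0,3,2,0,1,1,0,2,2,0,3,1,0,2,2,0,3,1,0,3,1,0,3,2] @
   [0,1,1,0,2,2,0,1,1,0,2,2,0,3,1,0,3,1,0,2,1,0,3,1,0,2,1,0,2,1,0,3,1,0,2,1,0,3,1,0,3,2,0,3,2,0,1,1] @
   [0,2,2,0,1,1,0,2,2,0,3,1,0,3,1,0,2,1,0,3,1,0,3,2,0,1,1,0,3,2,0,1,1,0,2,2,0,3,1,0,2,2,0,3,1,0,3,1] @
   [0,2,1,0,3,1,0,2,1,0,2,1,0,3,1,0,2,1,0,3,1,0,4,1,0,2,1,0,4,1,0,2,1,0,3,1,0,3,1,0,3,1,0,3,1,0,2,1] @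
   [0,2,1,0,2,1,0,2,1,0,4,1,0,3,1,0,4,1,0,3,1,0,3,1,0,2,1,0,3,1,0,2,1,0,2,3,0,1,1,0,2,2,0,1,1,0,3,2] @
   [0,1,2,0,1,2,0,3,2,0,1,1,0,2,2,0,3,1,0,2,1,0,2,1,0,3,1,0,2,1,0,3,1,0,3,1,0,2,1,0,3,1,0,4,1,0,2,1] @
   [0,4,1,0,2,1,0,2,1,0,3,1,0,3,1,0,3,1,0,3,1,0,2,1,0,2,1,0,2,1,0,4,1,0,3,1,0,4,1,0,3,1,0,2,1,0,2,1]"

definition y_table_3 :: "nat list" where "y_table_3 =
   [0,3,1,0,2,1,0,3,3,0,1,1,0,2,2,0,1,1,0,2,2,0,1,3,0,1,2,0,3,2,0,1,1,0,2,2,0,1,1,0,2,2,0,3,1,0,3,1] @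
   [0,2,1,0,3,1,0,2,1,0,2,1,0,3,1,0,4,1,0,3,1,0,3,2,0,1,1,0,2,2,0,1,1,0,2,2,0,3,1,0,3,1,0,2,1,0,3,1] @
   [0,2,1,0,2,1,0,3,1,0,2,1,0,3,1,0,3,2,0,1,1,0,3,2,0,1,1,0,2,2,0,3,1,0,2,2,0,3,1,0,3,1,0,3,2,0,1,1] @
   [0,2,2,0,1,1,0,2,2,0,3,1,0,3,1,0,2,1,0,3,1,0,2,1,0,2,1,0,3,1,0,2,1,0,3,1,0,3,2,0,1,1,0,3,2,0,1,1] @
   [0,2,2,0,3,1,0,2,2,0,3,1,0,3,1,0,3,2,0,3,1,0,2,1,0,2,1,0,2,1,0,2,1,0,3,1,0,3,2,0,3,1,0,3,1,0,2,2] @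
   [0,1,1,0,2,2,0,1,1,0,3,2,0,3,1,0,3,1,0,2,1,0,2,1,0,2,1,0,2,1,0,3,1,0,3,1,0,3,1,0,3,2,0,1,1,0,2,2] @
   [0,1,1,0,2,2,0,3,1,0,3,2,0,3,1,0,3,1,0,3,2,0,1,1,0,2,2,0,1,1,0,2,2,0,3,1,0,3,1,0,2,1,0,3,1,0,2,1] @
   [0,2,1,0,4,1,0,2,1,0,3,1,0,3,2,0,1,1,0,3,2,0,1,1,0,2,2,0,3,1,0,2,1,0,2,1,0,3,1,0,2,1,0,3,1,0,3,1] @
   [0,2,1,0,3,1,0,2,2,0,1,1,0,3,2,0,1,1,0,3,2,0,3,1,0,2,2,0,3,1,0,2,1,0,3,3,0,1,1,0,2,2,0,1,1,0,2,2] @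
   [0,1,3,0,1,2,0,3,2,0,1,1,0,2,2,0,1,1,0,2,2,0,3,1,0,3,1,0,2,1,0,3,1,0,2,1,0,2,3,0,1,1,0,2,3,0,1,1]"

definition y_table_4 :: "nat list" where "y_table_4 =
   [0,3,2,0,1,2,0,1,2,0,1,2,0,1,2,0,3,2,0,3,1,0,2,1,0,2,1,0,2,1,0,2,1,0,3,1,0,3,1,0,3,1,0,3,1,0,2,2] @
   [0,1,1,0,2,2,0,1,1,0,3,2,0,3,1,0,3,2,0,3,1,0,2,1,0,2,3,0,1,1,0,2,2,0,1,1,0,3,2,0,1,2,0,1,2,0,3,2] @
   [0,1,1,0,2,2,0,3,1,0,2,1,0,3,1,0,3,1,0,2,1,0,3,1,0,2,1,0,2,1,0,3,1,0,2,2,0,1,1,0,3,2,0,1,1,0,3,2] @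
   [0,3,1,0,2,1,0,2,1,0,2,1,0,2,1,0,3,1,0,3,1,0,3,1,0,3,1,0,2,2,0,1,1,0,2,2,0,1,1,0,3,2,0,3,1,0,3,2] @
   [0,3,1,0,2,1,0,3,3,0,1,1,0,2,2,0,1,1,0,2,2,0,1,3,0,1,2,0,3,2,0,1,1,0,2,2,0,1,1,0,2,2,0,3,1,0,3,1] @
   [0,2,1,0,3,1,0,2,1,0,2,1,0,3,1,0,2,1,0,3,1,0,3,2,0,1,1,0,3,2,0,1,1,0,2,2,0,3,1,0,2,2,0,3,1,0,3,1] @
   [0,3,2,0,1,1,0,2,2,0,1,1,0,2,2,0,3,1,0,3,1,0,2,1,0,3,1,0,2,1,0,2,1,0,3,1,0,2,1,0,3,1,0,3,2,0,1,1] @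
   [0,3,2,0,1,1,0,2,2,0,3,1,0,2,2,0,3,1,0,3,1,0,3,2,0,1,1,0,2,2,0,1,1,0,2,2,0,3,1,0,3,1,0,2,1,0,3,1] @
   [0,2,1,0,2,1,0,3,1,0,2,1,0,3,1,0,3,2,0,1,1,0,3,2,0,1,1,0,2,2,0,3,1,0,2,2,0,3,1,0,3,1,0,3,2,0,1,1] @
   [0,2,2,0,1,1,0,2,2,0,3,1,0,3,1,0,2,1,0,3,1,0,2,1,0,2,1,0,3,1,0,2,1,0,3,1,0,3,2,0,1,1,0,3,2,0,1,1]"

definition y_table_5 :: "nat list" where "y_table_5 =
   [0,2,2,0,3,1,0,2,2,0,3,1,0,3,1,0,3,2,0,1,1,0,2,2,0,1,1,0,2,2,0,3,1,0,3,1,0,2,1,0,3,1,0,2,1,0,2,1] @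
   [0,3,1,0,2,1,0,3,1,0,3,2,0,1,1,0,3,2,0,1,1,0,2,2,0,3,1,0,2,2,0,3,1,0,3,4,0,1,1,0,3,3,0,1,1,0,2,3] @
   [0,1,3,0,1,2,0,1,2,0,1,2,0,1,2,0,1,3,0,1,3,0,1,3,0,1,3,0,2,2,0,1,1,0,2,2,0,1,1,0,2,3,0,1,3,0,2,3] @
   [0,1,3,0,1,2,0,1,4,0,1,2,0,1,2,0,1,3,0,1,2,0,1,3,0,1,3,0,2,2,0,1,3,0,1,2,0,1,4,0,1,2,0,3,2,0,1,1] @
   [0,2,2,0,1,1,0,2,2,0,3,1,0,3,1,0,2,1,0,3,1,0,2,1,0,2,1,0,4,1,0,2,1,0,3,1,0,3,2,0,1,1,0,3,2,0,1,1] @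
   [0,2,2,0,3,1,0,2,1,0,2,1,0,3,1,0,2,1,0,3,1,0,3,1,0,2,1,0,3,1,0,2,2,0,1,1,0,3,2,0,1,1,0,3,2,0,3,1] @
   [0,2,2,0,3,1,0,2,1,0,3,3,0,1,1,0,2,2,0,1,1,0,2,2,0,1,3,0,1,2,0,3,2,0,1,1,0,2,2,0,1,1,0,2,2,0,3,1] @
   [0,3,1,0,2,1,0,3,1,0,2,2,0,1,1,0,3,2,0,1,1,0,3,2,0,3,1,0,2,2,0,3,1,0,2,1,0,2,1,0,3,1,0,2,1,0,3,1] @
   [0,3,1,0,2,1,0,3,3,0,1,1,0,2,2,0,1,1,0,2,2,0,1,3,0,1,2,0,3,2,0,1,1,0,2,2,0,1,1,0,2,2,0,3,1,0,3,1] @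
   [0,2,1,0,3,1,0,2,1,0,2,1,0,3,1,0,2,1,0,3,1,0,3,2,0,1,1,0,3,2,0,1,1,0,2,2,0,3,1,0,2,2,0,3,1,0,3,1]"

definition y_table_6 :: "nat list" where "y_table_6 =
   [0,3,2,0,1,1,0,2,2,0,1,1,0,2,2,0,3,1,0,3,1,0,2,1,0,3,1,0,2,1,0,2,1,0,3,1,0,2,1,0,3,1,0,3,2,0,1,1] @
   [0,3,2,0,1,1,0,2,2,0,3,1,0,2,2,0,3,1,0,3,1,0,3,4,0,1,1,0,2,2,0,1,1,0,2,2,0,1,3,0,1,2,0,3,2,0,1,1] @
   [0,2,2,0,1,1,0,2,2,0,3,1,0,3,1,0,2,1,0,3,1,0,2,1,0,2,1,0,3,1,0,2,1,0,3,1,0,3,2,0,1,1,0,3,2,0,1,1] @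
   [0,2,2,0,3,1,0,2,2,0,3,1,0,3,1,0,3,2,0,1,1,0,2,2,0,1,1,0,2,2,0,3,1,0,3,1,0,2,1,0,3,1,0,2,1,0,2,1] @
   [0,3,1,0,2,1,0,3,1,0,3,2,0,1,1,0,3,2,0,1,1,0,2,3,0,1,3,0,1,2,0,3,2,0,1,1,0,2,2,0,1,1,0,2,2,0,3,1] @
   [0,3,1,0,2,1,0,3,3,0,1,1,0,2,3,0,1,1,0,2,3,0,2,1,0,3,1,0,3,1,0,3,1,0,2,2,0,1,1,0,2,2,0,1,1,0,3,2] @
   [0,3,1,0,3,2,0,3,1,0,2,1,0,2,1,0,2,1,0,2,1,0,3,1,0,3,1,0,3,1,0,3,1,0,4,1,0,2,1,0,4,1,0,2,1,0,2,1] @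
   [0,3,1,0,2,1,0,3,1,0,3,1,0,2,1,0,3,1,0,2,1,0,4,1,0,3,1,0,4,1,0,3,1,0,2,1,0,2,1,0,2,1,0,2,1,0,3,3] @
   [0,1,1,0,3,2,0,1,1,0,2,2,0,1,3,0,1,2,0,3,2,0,1,1,0,2,2,0,1,1,0,2,2,0,3,1,0,3,1,0,2,1,0,3,1,0,2,1] @
   [0,2,1,0,3,1,0,2,1,0,3,1,0,3,2,0,1,1,0,3,2,0,1,1,0,2,2,0,3,1,0,2,2,0,4,1,0,3,1,0,2,1,0,3,1,0,3,1]"

definition y_table_7 :: "nat list" where "y_table_7 =
   [0,2,1,0,3,1,0,2,1,0,2,1,0,3,1,0,4,1,0,3,1,0,4,1,0,2,1,0,2,1,0,2,1,0,3,1,0,3,1,0,3,1,0,3,1,0,2,1] @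
   [0,2,1,0,4,1,0,2,1,0,4,1,0,3,1,0,2,1,0,3,1,0,3,1,0,2,2,0,1,1,0,2,2,0,1,1,0,3,2,0,3,1,0,3,1,0,2,1] @
   [0,2,3,0,1,1,0,2,3,0,1,1,0,3,3,0,2,1,0,3,1,0,3,1,0,2,1,0,2,3,0,1,1,0,2,2,0,1,1,0,3,2,0,1,2,0,1,2] @
   [0,3,2,0,1,1,0,2,2,0,3,1,0,2,1,0,2,1,0,3,1,0,2,1,0,3,1,0,3,1,0,2,1,0,3,1,0,2,2,0,1,1,0,3,2,0,1,1] @
   [0,3,2,0,3,1,0,2,2,0,3,1,0,2,1,0,3,3,0,1,1,0,2,2,0,1,1,0,2,2,0,1,3,0,1,2,0,3,2,0,1,1,0,2,2,0,1,1] @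
   [0,2,2,0,3,1,0,3,1,0,2,1,0,3,1,0,2,1,0,2,1,0,3,1,0,2,1,0,3,1,0,3,2,0,1,1,0,3,2,0,1,1,0,2,2,0,3,1] @
   [0,2,2,0,3,1,0,3,1,0,3,2,0,1,1,0,2,2,0,1,1,0,2,2,0,3,1,0,3,1,0,2,1,0,3,1,0,2,1,0,2,1,0,3,1,0,2,1] @
   [0,3,1,0,3,2,0,1,1,0,3,2,0,1,1,0,2,2,0,3,1,0,2,2,0,3,1,0,3,1,0,3,2,0,1,1,0,2,2,0,1,1,0,2,2,0,3,1] @
   [0,3,1,0,2,1,0,3,1,0,2,1,0,2,1,0,3,1,0,2,1,0,3,1,0,3,2,0,1,1,0,3,2,0,1,1,0,2,2,0,3,1,0,2,2,0,3,1] @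
   [0,3,1,0,3,2,0,1,1,0,2,2,0,1,1,0,2,2,0,3,1,0,3,1,0,2,1,0,3,1,0,2,1,0,2,1,0,3,1,0,2,1,0,3,1,0,3,2]"

definition y_table_8 :: "nat list" where "y_table_8 =
   [0,1,1,0,3,2,0,1,1,0,2,2,0,3,1,0,2,2,0,3,1,0,3,1,0,3,2,0,1,1,0,2,2,0,1,1,0,2,2,0,3,1,0,3,1,0,2,1] @
   [0,3,1,0,2,1,0,2,1,0,3,1,0,2,1,0,3,1,0,3,2,0,1,1,0,3,2,0,1,1,0,2,2,0,3,1,0,2,2,0,3,1,0,3,4,0,1,1] @
   [0,3,3,0,1,1,0,2,3,0,1,3,0,1,2,0,1,2,0,1,2,0,1,2,0,1,3,0,1,3,0,1,3,0,1,3,0,2,2,0,1,1,0,2,2,0,1,1] @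
   [0,2,3,0,1,3,0,2,3,0,1,3,0,1,2,0,1,4,0,1,2,0,1,2,0,1,3,0,1,2,0,1,3,0,1,3,0,2,2,0,1,3,0,1,2,0,1,4] @
   [0,1,2,0,3,2,0,1,1,0,2,2,0,1,1,0,2,2,0,3,1,0,3,1,0,2,1,0,3,1,0,2,1,0,2,1,0,3,1,0,2,1,0,3,1,0,3,2] @
   [0,1,1,0,3,2,0,1,1,0,2,2,0,3,3,0,1,1,0,2,2,0,1,1,0,2,2,0,1,3,0,1,2,0,3,2,0,1,1,0,2,2,0,1,1,0,2,2] @
   [0,4,1,0,3,1,0,2,1,0,3,1,0,2,1,0,2,1,0,3,1,0,2,1,0,3,1,0,3,1,0,4,1,0,3,1,0,4,1,0,2,1,0,2,1,0,2,1] @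
   [0,2,1,0,3,1,0,3,1,0,3,1,0,3,1,0,2,1,0,4,1,0,2,1,0,4,1,0,3,1,0,2,1,0,3,1,0,2,1,0,2,3,0,1,1,0,2,2] @
   [0,1,1,0,3,2,0,1,2,0,1,2,0,3,2,0,1,1,0,2,2,0,3,1,0,2,1,0,2,1,0,3,1,0,2,1,0,3,1,0,3,1,0,2,1,0,3,1] @
   [0,2,2,0,1,1,0,3,2,0,1,1,0,3,2,0,3,1,0,2,2,0,3,1,0,2,1,0,3,3,0,1,1,0,2,2,0,1,1,0,2,2,0,1,3,0,1,2]"

definition y_table_9 :: "nat list" where "y_table_9 =
   [0,3,2,0,1,1,0,2,2,0,1,1,0,2,2,0,3,1,0,3,1,0,2,1,0,3,1,0,2,1,0,2,1,0,3,1,0,2,1,0,3,1,0,3,2,0,1,1] @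
   [0,3,2,0,1,1,0,2,2,0,3,1,0,2,2,0,3,1,0,3,1,0,4,1,0,3,1,0,2,1,0,2,1,0,2,1,0,2,1,0,3,1,0,3,2,0,3,1] @
   [0,3,1,0,4,1,0,2,1,0,3,3,0,1,1,0,2,2,0,1,1,0,2,2,0,1,3,0,1,2,0,3,2,0,1,1,0,2,2,0,1,1,0,2,2,0,3,1] @
   [0,3,1,0,2,1,0,3,1,0,2,1,0,2,1,0,3,1,0,2,1,0,3,1,0,3,2,0,1,1,0,3,2,0,1,1,0,2,2,0,3,1,0,2,2,0,3,1] @
   [0,3,1,0,3,2,0,1,1,0,2,2,0,1,1,0,2,2,0,3,1,0,3,1,0,2,1,0,3,1,0,2,1,0,2,1,0,3,1,0,2,1,0,3,1,0,3,2] @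
   [0,1,1,0,3,2,0,1,1,0,2,2,0,3,1,0,2,2,0,3,1,0,3,1,0,3,2,0,1,1,0,2,2,0,1,1,0,2,2,0,3,1,0,3,1,0,2,1] @
   [0,3,1,0,2,1,0,2,1,0,3,1,0,2,1,0,3,3,0,1,1,0,2,2,0,1,1,0,2,2,0,1,3,0,1,2,0,3,2,0,1,1,0,2,2,0,1,1] @
   [0,2,3,0,1,3,0,1,2,0,3,2,0,1,1,0,2,2,0,3,1,0,2,1,0,2,1,0,3,1,0,2,1,0,3,1,0,3,1,0,2,1,0,3,1,0,2,2] @
   [0,1,1,0,3,2,0,1,1,0,3,2,0,3,1,0,2,2,0,3,1,0,2,1,0,3,3,0,1,1,0,2,2,0,1,1,0,2,2,0,1,3,0,1,2,0,3,2] @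
   [0,1,1,0,2,2,0,1,1,0,2,2,0,3,1,0,3,1,0,2,1,0,3,1,0,2,1,0,2,1,0,3,1,0,2,1,0,3,1,0,3,2,0,1,1,0,3,2]"

definition y_table_10 :: "nat list" where "y_table_10 =
   [0,1,1,0,2,2,0,3,1,0,2,2,0,3,1,0,3,1,0,3,2,0,1,1,0,2,2,0,1,1,0,2,2,0,3,1,0,3,1,0,2,1,0,3,1,0,2,1] @
   [0,2,1,0,3,1,0,2,1,0,3,1,0,3,2,0,1,1,0,3,2,0,1,1,0,2,2,0,3,1,0,2,2,0,3,1,0,3,1,0,3,2,0,1,1,0,2,2] @
   [0,1,1,0,2,2,0,3,1,0,3,1,0,2,2,0,1,1,0,2,2,0,1,1,0,3,2,0,3,1,0,3,1,0,2,1,0,2,1,0,2,1,0,2,1,0,3,1] @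
   [0,3,1,0,3,1,0,3,2,0,1,1,0,2,2,0,1,1,0,2,2,0,3,1,0,3,2,0,3,1,0,3,1,0,3,2,0,1,1,0,2,2,0,1,1,0,2,2] @
   [0,3,1,0,3,1,0,2,1,0,3,1,0,2,1,0,2,1,0,3,1,0,2,1,0,3,1,0,3,2,0,1,1,0,3,2,0,1,1,0,2,3,0,1,3,0,1,2] @
   [0,3,2,0,1,1,0,2,2,0,1,1,0,2,2,0,3,1,0,3,1,0,2,1,0,3,1,0,2,1,0,2,1,0,3,1,0,2,1,0,3,1,0,3,2,0,1,1] @
   [0,3,2,0,1,1,0,2,2,0,3,1,0,2,2,0,3,1,0,3,1,0,3,2,0,1,1,0,2,2,0,1,1,0,2,2,0,3,1,0,3,1,0,2,1,0,4,1] @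
   [0,2,1,0,2,1,0,3,1,0,2,1,0,3,1,0,3,2,0,1,1,0,3,2,0,1,1,0,2,2,0,3,1,0,2,2,0,3,1,0,3,1,0,3,2,0,1,1] @
   [0,2,2,0,1,1,0,2,2,0,3,1,0,3,1,0,2,1,0,3,1,0,2,1,0,2,1,0,3,1,0,2,1,0,3,1,0,3,2,0,3,2,0,1,1,0,2,2] @
   [0,1,1,0,2,2,0,3,1,0,3,1,0,2,1,0,3,1,0,3,2,0,1,1,0,3,2,0,1,1,0,2,2,0,3,1,0,2,2,0,3,1,0,3,1,0,2,1]"

definition y_table_11 :: "nat list" where "y_table_11 =
   [0,3,1,0,2,1,0,2,1,0,3,1,0,2,1,0,3,1,0,4,1,0,2,1,0,4,1,0,2,1,0,3,1,0,3,1,0,3,1,0,3,1,0,2,1,0,2,1] @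
   [0,2,1,0,2,1,0,4,1,0,3,1,0,4,1,0,3,1,0,3,1,0,2,1,0,3,1,0,2,1,0,2,3,0,1,1,0,2,2,0,1,1,0,3,2,0,1,2] @
   [0,1,2,0,3,2,0,1,1,0,2,2,0,3,1,0,2,1,0,2,1,0,3,1,0,2,1,0,3,1,0,3,1,0,2,1,0,3,1,0,4,1,0,2,1,0,4,1] @
   [0,2,1,0,2,1,0,3,1,0,3,1,0,3,1,0,3,1,0,2,1,0,2,1,0,2,1,0,4,1,0,3,1,0,4,1,0,3,1,0,2,1,0,2,1,0,3,1] @
   [0,2,1,0,3,3,0,1,1,0,2,2,0,1,1,0,2,2,0,1,3,0,1,2,0,3,2,0,1,1,0,2,2,0,1,1,0,2,2,0,3,1,0,3,1,0,2,1] @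
   [0,3,1,0,2,1,0,2,1,0,3,1,0,4,1,0,3,1,0,3,2,0,1,1,0,2,2,0,1,1,0,2,2,0,3,1,0,3,1,0,2,1,0,3,1,0,2,1] @
   [0,2,1,0,3,1,0,2,1,0,3,1,0,3,2,0,1,1,0,3,2,0,1,1,0,2,2,0,3,1,0,2,2,0,3,1,0,3,1,0,3,2,0,1,1,0,2,2] @
   [0,1,1,0,2,2,0,3,1,0,3,1,0,2,1,0,3,1,0,2,1,0,2,1,0,3,1,0,2,1,0,3,1,0,3,2,0,1,1,0,3,2,0,1,1,0,2,2] @
   [0,3,1,0,2,2,0,3,1,0,3,1,0,3,2,0,1,1,0,2,2,0,1,1,0,2,2,0,3,1,0,3,1,0,2,1,0,3,1,0,2,1,0,2,1,0,3,1] @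
   [0,2,1,0,3,1,0,3,2,0,1,1,0,3,2,0,1,1,0,2,2,0,3,1,0,2,2,0,3,1,0,3,1,0,3,2,0,1,1,0,2,2,0,1,1,0,2,2]"

definition y_table_12 :: "nat list" where "y_table_12 =
   [0,3,1,0,3,1,0,2,1,0,3,1,0,2,1,0,2,1,0,3,1,0,2,1,0,3,1,0,3,2,0,1,1,0,3,2,0,1,1,0,2,2,0,3,1,0,2,2] @
   [0,3,1,0,3,1,0,3,2,0,1,1,0,2,2,0,1,1,0,2,2,0,3,1,0,3,1,0,2,1,0,3,1,0,2,1,0,2,1,0,3,1,0,2,1,0,3,1] @
   [0,3,2,0,1,1,0,3,2,0,1,1,0,2,2,0,3,1,0,2,2,0,4,1,0,3,1,0,2,1,0,3,1,0,3,1,0,2,1,0,3,1,0,2,1,0,2,1] @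
   [0,3,1,0,4,1,0,3,1,0,4,1,0,2,1,0,2,1,0,2,1,0,3,1,0,3,1,0,3,1,0,3,1,0,2,1,0,2,1,0,4,1,0,2,1,0,4,1] @
   [0,3,1,0,2,1,0,3,1,0,3,1,0,2,2,0,1,1,0,2,2,0,1,1,0,3,2,0,3,1,0,3,1,0,2,1,0,2,3,0,1,1,0,2,3,0,1,1] @
   [0,3,3,0,2,1,0,3,1,0,3,1,0,2,1,0,2,3,0,1,1,0,2,2,0,1,1,0,3,2,0,1,2,0,1,2,0,3,2,0,1,1,0,2,2,0,3,1] @
   [0,2,1,0,2,1,0,3,1,0,2,1,0,3,1,0,3,1,0,2,1,0,3,1,0,2,2,0,1,1,0,3,2,0,1,1,0,3,2,0,3,1,0,2,2,0,3,1] @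
   [0,2,1,0,3,3,0,1,1,0,2,2,0,1,1,0,2,2,0,1,3,0,1,2,0,3,2,0,1,1,0,2,2,0,1,1,0,2,2,0,3,1,0,3,1,0,2,1] @
   [0,3,1,0,2,1,0,2,1,0,3,1,0,2,1,0,3,1,0,3,2,0,1,1,0,3,2,0,1,1,0,2,2,0,3,1,0,2,2,0,3,1,0,3,1,0,3,2] @
   [0,1,1,0,2,2,0,1,1,0,2,2,0,3,1,0,3,1,0,2,1,0,3,1,0,2,1,0,2,1,0,3,1,0,2,1,0,3,3,0,1,1,0,2,2,0,1,1]"

definition y_table_13 :: "nat list" where "y_table_13 =
   [0,2,2,0,1,3,0,1,2,0,3,2,0,1,1,0,2,2,0,1,1,0,2,3,0,1,3,0,1,2,0,3,2,0,1,1,0,2,2,0,3,1,0,2,1,0,2,1] @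
   [0,3,1,0,2,1,0,3,1,0,3,1,0,2,1,0,3,1,0,2,2,0,1,1,0,3,2,0,1,1,0,3,2,0,3,1,0,2,2,0,3,1,0,2,1,0,3,3] @
   [0,1,1,0,2,2,0,1,1,0,2,2,0,1,3,0,1,2,0,3,2,0,1,1,0,2,2,0,1,1,0,2,2,0,3,1,0,3,1,0,2,1,0,3,1,0,2,1] @
   [0,2,1,0,3,1,0,2,1,0,3,1,0,3,2,0,1,1,0,3,2,0,1,1,0,2,2,0,3,1,0,2,2,0,3,1,0,3,1,0,3,2,0,1,1,0,2,2] @
   [0,1,1,0,2,2,0,3,1,0,3,1,0,2,1,0,3,1,0,2,1,0,2,1,0,3,1,0,2,1,0,3,1,0,3,2,0,1,1,0,3,2,0,1,1,0,2,2] @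
   [0,3,1,0,2,2,0,3,1,0,3,1,0,3,2,0,1,1,0,2,2,0,1,1,0,2,2,0,3,1,0,3,1,0,2,1,0,3,1,0,2,1,0,2,1,0,3,1] @
   [0,2,1,0,3,1,0,3,2,0,1,1,0,3,2,0,1,1,0,2,2,0,3,1,0,2,2,0,3,3,0,1,1,0,2,2,0,1,1,0,2,2,0,1,3,0,1,2] @
   [0,3,2,0,1,1,0,2,3,0,2,1,0,2,1,0,2,1,0,3,1,0,2,2,0,1,1,0,3,2,0,1,1,0,3,2,0,3,1,0,2,1,0,2,1,0,2,1] @
   [0,2,1,0,3,1,0,3,1,0,3,1,0,3,1,0,2,2,0,1,1,0,2,2,0,1,1,0,3,2,0,3,1,0,3,2,0,3,1,0,2,1,0,3,3,0,1,1] @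
   [0,2,2,0,1,1,0,2,2,0,1,3,0,1,2,0,3,2,0,1,1,0,2,2,0,1,1,0,2,2,0,3,1,0,3,1,0,2,1,0,3,1,0,2,1,0,2,1]"

definition y_table_14 :: "nat list" where "y_table_14 =
   [0,3,1,0,2,1,0,3,1,0,3,2,0,1,1,0,3,2,0,1,1,0,2,2,0,3,1,0,2,2,0,3,3,0,1,1,0,2,2,0,1,1,0,2,2,0,1,3] @
   [0,1,3,0,1,2,0,1,2,0,3,2,0,1,1,0,2,2,0,3,1,0,2,1,0,2,1,0,3,1,0,2,1,0,3,1,0,3,1,0,2,1,0,3,1,0,2,2] @
   [0,1,1,0,3,2,0,1,1,0,3,2,0,3,1,0,2,2,0,3,1,0,2,1,0,3,3,0,1,1,0,2,2,0,1,1,0,2,2,0,1,3,0,1,2,0,3,2] @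
   [0,1,1,0,2,2,0,1,1,0,2,2,0,3,1,0,3,1,0,2,1,0,3,1,0,2,1,0,2,1,0,3,1,0,2,1,0,3,1,0,3,2,0,1,1,0,3,2] @
   [0,1,1,0,2,2,0,3,1,0,2,2,0,3,1,0,3,1,0,3,2,0,1,1,0,2,2,0,1,1,0,2,2,0,3,1,0,3,1,0,2,1,0,3,1,0,2,1] @
   [0,2,1,0,3,1,0,2,1,0,3,1,0,3,2,0,1,1,0,3,2,0,1,1,0,2,2,0,3,1,0,2,2,0,3,1,0,3,1,0,3,2,0,1,1,0,2,2] @
   [0,1,1,0,2,2,0,3,1,0,3,1,0,2,1,0,3,1,0,2,1,0,2,1,0,3,1,0,2,1,0,3,1,0,3,2,0,1,1,0,3,2,0,1,1,0,2,2] @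
   [0,3,1,0,2,2,0,3,1,0,3,1,0,3,2,0,1,2,0,1,2,0,1,2,0,1,2,0,3,2,0,3,1,0,2,1,0,2,1,0,2,1,0,2,1,0,3,1] @
   [0,3,1,0,3,1,0,3,1,0,2,2,0,1,1,0,2,2,0,1,1,0,3,2,0,3,1,0,3,2,0,3,1,0,2,1,0,2,3,0,1,1,0,2,2,0,1,1] @
   [0,3,2,0,1,2,0,1,2,0,3,2,0,1,1,0,2,2,0,3,1,0,2,1,0,3,1,0,3,1,0,2,1,0,3,1,0,2,1,0,2,1,0,3,1,0,2,2]"

definition y_table_15 :: "nat list" where "y_table_15 =
   [0,1,1,0,3,2,0,1,1,0,3,2,0,3,1,0,2,1,0,2,1,0,2,1,0,2,1,0,3,1,0,3,1,0,3,1,0,3,1,0,2,2,0,1,1,0,2,2] @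
   [0,1,1,0,3,2,0,3,1,0,3,2,0,3,1,0,2,1,0,3,3,0,1,1,0,2,2,0,1,1,0,2,2,0,1,3,0,1,2,0,3,2,0,1,1,0,2,2] @
   [0,1,1,0,2,2,0,3,1,0,3,1,0,2,1,0,3,1,0,2,1,0,2,1,0,3,1,0,2,1,0,3,1,0,3,2,0,1,1,0,4,2,0,1,1,0,2,2] @
   [0,3,1,0,2,2,0,3,1,0,3,1,0,3,2,0,1,1,0,2,2,0,1,1,0,2,2,0,3,1,0,3,1,0,2,1,0,3,1,0,2,1,0,2,1,0,3,1] @
   [0,2,1,0,3,1,0,3,2,0,1,1,0,3,2,0,1,1,0,2,2,0,3,1,0,2,2,0,3,1,0,3,1,0,3,2,0,1,1,0,2,2,0,1,1,0,2,2] @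
   [0,3,1,0,3,1,0,2,1,0,3,1,0,2,1,0,2,1,0,3,1,0,2,1,0,3,1,0,3,2,0,1,1,0,3,2,0,1,1,0,2,2,0,3,1,0,2,2] @
   [0,3,1,0,3,1,0,3,2,0,1,1,0,2,2,0,1,1,0,2,2,0,3,1,0,3,1,0,2,1,0,3,1,0,2,1,0,2,1,0,3,1,0,2,1,0,3,1] @
   [0,3,2,0,1,1,0,3,2,0,1,1,0,2,2,0,3,1,0,2,2,0,3,1,0,3,1,0,3,4,0,1,1,0,2,2,0,1,1,0,2,2,0,1,3,0,1,2] @
   [0,3,2,0,1,1,0,2,2,0,1,1,0,2,2,0,3,1,0,3,1,0,2,1,0,3,1,0,2,1,0,2,1,0,3,1,0,2,1,0,3,1,0,3,2,0,1,1] @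
   [0,3,2,0,1,1,0,2,3,0,1,3,0,1,2,0,3,2,0,1,1,0,2,2,0,1,1,0,2,2,0,3,1,0,3,1,0,2,1,0,3,1,0,2,1,0,2,1]"

definition y_table_16 :: "nat list" where "y_table_16 =
   [0,3,1,0,2,1,0,3,1,0,3,2,0,1,1,0,3,2,0,1,1,0,2,2,0,3,1,0,2,2,0,3,1,0,3,1,0,3,2,0,1,1,0,2,2,0,1,1] @
   [0,2,2,0,3,1,0,3,1,0,2,1,0,3,1,0,2,1,0,2,3,0,1,1,0,2,3,0,1,1,0,3,2,0,1,2,0,1,2,0,1,2,0,1,2,0,3,2] @
   [0,3,1,0,2,1,0,2,1,0,2,1,0,2,1,0,3,1,0,3,1,0,3,1,0,3,1,0,2,2,0,1,1,0,2,2,0,1,1,0,3,2,0,3,1,0,3,2] @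
   [0,3,1,0,2,1,0,2,3,0,1,1,0,2,2,0,1,1,0,3,2,0,1,2,0,1,2,0,3,2,0,1,1,0,2,2,0,3,1,0,2,1,0,3,1,0,3,1] @
   [0,2,1,0,3,1,0,2,1,0,2,1,0,3,1,0,2,2,0,1,1,0,3,2,0,1,1,0,3,2,0,3,1,0,2,1,0,2,1,0,2,1,0,2,1,0,3,1] @
   [0,3,1,0,3,1,0,3,1,0,2,2,0,1,1,0,2,2,0,1,1,0,3,2,0,3,1,0,3,2,0,3,1,0,2,1,0,3,3,0,1,1,0,2,2,0,1,1] @
   [0,2,2,0,1,3,0,1,2,0,3,2,0,1,1,0,2,2,0,1,1,0,2,2,0,3,1,0,3,1,0,2,1,0,3,1,0,2,1,0,2,1,0,3,1,0,2,1] @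
   [0,3,1,0,3,2,0,1,1,0,3,2,0,1,1,0,2,2,0,3,1,0,2,2,0,3,1,0,3,1,0,3,2,0,1,1,0,2,2,0,1,1,0,2,2,0,3,1] @
   [0,3,1,0,2,1,0,3,1,0,2,1,0,2,1,0,3,1,0,2,1,0,3,1,0,3,2,0,1,1,0,3,2,0,1,1,0,2,2,0,3,1,0,2,2,0,3,1] @
   [0,3,4,0,1,1,0,3,3,0,1,1,0,2,3,0,1,3,0,1,2,0,1,2,0,1,2,0,1,2,0,1,3,0,1,3,0,1,3,0,1,3,0,2,2,0,1,1]"

definition y_table_17 :: "nat list" where "y_table_17 =
   [0,2,2,0,1,1,0,2,3,0,1,3,0,2,3,0,1,3,0,1,2,0,1,4,0,1,2,0,1,2,0,1,3,0,1,2,0,1,3,0,1,3,0,2,2,0,1,3] @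
   [0,1,2,0,1,4,0,1,2,0,3,2,0,1,1,0,2,2,0,1,1,0,2,2,0,3,1,0,3,1,0,2,1,0,3,1,0,2,1,0,2,1,0,3,1,0,2,1] @
   [0,3,1,0,3,2,0,1,1,0,3,2,0,1,1,0,2,3,0,1,3,0,1,2,0,3,2,0,1,1,0,2,2,0,1,1,0,2,2,0,3,1,0,3,1,0,2,1] @
   [0,3,1,0,2,1,0,2,1,0,3,1,0,2,1,0,3,1,0,3,2,0,1,1,0,3,2,0,1,1,0,2,2,0,3,1,0,2,2,0,3,1,0,3,1,0,3,2] @
   [0,1,1,0,2,2,0,1,1,0,2,2,0,3,1,0,3,1,0,2,1,0,3,1,0,2,1,0,2,3,0,1,1,0,2,3,0,1,1,0,3,2,0,1,2,0,1,2] @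
   [0,1,2,0,1,2,0,3,2,0,3,1,0,2,1,0,2,1,0,2,1,0,2,1,0,3,1,0,3,1,0,3,1,0,3,1,0,2,2,0,1,1,0,2,2,0,1,1] @
   [0,3,2,0,3,1,0,3,2,0,3,1,0,2,1,0,2,3,0,1,1,0,2,2,0,1,1,0,3,2,0,1,2,0,1,2,0,3,2,0,1,1,0,2,2,0,3,1] @
   [0,2,1,0,3,1,0,3,1,0,2,1,0,3,1,0,2,1,0,2,1,0,3,1,0,2,2,0,1,1,0,3,2,0,1,1,0,3,2,0,3,1,0,2,1,0,2,1] @
   [0,2,1,0,2,1,0,3,1,0,3,1,0,3,1,0,3,1,0,2,2,0,1,1,0,2,2,0,1,1,0,3,2,0,3,1,0,3,2,0,3,1,0,2,1,0,3,3] @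
   [0,1,1,0,2,2,0,1,1,0,2,2,0,1,3,0,1,2,0,3,2,0,1,1,0,2,2,0,1,1,0,2,2,0,3,1,0,3,1,0,2,1,0,3,1,0,2,1]"

definition y_table_18 :: "nat list" where "y_table_18 =
   [0,2,1,0,3,1,0,2,1,0,3,1,0,3,2,0,1,1,0,3,2,0,1,1,0,2,2,0,3,1,0,2,2,0,3,1,0,3,1,0,3,2,0,1,1,0,2,2] @
   [0,1,1,0,2,2,0,3,1,0,3,1,0,2,1,0,3,1,0,2,1,0,2,1,0,3,1,0,2,1,0,3,1,0,3,2,0,1,1,0,3,2,0,1,1,0,2,2] @
   [0,3,1,0,2,2,0,3,1,0,3,1,0,3,2,0,1,1,0,2,2,0,1,1,0,2,2,0,3,1,0,3,1,0,2,1,0,3,1,0,2,1,0,2,1,0,3,1] @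
   [0,2,1,0,3,1,0,3,2,0,1,1,0,3,2,0,1,1,0,2,2,0,3,1,0,2,2,0,3,1,0,3,1,0,3,2,0,1,1,0,2,2,0,1,1,0,2,2] @
   [0,3,1,0,3,1,0,2,1,0,3,1,0,2,1,0,2,1,0,3,1,0,2,1,0,3,1,0,3,2,0,1,1,0,3,2,0,1,1,0,2,2,0,3,1,0,2,2] @
   [0,3,1,0,3,1,0,3,2,0,1,1,0,2,2,0,1,1,0,2,2,0,3,1,0,3,1,0,2,1,0,3,1,0,2,1,0,2,1,0,3,1,0,2,1,0,3,1] @
   [0,3,2,0,1,1,0,3,2,0,1,1,0,2,2,0,3,1,0,2,2,0,3,1,0,3,4,0,1,1,0,3,3,0,1,1,0,2,3,0,1,3,0,1,2,0,1,2] @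
   [0,1,2,0,1,2,0,1,3,0,1,3,0,1,3,0,1,3,0,2,2,0,1,1,0,2,2,0,1,1,0,2,3,0,1,3,0,2,3,0,1,3,0,1,2,0,1,4] @
   [0,1,3,0,2,2,0,1,1,0,2,2,0,1,1,0,2,3,0,1,3,0,1,2,0,3,2,0,1,1,0,2,2,0,1,1,0,2,2,0,3,1,0,3,1,0,2,1] @
   [0,3,1,0,2,1,0,2,1,0,3,1,0,2,1,0,3,1,0,3,2,0,1,1,0,3,2,0,1,1,0,2,2,0,3,1,0,2,2,0,3,1,0,3,1,0,3,2]"

definition y_table_19 :: "nat list" where "y_table_19 =
   [0,1,2,0,1,2,0,1,2,0,1,2,0,3,2,0,3,1,0,2,1,0,2,1,0,2,1,0,2,1,0,3,1,0,3,1,0,3,1,0,3,1,0,2,2,0,1,1] @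
   [0,2,2,0,1,1,0,3,2,0,3,1,0,3,2,0,3,1,0,2,1,0,2,3,0,1,1,0,2,2,0,1,1,0,3,2,0,1,2,0,1,2,0,3,2,0,1,1] @
   [0,2,2,0,3,1,0,2,1,0,3,1,0,3,1,0,2,1,0,3,1,0,2,1,0,2,1,0,3,1,0,2,2,0,1,1,0,3,2,0,1,1,0,3,2,0,3,1] @
   [0,2,1,0,2,1,0,2,1,0,2,1,0,3,1,0,3,1,0,3,1,0,3,1,0,2,2,0,1,1,0,2,2,0,1,1,0,3,2,0,3,1,0,3,2,0,3,1] @
   [0,2,1,0,3,3,0,1,1,0,2,2,0,1,1,0,2,2,0,1,3,0,1,2,0,3,2,0,1,1,0,2,2,0,1,1,0,2,2,0,3,1,0,3,1,0,2,1] @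
   [0,3,1,0,2,1,0,2,1,0,3,1,0,2,1,0,3,1,0,3,2,0,1,1,0,3,2,0,1,1,0,2,2,0,3,1,0,2,2,0,3,3,0,1,1,0,2,2] @
   [0,1,1,0,2,2,0,1,3,0,1,3,0,1,2,0,1,2,0,3,2,0,1,1,0,2,2,0,3,1,0,2,1,0,2,1,0,3,1,0,2,1,0,3,1,0,3,1] @
   [0,2,1,0,3,1,0,2,2,0,1,1,0,3,2,0,1,1,0,3,2,0,3,1,0,2,2,0,3,1,0,2,1,0,3,3,0,1,1,0,2,2,0,1,1,0,2,2] @
   [0,1,3,0,1,2,0,3,2,0,1,1,0,2,2,0,1,1,0,2,2,0,3,1,0,3,1,0,2,1,0,3,1,0,2,1,0,2,1,0,3,1,0,2,1,0,3,1] @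
   [0,3,2,0,1,1,0,3,2,0,1,1,0,2,2,0,3,1,0,2,2,0,3,1,0,3,1,0,3,2,0,1,1,0,2,2,0,1,1,0,2,2,0,3,1,0,3,1]"

definition y_table_20 :: "nat list" where "y_table_20 =
   [0,2,1,0,3,1,0,2,1,0,2,1,0,3,1,0,2,1,0,3,1,0,3,2,0,1,1,0,3,2,0,1,1,0,2,2,0,3,1,0,2,2,0,3,1,0,3,1]"

text \<open>The entry for index 606 stands alone: the column of multiples of 6 in
  \<open>oddpart\<close> is regular only from \<open>6 * 607\<close> on, so the blocks that are
  unfolded to \<open>oddpart\<close> start at 607.\<close>

definition y_table :: "nat list" where
  "y_table = 1 # y_table_0 @ y_table_1 @ y_table_2 @ y_table_3 @ y_table_4 @ y_table_5 @ y_table_6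
    @ y_table_7 @ y_table_8 @ y_table_9 @ y_table_10 @ y_table_11 @ y_table_12 @ y_table_13 @
    y_table_14 @ y_table_15 @ y_table_16 @ y_table_17 @ y_table_18 @ y_table_19 @ y_table_20"

lemma length_y_table:
  "length y_table_0 = 480" "length y_table_1 = 480" "length y_table_2 = 480" "length y_table_3 =
  480" "length y_table_4 = 480" "length y_table_5 = 480" "length y_table_6 = 480" "length
  y_table_7 = 480" "length y_table_8 = 480" "length y_table_9 = 480" "length y_table_10 = 480"
  "length y_table_11 = 480" "length y_table_12 = 480" "length y_table_13 = 480" "length y_table_14
  = 480" "length y_table_15 = 480" "length y_table_16 = 480" "length y_table_17 = 480" "length
  y_table_18 = 480" "length y_table_19 = 480" "length y_table_20 = 48"
  by (simp_all add: y_table_0_def y_table_1_def y_table_2_def y_table_3_def y_table_4_def y_table_5_def y_table_6_def y_table_7_def y_table_8_def y_table_9_def y_table_10_def y_table_11_def y_table_12_def y_table_13_def y_table_14_def y_table_15_def y_table_16_def y_table_17_def y_table_18_def y_table_19_def y_table_20_def)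

text \<open>
  \<open>oddpart\<close> will turn out to be the sequence of letters of the word at odd positions. From position
  \<open>3637\<close> on its only interesting column is the one of positions \<open>6 j + 3\<close>; subtracting \<open>2\<close> there gives
  a sequence \<open>core\<close> that, after a transient, is a shifted copy of \<open>oddpart\<close>.
\<close>

function oddpart :: "nat \<Rightarrow> nat" where
  "oddpart n =
    (if n < 3637 then v_table ! n
     else if n mod 6 = 3 then
       (if n div 6 < 10255 then y_table ! (n div 6 - 606) else oddpart (n div 6 - 7295)) + 2
     else if n mod 6 = 0 then (if n div 6 mod 4 \<in> {0, 3} then 3 else 2)
     else if n mod 3 = 1 then 1 else 0)"
  by auto
termination by (relation "measure id") auto

declare oddpart.simps [simp del]

definition core :: "nat \<Rightarrow> nat" where
  "core j = (if j < 10255 then y_table ! (j - 606) else oddpart (j - 7295))"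

lemma oddpart_mod6_3: "a \<ge> 606 \<Longrightarrow> oddpart (6 * a + 3) = core a + 2"
  by (simp add: oddpart.simps[of "6 * a + 3"] core_def)

lemma oddpart_mod6_0: "a \<ge> 607 \<Longrightarrow> oddpart (6 * a) = (if a mod 4 \<in> {0, 3} then 3 else 2)"
  by (simp add: oddpart.simps[of "6 * a"])

lemma oddpart_mod3_1:
  assumes "n \<ge> 3637" and "n mod 3 = 1" shows "oddpart n = 1"
proof -
  have "n mod 6 \<noteq> 3" "n mod 6 \<noteq> 0" using assms(2) by presburger+
  thus ?thesis using assms by (simp add: oddpart.simps[of n])
qed

lemma oddpart_mod3_2:
  assumes "n \<ge> 3637" and "n mod 3 = 2" shows "oddpart n = 0"
proof -
  have "n mod 6 \<noteq> 3" "n mod 6 \<noteq> 0" using assms(2) by presburger+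
  thus ?thesis using assms by (simp add: oddpart.simps[of n])
qed

lemma core_shift: "j \<ge> 10255 \<Longrightarrow> core j = oddpart (j - 7295)"
  by (simp add: core_def)

section \<open>Turning the tables into equations for single letters\<close>

definition listed :: "(nat \<Rightarrow> nat) \<Rightarrow> nat \<Rightarrow> nat list \<Rightarrow> bool" where
  "listed f a xs \<longleftrightarrow> (\<forall>i<length xs. f (a + i) = xs ! i)"

lemma listed_Nil: "listed f a [] = True"
  by (simp add: listed_def)

lemma listed_Cons: "listed f a (x # xs) \<longleftrightarrow> f a = x \<and> listed f (a + 1) xs"
  unfolding listed_def by (auto simp: less_Suc_eq_0_disj)

lemma listed_append: "listed f a (xs @ ys) \<longleftrightarrow> listed f a xs \<and> listed f (a + length xs) ys"
  by (induction xs arbitrary: a) (simp_all add: listed_Nil listed_Cons)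

lemma listed_oddpart: "listed oddpart 0 (v_table)"
proof -
  have "length v_table = 3637" by (simp add: v_table_def length_v_table)
  thus ?thesis by (simp add: listed_def oddpart.simps)
qed

lemma listed_core: "listed core 606 (y_table)"
proof -
  have "length y_table = 9649" by (simp add: y_table_def length_y_table)
  thus ?thesis by (simp add: listed_def core_def)
qed

abbreviation (input) column_0 :: "nat \<Rightarrow> nat" where
  "column_0 a \<equiv> (if a mod 4 \<in> {0, 3} then 3 else 2)"

text \<open>The four parameters are the letters of \<open>oddpart\<close> at multiples of 6, which
  repeat with period 4 and are rotated at each entry.\<close>

fun unfold_core :: "nat \<Rightarrow> nat \<Rightarrow> nat \<Rightarrow> nat \<Rightarrow> nat list \<Rightarrow> nat list" where
  "unfold_core p q r s [] = []"
| "unfold_core p q r s (y # ys) = p # 1 # 0 # (y + 2) # 1 # 0 # unfold_core q r s p ys"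

text \<open>After a multiple of four entries the rotation is back at its start, so a table can be
  unfolded row by row.\<close>

lemma unfold_core_append:
  assumes "length xs = 4 * k"
  shows "unfold_core p q r s (xs @ ys) = unfold_core p q r s xs @ unfold_core p q r s ys"
  using assms
proof (induction k arbitrary: xs)
  case (Suc k)
  then obtain x1 x2 x3 x4 zs where "xs = x1 # x2 # x3 # x4 # zs" "length zs = 4 * k"
    by (auto simp: length_Suc_conv numeral_eq_Suc)
  thus ?case using Suc.IH[of zs] by simp
qed simp

lemma unfold_core_append_48:
  "length xs = 48 \<Longrightarrow>
    unfold_core p q r s (xs @ ys) = unfold_core p q r s xs @ unfold_core p q r s ys"
  using unfold_core_append[of xs 12] by simp

lemma listed_unfold_core:
  assumes "a \<ge> 607" and "listed core a ys"
  shows "listed oddpart (6 * a)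
    (unfold_core (column_0 a) (column_0 (a + 1)) (column_0 (a + 2)) (column_0 (a + 3)) ys)"
  using assms
proof (induction ys arbitrary: a)
  case (Cons y ys)
  have "oddpart (6 * a) = column_0 a"
    using Cons.prems(1) oddpart_mod6_0[of a] by simp
  moreover have "oddpart (6 * a + 1) = 1" "oddpart (6 * a + 1 + 1 + 1 + 1) = 1"
    by (intro oddpart_mod3_1; use Cons.prems(1) in \<open>simp; presburger\<close>)+
  moreover have "oddpart (6 * a + 1 + 1) = 0" "oddpart (6 * a + 1 + 1 + 1 + 1 + 1) = 0"
    by (intro oddpart_mod3_2; use Cons.prems(1) in \<open>simp; presburger\<close>)+
  moreover have "oddpart (6 * a + 1 + 1 + 1) = core a + 2"
    using Cons.prems(1) oddpart_mod6_3[of a] by (simp add: numeral_3_eq_3)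
  moreover have "core a = y" "listed core (a + 1) ys" using Cons.prems(2) by (simp_all add: listed_Cons)
  moreover have "6 * a + 1 + 1 + 1 + 1 + 1 + 1 = 6 * (a + 1)" by simp
  moreover have "column_0 (a + 4) = column_0 a" by simp
  moreover have "a + 1 + 1 = a + 2" "a + 1 + 2 = a + 3" "a + 1 + 3 = a + 4" by simp_all
  ultimately show ?case
    using Cons.IH[of "a + 1"] Cons.prems(1) by (simp only: unfold_core.simps listed_Cons)
qed (simp add: listed_Nil)

lemma listed_core_shift:
  assumes "n \<ge> 2960" and "listed oddpart n xs" shows "listed core (n + 7295) xs"
  using assms by (auto simp: listed_def core_shift)

lemma listed_single: "listed f a [x] \<longleftrightarrow> f a = x"
  by (simp add: listed_Cons listed_Nil)

lemma listed_Cons_Cons: "listed f a (x # y # xs) \<longleftrightarrow> f a = x \<and> listed f (a + 1) (y # xs)"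
  by (simp add: listed_Cons)

lemma length_Cons_add: "length (x # xs) = length xs + 1"
  by simp

text \<open>Positions are added up as numerals and never as \<open>Suc\<close>, so that the
  resulting equations match the arguments that arise in the checks.\<close>

lemmas listing_simps = listed_append list.size(3) length_Cons_add listed_single listed_Cons_Cons
  numeral_plus_numeral numeral_plus_one one_plus_numeral add_num_simps add_0 add_0_right one_add_one

lemma oddpart_blocks:
  "listed oddpart 0 v_table_0" "listed oddpart 370 v_table_1" "listed oddpart 740 v_table_2"
  "listed oddpart 1110 v_table_3" "listed oddpart 1480 v_table_4" "listed oddpart 1850 v_table_5"
  "listed oddpart 2220 v_table_6" "listed oddpart 2590 v_table_7" "listed oddpart 2960 v_table_8"
  "listed oddpart 3330 v_table_9"
  using listed_oddpart unfolding v_table_def listed_append listed_Cons by (simp_all add: length_v_table)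

lemma core_blocks:
  "listed core 607 y_table_0" "listed core 1087 y_table_1" "listed core 1567 y_table_2" "listed
  core 2047 y_table_3" "listed core 2527 y_table_4" "listed core 3007 y_table_5" "listed core 3487
  y_table_6" "listed core 3967 y_table_7" "listed core 4447 y_table_8" "listed core 4927
  y_table_9" "listed core 5407 y_table_10" "listed core 5887 y_table_11" "listed core 6367
  y_table_12" "listed core 6847 y_table_13" "listed core 7327 y_table_14" "listed core 7807
  y_table_15" "listed core 8287 y_table_16" "listed core 8767 y_table_17" "listed core 9247
  y_table_18" "listed core 9727 y_table_19" "listed core 10207 y_table_20"
  using listed_core unfolding y_table_def listed_append listed_Cons by (simp_all add: length_y_table)

lemma core_606: "core 606 = 1"
  using listed_core unfolding y_table_def listed_Cons by simp

lemmas oddpart_values =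
  oddpart_blocks(1)[unfolded v_table_0_def, simplified listing_simps]
  oddpart_blocks(2)[unfolded v_table_1_def, simplified listing_simps]
  oddpart_blocks(3)[unfolded v_table_2_def, simplified listing_simps]
  oddpart_blocks(4)[unfolded v_table_3_def, simplified listing_simps]
  oddpart_blocks(5)[unfolded v_table_4_def, simplified listing_simps]
  oddpart_blocks(6)[unfolded v_table_5_def, simplified listing_simps]
  oddpart_blocks(7)[unfolded v_table_6_def, simplified listing_simps]
  oddpart_blocks(8)[unfolded v_table_7_def, simplified listing_simps]
  oddpart_blocks(9)[unfolded v_table_8_def, simplified listing_simps]
  oddpart_blocks(10)[unfolded v_table_9_def, simplified listing_simps]

lemmas core_values = core_606
  core_blocks(1)[unfolded y_table_0_def, simplified listing_simps]
  core_blocks(2)[unfolded y_table_1_def, simplified listing_simps]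
  core_blocks(3)[unfolded y_table_2_def, simplified listing_simps]
  core_blocks(4)[unfolded y_table_3_def, simplified listing_simps]
  core_blocks(5)[unfolded y_table_4_def, simplified listing_simps]
  core_blocks(6)[unfolded y_table_5_def, simplified listing_simps]
  core_blocks(7)[unfolded y_table_6_def, simplified listing_simps]
  core_blocks(8)[unfolded y_table_7_def, simplified listing_simps]
  core_blocks(9)[unfolded y_table_8_def, simplified listing_simps]
  core_blocks(10)[unfolded y_table_9_def, simplified listing_simps]
  core_blocks(11)[unfolded y_table_10_def, simplified listing_simps]
  core_blocks(12)[unfolded y_table_11_def, simplified listing_simps]
  core_blocks(13)[unfolded y_table_12_def, simplified listing_simps]
  core_blocks(14)[unfolded y_table_13_def, simplified listing_simps]
  core_blocks(15)[unfolded y_table_14_def, simplified listing_simps]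
  core_blocks(16)[unfolded y_table_15_def, simplified listing_simps]
  core_blocks(17)[unfolded y_table_16_def, simplified listing_simps]
  core_blocks(18)[unfolded y_table_17_def, simplified listing_simps]
  core_blocks(19)[unfolded y_table_18_def, simplified listing_simps]
  core_blocks(20)[unfolded y_table_19_def, simplified listing_simps]
  core_blocks(21)[unfolded y_table_20_def, simplified listing_simps]

text \<open>Two blocks give \<open>oddpart\<close> up to position 9401. This suffices for powers
  with \<open>m\<close> up to 910 that start before 3637.\<close>

lemma oddpart_unfolded:
  "listed oddpart 3642 (unfold_core 3 3 2 2 y_table_0)"
  "listed oddpart 6522 (unfold_core 3 3 2 2 y_table_1)"
  using listed_unfold_core[of 607 y_table_0] listed_unfold_core[of 1087 y_table_1] core_blocks(1,2)
  by simp_all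

lemma oddpart_junction: "listed oddpart 3637 [1, 0, 3, 1, 0]"
  using oddpart_mod3_1[of 3637] oddpart_mod3_2[of 3638] oddpart_mod6_3[of 606] oddpart_mod3_1[of 3640]
    oddpart_mod3_2[of 3641] core_606
  by (simp add: listed_Nil listed_Cons)

lemmas unfolding_simps = unfold_core_append_48 unfold_core.simps numeral_eq_iff num.inject listing_simps

lemmas oddpart_unfolded_values =
  oddpart_junction[simplified listing_simps]
  oddpart_unfolded(1)[unfolded y_table_0_def, simplified unfolding_simps]
  oddpart_unfolded(2)[unfolded y_table_1_def, simplified unfolding_simps]

section \<open>Finite checks\<close>

text \<open>These continue \<open>core\<close> from 10255 to 13816 by the letters of
  \<open>oddpart\<close> from 2960 on, because the checks read past the end of
  \<open>y_table\<close>.\<close>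

lemmas core_shifted_values =
  listed_core_shift[OF _ oddpart_blocks(9), unfolded v_table_8_def,
    simplified listing_simps rel_simps simp_thms]
  listed_core_shift[OF _ oddpart_blocks(10), unfolded v_table_9_def,
    simplified listing_simps rel_simps simp_thms]
  listed_core_shift[OF _ oddpart_junction, simplified listing_simps rel_simps simp_thms]
  listed_core_shift[OF _ oddpart_unfolded(1), unfolded y_table_0_def,
    simplified unfolding_simps rel_simps simp_thms]

lemmas letter_values = oddpart_values oddpart_unfolded_values core_values core_shifted_values

text \<open>
  \<open>check_period f m d hi p q\<close> looks for the last position \<open>q < p + m\<close> with \<open>f q \<noteq> f (q + d)\<close>,
  which settles all starting positions up to \<open>q\<close>.
\<close>

function check_period :: "(nat \<Rightarrow> nat) \<Rightarrow> nat \<Rightarrow> nat \<Rightarrow> nat \<Rightarrow> nat \<Rightarrow> nat \<Rightarrow> bool" where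
  "check_period f m d hi p q =
    (if f q = f (q + d) then
       if q = p then False else if q = 0 then False else check_period f m d hi p (q - 1)
     else if q < p then False
     else if hi \<le> q + 1 then True
     else check_period f m d hi (q + 1) (q + m))"
  by auto
termination
  by (relation "(\<lambda>(f, m, d, hi, p, q). hi - p) <*mlex*> measure (\<lambda>(f, m, d, hi, p, q). q)")
    (auto simp: wf_mlex mlex_less mlex_leq)

declare check_period.simps [simp del]

lemma check_period_sound:
  assumes "check_period f m (4 * m) hi p q" "q < p + m" "p \<le> s" "s < hi"
  shows "\<not> rep f m s"
  using assms
proof (induction f m "4 * m" hi p q rule: check_period.induct)
  case (1 f m hi p q)
  note c = "1.prems"(1)[unfolded check_period.simps[of f m "4 * m" hi p q]]
  show ?case
  proof (cases "f q = f (q + 4 * m)")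
    case True
    hence h: "q \<noteq> p" "q \<noteq> 0" "check_period f m (4 * m) hi p (q - 1)"
      using c by (auto split: if_splits)
    have "q - 1 < p + m" using "1.prems"(2) by simp
    thus ?thesis using "1.hyps"(1)[OF True h] "1.prems"(3,4) by simp
  next
    case False
    hence h: "\<not> q < p" "hi \<le> q + 1 \<or> check_period f m (4 * m) hi (q + 1) (q + m)"
      using c by (auto split: if_splits)
    show ?thesis
    proof (cases "s \<le> q")
      case True
      hence "q - s < m" "s + (q - s) = q" using "1.prems"(2,3) by auto
      thus ?thesis using False unfolding rep_def by metis
    next
      case sq: False
      hence "\<not> hi \<le> q + 1" using "1.prems"(4) by simp
      thus ?thesis using "1.hyps"(2)[OF False h(1)] h(2) sq "1.prems" by simp
    qed
  qed
qed

text \<open>When \<open>m\<close> decreases by one, the bound on the start grows by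
  \<open>c\<close>. So \<open>c = 0\<close> checks a rectangle of starts and lengths, and
  \<open>c = 4\<close> the region where start plus \<open>4 * m\<close> stays below a fixed
  bound.\<close>

function check_periods :: "(nat \<Rightarrow> nat) \<Rightarrow> nat \<Rightarrow> nat \<Rightarrow> nat \<Rightarrow> nat \<Rightarrow> nat \<Rightarrow> bool" where
  "check_periods f lo hi c k m =
    (if m < k then True else if m = 0 then False
     else if check_period f m (4 * m) hi lo (lo + m - 1) then check_periods f lo (hi + c) c k (m - 1)
     else False)"
  by auto
termination by (relation "measure (\<lambda>(f, lo, hi, c, k, m). m)") auto

declare check_periods.simps [simp del]

lemma check_periods_sound:
  assumes "check_periods f lo hi c k m" "k \<le> l" "l \<le> m" "lo \<le> s" "s < hi + c * (m - l)"
  shows "\<not> rep f l s"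
  using assms
proof (induction f lo hi c k m rule: check_periods.induct)
  case (1 f lo hi c k m)
  note c = 1(2)[unfolded check_periods.simps[of f lo hi c k m]]
  have m: "\<not> m < k" "m \<noteq> 0" using c 1(3,4) by (auto split: if_splits)
  hence h: "check_period f m (4 * m) hi lo (lo + m - 1)" "check_periods f lo (hi + c) c k (m - 1)"
    using c by (auto split: if_splits)
  show ?case
  proof (cases "l = m")
    case True
    thus ?thesis using check_period_sound[OF h(1)] m 1(5,6) by simp
  next
    case False
    hence "m - l = Suc (m - 1 - l)" using 1(4) by simp
    hence "s < hi + c + c * (m - 1 - l)" using 1(6) by simp
    thus ?thesis using 1(1) m h 1(3,4,5) False by simp
  qed
qed

section \<open>Evaluation by rewriting, and further checks\<close>

lemma numeral_minus_one:
  "numeral (num.Bit0 n) - 1 = (numeral (Num.BitM n) :: nat)"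
  "numeral (num.Bit1 n) - 1 = (numeral (num.Bit0 n) :: nat)"
  "1 - (1::nat) = 0"
  by (simp_all add: numeral_BitM)

text \<open>The checks are evaluated by rewriting with these rules and the letter equations. They
  use nested \<open>if\<close> instead of conjunctions: under \<open>if_weak_cong\<close> only the
  condition is rewritten, so a recursive call is unfolded after its guard is decided.\<close>

lemmas numeral_eval = numeral_minus_one numeral_One Num.BitM.simps add_num_simps mult_num_simps
  numeral_plus_numeral numeral_plus_one one_plus_numeral one_add_one add_0 add_0_right
  numeral_times_numeral mult_1_left mult_1_right
  numeral_eq_iff numeral_le_iff numeral_less_iff num.inject num.distinct le_num_simps less_num_simps
  numeral_eq_one_iff one_eq_numeral_iff zero_neq_numeral numeral_neq_zero zero_neq_one one_neq_zero
  one_le_numeral numeral_le_one_iff one_less_numeral_iff not_numeral_less_one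
  not_numeral_less_zero zero_less_numeral not_numeral_le_zero zero_le_numeral
  zero_less_one zero_le_one not_one_le_zero not_one_less_zero less_irrefl order_refl
  if_True if_False simp_thms

function check_adjacent :: "(nat \<Rightarrow> nat) \<Rightarrow> nat \<Rightarrow> nat \<Rightarrow> bool" where
  "check_adjacent f hi p =
    (if hi \<le> p then True else if f p = f (p + 2) then False else check_adjacent f hi (p + 1))"
  by auto
termination by (relation "measure (\<lambda>(f, hi, p). hi - p)") auto

declare check_adjacent.simps [simp del]

lemma check_adjacent_sound:
  "check_adjacent f hi p \<Longrightarrow> p \<le> s \<Longrightarrow> s < hi \<Longrightarrow> f s \<noteq> f (s + 2)"
proof (induction f hi p rule: check_adjacent.induct)
  case (1 f hi p)
  thus ?case using check_adjacent.simps[of f hi p] by (cases "s = p") (auto split: if_splits)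
qed

function check_column :: "(nat \<Rightarrow> nat) \<Rightarrow> nat \<Rightarrow> nat \<Rightarrow> nat \<Rightarrow> bool" where
  "check_column f c hi p =
    (if hi \<le> p then True else if f p = c then check_column f c hi (p + 3) else False)"
  by auto
termination by (relation "measure (\<lambda>(f, c, hi, p). hi - p)") auto

declare check_column.simps [simp del]

lemma check_column_sound:
  "check_column f c hi p \<Longrightarrow> p \<le> s \<Longrightarrow> s < hi \<Longrightarrow> s mod 3 = p mod 3 \<Longrightarrow> f s = c"
proof (induction f c hi p rule: check_column.induct)
  case (1 f c hi p)
  show ?case
  proof (cases "s = p")
    case False
    hence "p + 3 \<le> s" using "1.prems"(2,4) by presburger
    thus ?thesis using 1 check_column.simps[of f c hi p] by (auto split: if_splits)
  qed (use "1.prems" check_column.simps[of f c hi p] in \<open>auto split: if_splits\<close>)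
qed

function check_nonzero :: "(nat \<Rightarrow> nat) \<Rightarrow> nat \<Rightarrow> nat \<Rightarrow> bool" where
  "check_nonzero f hi p =
    (if hi \<le> p then True else if f p = 0 then False else check_nonzero f hi (p + 3))"
  by auto
termination by (relation "measure (\<lambda>(f, hi, p). hi - p)") auto

declare check_nonzero.simps [simp del]

lemma check_nonzero_sound:
  "check_nonzero f hi p \<Longrightarrow> p \<le> s \<Longrightarrow> s < hi \<Longrightarrow> s mod 3 = p mod 3 \<Longrightarrow> f s \<noteq> 0"
proof (induction f hi p rule: check_nonzero.induct)
  case (1 f hi p)
  show ?case
  proof (cases "s = p")
    case False
    hence "p + 3 \<le> s" using "1.prems"(2,4) by presburger
    thus ?thesis using 1 check_nonzero.simps[of f hi p] by (auto split: if_splits)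
  qed (use "1.prems" check_nonzero.simps[of f hi p] in \<open>auto split: if_splits\<close>)
qed

function check_run :: "(nat \<Rightarrow> nat) \<Rightarrow> nat \<Rightarrow> nat \<Rightarrow> nat \<Rightarrow> bool" where
  "check_run f d b e =
    (if e \<le> b then True else if f b = f (b + d) then check_run f d (b + 1) e else False)"
  by auto
termination by (relation "measure (\<lambda>(f, d, b, e). e - b)") auto

declare check_run.simps [simp del]

lemma check_run_sound: "check_run f d b e \<Longrightarrow> b \<le> s \<Longrightarrow> s < e \<Longrightarrow> f s = f (s + d)"
proof (induction f d b e rule: check_run.induct)
  case (1 f d b e)
  thus ?case using check_run.simps[of f d b e] by (cases "s = b") (auto split: if_splits)
qed

text \<open>The list \<open>ms\<close> offers candidate lengths for the blocking power; a short list
  replaces a search over all \<open>m\<close>.\<close>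

fun check_blocked :: "(nat \<Rightarrow> nat) \<Rightarrow> nat \<Rightarrow> nat \<Rightarrow> nat \<Rightarrow> nat list \<Rightarrow> bool" where
  "check_blocked f a n c [] = False"
| "check_blocked f a n c (m # ms) =
    (if a + 5 * m \<le> n + 1 then
       if f (n - 4 * m) = c then
         if check_run f (4 * m) (n + 1 - 5 * m) (n - 4 * m) then True else check_blocked f a n c ms
       else check_blocked f a n c ms
     else check_blocked f a n c ms)"

lemma check_blocked_sound:
  "check_blocked f a n c ms \<Longrightarrow> 0 \<notin> set ms \<Longrightarrow> blocked f a n c"
proof (induction ms)
  case (Cons m ms)
  show ?case
  proof (cases "a + 5 * m \<le> n + 1 \<and> f (n - 4 * m) = c \<and>
      check_run f (4 * m) (n + 1 - 5 * m) (n - 4 * m)")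
    case True
    have "f (n - k) = f (n - k - 4 * m)" if "1 \<le> k" "k < m" for k
    proof -
      have "n + 1 - 5 * m \<le> n - k - 4 * m" "n - k - 4 * m < n - 4 * m" "n - k - 4 * m + 4 * m = n - k"
        using True that by linarith+
      thus ?thesis using check_run_sound True by metis
    qed
    thus ?thesis unfolding blocked_def using True Cons.prems(2) by (intro exI[of _ m]) auto
  qed (use Cons in \<open>auto split: if_splits\<close>)
qed simp

function check_letter :: "(nat \<Rightarrow> nat) \<Rightarrow> nat \<Rightarrow> nat list \<Rightarrow> nat \<Rightarrow> nat \<Rightarrow> nat \<Rightarrow> bool" where
  "check_letter f a ms n v c =
    (if v \<le> c then True
     else if a + 2 \<le> n then
       if f (n - 2) = c then check_letter f a ms n v (c + 1)
       else if check_blocked f a n c ms then check_letter f a ms n v (c + 1) else False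
     else if check_blocked f a n c ms then check_letter f a ms n v (c + 1) else False)"
  by auto
termination by (relation "measure (\<lambda>(f, a, ms, n, v, c). v - c)") auto

declare check_letter.simps [simp del]

lemma check_letter_sound:
  "check_letter f a ms n v c \<Longrightarrow> 0 \<notin> set ms \<Longrightarrow> c \<le> x \<Longrightarrow> x < v \<Longrightarrow> excluded f a n x"
proof (induction f a ms n v c rule: check_letter.induct)
  case (1 f a ms n v c)
  show ?case
  proof (cases "x = c")
    case True
    thus ?thesis using "1.prems" check_letter.simps[of f a ms n v c] check_blocked_sound[of f a n c ms]
      unfolding excluded_def by (auto split: if_splits)
  next
    case False
    hence "c + 1 \<le> x" "\<not> v \<le> c" using "1.prems" by auto
    moreover from this have "check_letter f a ms n v (c + 1)"
      using "1.prems"(1) check_letter.simps[of f a ms n v c] by (auto split: if_splits)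
    ultimately show ?thesis
      using 1 check_letter.simps[of f a ms n v c] by (auto split: if_splits)
  qed
qed

function check_letters :: "(nat \<Rightarrow> nat) \<Rightarrow> nat \<Rightarrow> nat list \<Rightarrow> nat \<Rightarrow> nat \<Rightarrow> bool" where
  "check_letters f a ms hi n =
    (if hi \<le> n then True
     else if check_letter f a ms n (f n) 0 then check_letters f a ms hi (n + 1) else False)"
  by auto
termination by (relation "measure (\<lambda>(f, a, ms, hi, n). hi - n)") auto

declare check_letters.simps [simp del]

lemma check_letters_sound:
  "check_letters f a ms hi p \<Longrightarrow> 0 \<notin> set ms \<Longrightarrow> p \<le> n \<Longrightarrow> n < hi \<Longrightarrow> c < f n \<Longrightarrow> excluded f a n c"
proof (induction f a ms hi p rule: check_letters.induct)
  case (1 f a ms hi p)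
  have "\<not> hi \<le> p" using "1.prems" by simp
  hence "check_letter f a ms p (f p) 0" "check_letters f a ms hi (p + 1)"
    using "1.prems"(1) check_letters.simps[of f a ms hi p] by (auto split: if_splits)
  thus ?case using 1 check_letter_sound[of f a ms p "f p" 0 c] \<open>\<not> hi \<le> p\<close>
    by (cases "n = p") auto
qed

lemmas check_rules = check_period.simps check_periods.simps check_adjacent.simps check_column.simps
  check_nonzero.simps check_run.simps check_blocked.simps check_letter.simps check_letters.simps

lemma nat_eval:
  "nat 1 = 1" "nat (- 1) = 0" "nat (- numeral k) = 0" "(1::nat) - numeral k = 0" "(0::nat) - x = 0"
  by simp_all

lemmas minus_eval = diff_nat_numeral diff_numeral_simps(1) sub_num_simps nat_numeral nat_0 nat_eval
  Num.dbl_simps Num.dbl_inc_simps Num.dbl_dec_simps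

text \<open>These lengths, together with the distance-2 rule, exclude every smaller letter at the
  positions 613 to 10975 of \<open>core\<close>.\<close>

abbreviation core_witnesses :: "nat list" where
  "core_witnesses \<equiv> [1, 3, 6, 9, 12, 15, 18, 21, 33, 42, 57, 60, 66, 69, 72, 75, 78, 90, 93, 111, 138, 141,
    144, 147, 150, 168, 171, 180, 183, 204, 210, 225, 510]"

lemmas check_eval = letter_values check_rules minus_eval numeral_eval

text \<open>From \<open>m = 911\<close> on the shift \<open>4 * m\<close> exceeds the transient, and
  the window is long enough for the argument by residues in
  \<open>oddpart_rep_early\<close>.\<close>

lemma oddpart_periods:
  "check_periods oddpart 0 3637 0 1 910"
  by (simp only: check_eval cong: if_weak_cong)

lemma core_periods_1:
  "check_periods core 606 10255 0 100 699"
  by (simp only: check_eval cong: if_weak_cong)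

lemma core_periods_2:
  "check_periods core 606 10255 0 1 99"
  by (simp only: check_eval cong: if_weak_cong)

text \<open>Since \<open>609 + 4 * 2517 = 10677\<close>, this covers all pairs with
  \<open>s + 4 * m < 10677\<close>. From 10677 on, the multiples of 3 carry the constant letter 1 in
  \<open>core\<close>.\<close>

lemma core_periods_3:
  "check_periods core 606 609 4 700 2517"
  by (simp only: check_eval cong: if_weak_cong)

text \<open>The bound 3681 is \<open>6 * 613 + 3\<close>: beyond it, exclusion in
  \<open>oddpart\<close> is derived from exclusion in \<open>core\<close> from 613 on.\<close>

lemma oddpart_letters:
  "check_letters oddpart 0 [1, 3, 6, 9, 12, 15, 18, 30, 48, 50, 60, 69, 72, 105, 122, 123, 183, 476]
    3681 0"
  by (simp only: check_eval cong: if_weak_cong)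

lemma core_letters_1:
  "check_letters core 607 core_witnesses 5600 613"
  by (simp only: check_eval cong: if_weak_cong)

text \<open>The bound 10976 is \<open>3681 + 7295\<close>, the first index whose copy in
  \<open>oddpart\<close> is covered by \<open>excluded_core_late\<close>.\<close>

lemma core_letters_2:
  "check_letters core 607 core_witnesses 10976 5600"
  by (simp only: check_eval cong: if_weak_cong)

text \<open>At \<open>10932 = 3637 + 7295\<close> the copy of the regular part of
  \<open>oddpart\<close> begins in \<open>core\<close>. Inside its table, \<open>oddpart\<close> is
  already 0 on the class 2 modulo 3 from 950 on, and 1 on the class 1 from 3382 on.\<close>

lemma column_checks:
  "check_adjacent oddpart 3637 0"
  "check_adjacent core 10255 606"
  "check_column core 0 10932 607"
  "check_nonzero core 10932 606"
  "check_nonzero core 10932 608"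
  "check_column oddpart 0 3637 950"
  "check_column oddpart 1 3637 3382"
  by (simp_all only: check_eval cong: if_weak_cong)

text \<open>Positions that break the later pattern of their column. The gaps between 910, 1804, 2686
  and 3379 are small enough for every window of 911 letters of \<open>oddpart\<close> that starts up
  to 3379 to contain one of them. The listed indices of \<open>core\<close> do the same for windows
  of 700 letters that start in \<open>y_table\<close>.\<close>

lemma exceptional_values:
  "oddpart 361 \<notin> {0, 1}" "oddpart 362 \<noteq> 1" "oddpart 910 \<noteq> 1" "oddpart 1804 \<noteq> 1" "oddpart 2686 \<noteq> 1"
  "oddpart 3379 \<noteq> 1" "oddpart 3636 = 4"
  "\<forall>j \<in> {1245, 1944, 2628, 3327, 3951, 4650, 5349, 5994, 6693, 7392, 8088, 8787, 9486, 10179, 10674}.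
    core j \<noteq> 1"
  by (simp_all only: check_eval ball_simps insert_iff empty_iff cong: if_weak_cong)

section \<open>Freeness and minimality\<close>

lemma core_mod3_0:
  assumes "j \<ge> 10677" and "j mod 3 = 0" shows "core j = 1"
proof -
  define n where "n = j - 7295"
  have n: "j = n + 7295" using assms(1) by (simp add: n_def)
  have h: "n \<ge> 3382" using assms(1) n by simp
  have h': "n mod 3 = 1" using assms(2) unfolding n by presburger
  have "oddpart n = 1"
  proof (cases "n < 3637")
    case True
    thus ?thesis using check_column_sound[OF column_checks(7), of n] h h' by simp
  next
    case False
    thus ?thesis using oddpart_mod3_1 h' by simp
  qed
  thus ?thesis using assms core_shift n by simp
qed

lemma oddpart_mod6_cases:
  fixes n :: nat
  obtains "n mod 3 = 1" | "n mod 3 = 2" | "n mod 3 = 0" "n = 6 * (n div 6)"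
  | "n mod 3 = 0" "n = 6 * (n div 6) + 3"
proof -
  have "n mod 3 = 1 \<or> n mod 3 = 2 \<or> n mod 3 = 0 \<and> n = 6 * (n div 6) \<or> n mod 3 = 0 \<and> n = 6 * (n div 6) + 3"
    by presburger
  thus thesis by (elim disjE conjE) (rule that; assumption)+
qed

lemma oddpart_ge_2:
  assumes "n \<ge> 3637" "n mod 3 = 0" shows "oddpart n \<ge> 2"
proof (cases n rule: oddpart_mod6_cases)
  case 3
  hence "n div 6 \<ge> 607" using assms(1) by linarith
  thus ?thesis using oddpart_mod6_0[of "n div 6"] 3 by (simp split: if_splits)
next
  case 4
  hence "n div 6 \<ge> 606" using assms(1) by linarith
  thus ?thesis using oddpart_mod6_3[of "n div 6"] 4 by simp
qed (use assms in auto)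

lemma oddpart_eq_0:
  assumes "n \<ge> 3637" shows "oddpart n = 0 \<longleftrightarrow> n mod 3 = 2"
  using assms oddpart_mod3_1[of n] oddpart_mod3_2[of n] oddpart_ge_2[of n]
  by (cases n rule: oddpart_mod6_cases) auto

lemma core_eq_0:
  assumes "j \<ge> 606" shows "core j = 0 \<longleftrightarrow> j mod 3 = 1"
proof (cases "j < 10932")
  case True
  have "j mod 3 = 0 \<or> j mod 3 = 1 \<and> j \<ge> 607 \<or> j mod 3 = 2 \<and> j \<ge> 608"
    using assms by presburger
  thus ?thesis
    using True assms check_column_sound[OF column_checks(3), of j]
        check_nonzero_sound[OF column_checks(4), of j] check_nonzero_sound[OF column_checks(5), of j]
        by auto
next
  case False
  define n where "n = j - 7295"
  have n: "j = n + 7295" "n \<ge> 3637" using False by (simp_all add: n_def)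
  have "n mod 3 = 2 \<longleftrightarrow> j mod 3 = 1" unfolding n(1) by presburger
  thus ?thesis using oddpart_eq_0[OF n(2)] n core_shift by simp
qed

text \<open>Beyond the transient the letters 0, 1 and those from 2 on mark the residues 2, 1 and 0,
  so equal letters lie at a distance divisible by 3.\<close>

lemma oddpart_mod3_eq:
  assumes "s \<ge> 3637" "t \<ge> 3637" "oddpart s = oddpart t" shows "s mod 3 = t mod 3"
proof -
  have "oddpart n = 0 \<and> n mod 3 = 2 \<or> oddpart n = 1 \<and> n mod 3 = 1 \<or> oddpart n \<ge> 2 \<and> n mod 3 = 0"
    if "n \<ge> 3637" for n
    using that oddpart_mod3_1[of n] oddpart_mod3_2[of n] oddpart_ge_2[of n]
    by (cases n rule: oddpart_mod6_cases) auto
  from this[OF assms(1)] this[OF assms(2)] show ?thesis using assms(3) by auto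
qed

lemma oddpart_adjacent: "oddpart i \<noteq> oddpart (i + 2)"
proof (cases "i < 3637")
  case True
  thus ?thesis using check_adjacent_sound[OF column_checks(1)] by simp
next
  case False
  have "i mod 3 \<noteq> (i + 2) mod 3" by presburger
  thus ?thesis using oddpart_mod3_eq[of i "i + 2"] False by auto
qed

lemma core_adjacent:
  assumes "j \<ge> 606" shows "core j \<noteq> core (j + 2)"
proof (cases "j < 10255")
  case True
  thus ?thesis using check_adjacent_sound[OF column_checks(2)] assms by simp
next
  case False
  hence "j + 2 - 7295 = j - 7295 + 2" by simp
  thus ?thesis using oddpart_adjacent[of "j - 7295"] core_shift[of j] core_shift[of "j + 2"] False
    by simp
qed

text \<open>The shift moves \<open>a\<close> by \<open>2 * k\<close>, which is 2 modulo 4 for odd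
  \<open>k\<close>. This exchanges the classes 0, 3 of the letter 3 with the classes 1, 2 of the
  letter 2.\<close>

lemma oddpart_column_0_flip:
  assumes "a \<ge> 607" "odd k" shows "oddpart (6 * a) \<noteq> oddpart (6 * a + 12 * k)"
proof -
  obtain b where "k = 2 * b + 1" using assms(2) by (elim oddE)
  hence e: "6 * a + 12 * k = 6 * (a + 2 + 4 * b)" by simp
  have "(a + 2 + 4 * b) mod 4 \<in> {0, 3} \<longleftrightarrow> a mod 4 \<notin> {0, 3}" by (simp, presburger)
  thus ?thesis unfolding e
    using oddpart_mod6_0[of a] oddpart_mod6_0[of "a + 2 + 4 * b"] assms(1) by (simp split: if_splits)
qed

lemma exceptional_core:
  assumes "606 \<le> s" "s < 10255"
  obtains e where "s \<le> e" "e < s + 700" "e mod 3 = 0" "core e \<noteq> 1"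
proof -
  have "\<exists>e \<in> {1245, 1944, 2628, 3327, 3951, 4650, 5349, 5994, 6693, 7392, 8088, 8787, 9486, 10179, 10674}.
      s \<le> e \<and> e < s + 700"
    using assms by (simp, presburger)
  then obtain e where e: "e \<in> {1245, 1944, 2628, 3327, 3951, 4650, 5349, 5994, 6693, 7392, 8088, 8787,
      9486, 10179, 10674}" "s \<le> e" "e < s + 700" by blast
  have "core e \<noteq> 1" using exceptional_values(8) e(1) by (rule bspec)
  moreover have "e mod 3 = 0" using e(1) by (elim insertE) simp_all
  ultimately show thesis using that e(2,3) by metis
qed

lemma exceptional_oddpart:
  assumes "s \<le> 3379"
  obtains e where "s \<le> e" "e < s + 911" "e mod 3 = 1" "oddpart e \<noteq> 1"
proof -
  have "s \<le> 910 \<or> 910 < s \<and> s \<le> 1804 \<or> 1804 < s \<and> s \<le> 2686 \<or> 2686 < s" by linarith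
  thus thesis
    using that[of 910] that[of 1804] that[of 2686] that[of 3379] exceptional_values assms by auto
qed

lemma oddpart_zero_near:
  assumes "361 < s"
  obtains t where "s \<le> t" "t < s + 911" "t mod 3 = 2" "oddpart t = 0"
proof -
  have zero: "oddpart t = 0" if "t \<ge> 950" "t mod 3 = 2" for t
    using that oddpart_mod3_2[of t] check_column_sound[OF column_checks(6), of t]
    by (cases "t < 3637") auto
  show thesis
  proof (cases "s \<le> 950")
    case True
    thus ?thesis using that[of 950] zero[of 950] assms by simp
  next
    case False
    define t where "t = 3 * (s div 3) + 2"
    have "t mod 3 = 2" unfolding t_def by presburger
    moreover have "s \<le> t" "t < s + 911" unfolding t_def by linarith+
    ultimately show ?thesis using that[of t] zero[of t] False by simp
  qed
qed

text \<open>For \<open>m\<close> at least 911 the second \<open>x\<close> lies in the regular part.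
  For each residue of \<open>m\<close> modulo 3 some letter of the first \<open>x\<close> differs
  from what the regular part shows at the corresponding place.\<close>

lemma oddpart_rep_early:
  assumes "m \<ge> 1" "s < 3637" shows "\<not> rep oddpart m s"
proof
  assume rep: "rep oddpart m s"
  have r: "oddpart t = oddpart (t + 4 * m)" if "s \<le> t" "t < s + m" for t
    using rep that unfolding rep_def by (metis le_add_diff_inverse nat_add_left_cancel_less)
  have big: "m \<ge> 911"
  proof (rule ccontr)
    assume "\<not> m \<ge> 911"
    thus False using check_periods_sound[OF oddpart_periods, of m s] assms rep by simp
  qed
  consider (zero) "m mod 3 = 0" | (one) "m mod 3 = 1" | (two) "m mod 3 = 2" by linarith
  thus False
  proof cases
    case zero
    show False
    proof (cases "s \<le> 3379")
      case True
      then obtain e where e: "s \<le> e" "e < s + 911" "e mod 3 = 1" "oddpart e \<noteq> 1"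
        by (rule exceptional_oddpart)
      have "(e + 4 * m) mod 3 = 1" using e(3) zero by presburger
      thus False using r[of e] e big oddpart_mod3_1[of "e + 4 * m"] by simp
    next
      case False
      show False
      \<comment> \<open>The window now contains 3636 and 3642. The irregular letter 4 at 3636 meets
        a letter 2 if \<open>m\<close> is even; for odd \<open>m\<close> the multiples of 6 disagree
        already at 3642.\<close>
      proof (cases "even m")
        case True
        hence "m mod 6 = 0" using zero by presburger
        then obtain b where "m = 6 * b" by (metis dvdE mod_0_imp_dvd)
        hence "3636 + 4 * m = 6 * (606 + 4 * b)" by simp
        moreover have "(606 + 4 * b) mod 4 = 2" by presburger
        ultimately have "oddpart (3636 + 4 * m) = 2" 
          using oddpart_mod6_0[of "606 + 4 * b"] \<open>m = 6 * b\<close> big by simp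
        thus False using r[of 3636] False assms(2) big exceptional_values by simp
      next
        case odd: False
        obtain k where "m = 3 * k" using zero by (metis dvdE mod_0_imp_dvd)
        hence "odd k" using odd by simp
        hence "oddpart 3642 \<noteq> oddpart (3642 + 12 * k)" using oddpart_column_0_flip[of 607 k] by simp
        thus False using r[of 3642] False assms(2) big \<open>m = 3 * k\<close> by simp
      qed
    qed
  next
    case one
    show False
    \<comment> \<open>An early window contains 361, whose nonzero letter would meet a 0 of the class
      2. A later window contains a 0 of this class itself, which is shifted out of the
      class.\<close>
    proof (cases "s \<le> 361")
      case True
      have "(361 + 4 * m) mod 3 = 2" using one by presburger
      hence "oddpart (361 + 4 * m) = 0" using oddpart_mod3_2 big by simp
      thus False using r[of 361] True big exceptional_values by simp
    next
      case False
      then obtain t where t: "s \<le> t" "t < s + 911" "t mod 3 = 2" "oddpart t = 0"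
        by (meson not_le_imp_less oddpart_zero_near)
      have "(t + 4 * m) mod 3 \<noteq> 2" using t(3) one by presburger
      thus False using r[of t] t oddpart_eq_0[of "t + 4 * m"] big by simp
    qed
  next
    case two
    show False
    proof (cases "s \<le> 361")
      case True
      have "(362 + 4 * m) mod 3 = 1" using two by presburger
      hence "oddpart (362 + 4 * m) = 1" using oddpart_mod3_1 big by simp
      thus False using r[of 362] True big exceptional_values by simp
    next
      case False
      then obtain t where t: "s \<le> t" "t < s + 911" "t mod 3 = 2" "oddpart t = 0"
        by (meson not_le_imp_less oddpart_zero_near)
      have "(t + 4 * m) mod 3 \<noteq> 2" using t(3) two by presburger
      thus False using r[of t] t oddpart_eq_0[of "t + 4 * m"] big by simp
    qed
  qed
qed

text \<open>The residues modulo 3 force \<open>m = 3 * k\<close>, and the flip at multiples of 6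
  forces \<open>k\<close> to be even. The positions \<open>6 * a + 3\<close> then form a power in
  \<open>core\<close>.\<close>

lemma oddpart_rep_late:
  assumes "m \<ge> 1" "s \<ge> 3637" and rep: "rep oddpart m s"
  obtains b where "m = 6 * b" "rep core b ((s + 2) div 6)"
proof -
  have r: "oddpart t = oddpart (t + 4 * m)" if "s \<le> t" "t < s + m" for t
    using rep that unfolding rep_def by (metis le_add_diff_inverse nat_add_left_cancel_less)
  have "s mod 3 = (s + 4 * m) mod 3"
    using r[of s] assms(1,2) oddpart_mod3_eq[of s "s + 4 * m"] by simp
  hence "m mod 3 = 0" by presburger
  then obtain k where k: "m = 3 * k" by (metis dvdE mod_0_imp_dvd)
  have col: "oddpart (6 * a) = oddpart (6 * a + 12 * k)" if "s \<le> 6 * a" "6 * a < s + m" for a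
    using r[OF that] k by simp
  have "even k"
  proof (rule ccontr)
    assume odd: "odd k"
    have no: False if "s \<le> 6 * a" "6 * a < s + m" for a
    proof -
      have "a \<ge> 607" using that(1) assms(2) by linarith
      thus False using oddpart_column_0_flip[of a k] odd col[OF that] by simp
    qed
    define a where "a = (s + 5) div 6"
    have a: "s \<le> 6 * a" "6 * a \<le> s + 5" unfolding a_def by linarith+
    show False
    proof (cases "k = 1")
      case False
      hence "k \<ge> 3" using odd by presburger
      thus False using no[of a] a k by simp
    next
      \<comment> \<open>For \<open>k = 1\<close> a window of three letters may avoid the multiples
        of 6. It then contains some \<open>6 * c + 3\<close>, and the shift 12 yields equal letters
        of \<open>core\<close> at distance 2. This is where the distance-2 rule for
        \<open>core\<close> enters.\<close>
      case True
      hence "6 * a \<ge> s + 3" using no[of a] a k by fastforce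
      define c where "c = a - 1"
      have c: "s \<le> 6 * c + 3" "6 * c + 3 < s + m" "c \<ge> 606"
        using a \<open>6 * a \<ge> s + 3\<close> assms(2) k True unfolding c_def by linarith+
      have "oddpart (6 * (c + 2) + 3) = oddpart (6 * c + 3)" using r[OF c(1,2)] k True by (simp add: algebra_simps)
      hence "core (c + 2) = core c" using oddpart_mod6_3[of c] oddpart_mod6_3[of "c + 2"] c(3) by simp
      thus False using core_adjacent[OF c(3)] by simp
    qed
  qed
  then obtain b where "k = 2 * b" by (elim evenE)
  hence b: "m = 6 * b" using k by simp
  \<comment> \<open>The start \<open>(s + 2) div 6\<close> is the least \<open>a\<close> with
    \<open>s \<le> 6 * a + 3\<close>.\<close>
  moreover have "rep core b ((s + 2) div 6)"
    unfolding rep_def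
  proof (intro allI impI)
    fix i assume "i < b"
    define q where "q = (s + 2) div 6"
    have q: "6 * q \<le> s + 2" "s + 2 < 6 * q + 6" "q \<ge> 606"
      unfolding q_def using assms(2) by linarith+
    define a where "a = q + i"
    have a: "s \<le> 6 * a + 3" "6 * a + 3 < s + m" "a \<ge> 606"
      unfolding a_def b using q \<open>i < b\<close> by simp_all
    have "6 * a + 3 + 4 * m = 6 * (a + 4 * b) + 3" using b by simp
    hence "core a + 2 = core (a + 4 * b) + 2"
      using r[OF a(1,2)] oddpart_mod6_3[of a] oddpart_mod6_3[of "a + 4 * b"] a(3) by (simp only: trans_le_add1)
    thus "core ((s + 2) div 6 + i) = core ((s + 2) div 6 + i + 4 * b)"
      unfolding a_def q_def by simp
  qed
  ultimately show thesis by (rule that)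
qed

text \<open>The checks leave only \<open>m\<close> at least 700 with the second \<open>x\<close>
  starting from 10677 on. If 3 divides \<open>m\<close>, an exceptional letter meets the constant 1;
  otherwise a 0 is shifted out of the only class that contains 0.\<close>

lemma core_rep_early:
  assumes "m \<ge> 1" "606 \<le> s" "s < 10255" shows "\<not> rep core m s"
proof
  assume rep: "rep core m s"
  have r: "core t = core (t + 4 * m)" if "s \<le> t" "t < s + m" for t
    using rep that unfolding rep_def by (metis le_add_diff_inverse nat_add_left_cancel_less)
  have "m \<ge> 700"
  proof (rule ccontr)
    assume "\<not> m \<ge> 700"
    thus False using rep assms check_periods_sound[OF core_periods_1, of m s]
        check_periods_sound[OF core_periods_2, of m s] by (cases "m \<le> 99") simp_all
  qed
  have late: "s + 4 * m \<ge> 10677"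
  proof (rule ccontr)
    assume n: "\<not> s + 4 * m \<ge> 10677"
    hence "m \<le> 2517" "s < 609 + 4 * (2517 - m)" using assms(2) by linarith+
    thus False using rep assms \<open>m \<ge> 700\<close> check_periods_sound[OF core_periods_3, of m s] by simp
  qed
  show False
  proof (cases "m mod 3 = 0")
    case True
    obtain e where e: "s \<le> e" "e < s + 700" "e mod 3 = 0" "core e \<noteq> 1"
      using exceptional_core[OF assms(2,3)] by blast
    have "(e + 4 * m) mod 3 = 0" using e(3) True by presburger
    thus False using r[of e] e \<open>m \<ge> 700\<close> late core_mod3_0[of "e + 4 * m"] by simp
  next
    case False
    define t where "t = 3 * ((s + 1) div 3) + 1"
    have t: "s \<le> t" "t \<le> s + 2" unfolding t_def by linarith+
    have "t mod 3 = 1" unfolding t_def by presburger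
    moreover from this have "(t + 4 * m) mod 3 \<noteq> 1" using False by presburger
    ultimately show False
      using core_eq_0[of t] core_eq_0[of "t + 4 * m"] r[of t] t assms(2) \<open>m \<ge> 700\<close> by simp
  qed
qed

text \<open>A late power in \<open>oddpart\<close> gives one in \<open>core\<close> with a sixth of
  \<open>m\<close>, which the induction excludes. A late power in \<open>core\<close> is one in
  \<open>oddpart\<close> with the same \<open>m\<close>, so within each step \<open>oddpart\<close>
  is settled before \<open>core\<close>.\<close>

lemma no_rep: "m \<ge> 1 \<Longrightarrow> \<not> rep oddpart m s \<and> (606 \<le> s \<longrightarrow> \<not> rep core m s)"
proof (induction m arbitrary: s rule: less_induct)
  case (less m)
  have odd: "\<not> rep oddpart m s" for s
  proof (cases "s < 3637")
    case True
    thus ?thesis using oddpart_rep_early less.prems by simp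
  next
    case False
    show ?thesis
    proof
      assume "rep oddpart m s"
      then obtain b where "m = 6 * b" "rep core b ((s + 2) div 6)"
        using oddpart_rep_late[of m s] False less.prems by (metis not_le)
      moreover have "606 \<le> (s + 2) div 6" using False by linarith
      ultimately show False using less.IH[of b] less.prems by auto
    qed
  qed
  moreover have "\<not> rep core m s" if "606 \<le> s"
  proof (cases "s < 10255")
    case True
    thus ?thesis using core_rep_early less.prems that by simp
  next
    case False
    have "rep core m s \<longleftrightarrow> rep oddpart m (s - 7295)"
      unfolding rep_def using False core_shift by simp
    thus ?thesis using odd by simp
  qed
  ultimately show ?case by blast
qed

lemma admissible_oddpart: "admissible oddpart 0"
  unfolding admissible_def by (intro conjI allI impI oddpart_adjacent no_rep[THEN conjunct1])

section \<open>Minimality\<close>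

lemma oddpart_column_0: "a \<ge> 607 \<Longrightarrow> oddpart (6 * a) \<in> {2, 3}"
  by (simp add: oddpart_mod6_0)

lemma oddpart_column_1: "a \<ge> 1213 \<Longrightarrow> oddpart (3 * a + 1) = 1"
  by (rule oddpart_mod3_1) (simp, presburger)

lemma oddpart_column_2: "a \<ge> 1213 \<Longrightarrow> oddpart (3 * a + 2) = 0"
  by (rule oddpart_mod3_2) (simp, presburger)

text \<open>Letters below 2 stand close by in the constant columns. At multiples of 6 a letter 2
  below 3 stands 12 places earlier. At \<open>6 * a + 3\<close> the evidence comes from
  \<open>core\<close>: distance 2 becomes a power with \<open>m = 3\<close>, and a power of length
  parameter \<open>b\<close> becomes one with \<open>6 * b\<close>. The bound 3640 is
  \<open>6 * 606 + 4\<close>, where the stretched copy of a power from 607 on begins.\<close>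

lemma excluded_core_late:
  assumes "n \<ge> 3681" "c < oddpart n"
    and IH: "\<And>d. d < core (n div 6) \<Longrightarrow> n mod 6 = 3 \<Longrightarrow> excluded core 607 (n div 6) d"
  shows "excluded oddpart 3640 n c"
proof -
  have low: "excluded oddpart 3640 n c" if "n mod 3 = 0" "c < 2"
  proof -
    define p where "p = n div 3 - 2"
    have p: "n = 3 * p + 6" "p \<ge> 1213" using that(1) assms(1) div_mult_mod_eq[of n 3] unfolding p_def by linarith+
    show ?thesis
    proof (cases "c = 1")
      case True
      have "n - 2 = 3 * (p + 1) + 1" using p(1) by simp
      hence "oddpart (n - 2) = c" using oddpart_column_1[of "p + 1"] p(2) True by simp
      thus ?thesis using assms(1) unfolding excluded_def by simp
    next
      case False
      have "n - 4 * 1 = 3 * p + 2" using p(1) by simp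
      hence "oddpart (n - 4 * 1) = c" using oddpart_column_2[of p] p(2) False that(2) by simp
      thus ?thesis using assms(1) unfolding excluded_def blocked_def by (intro disjI2 exI[of _ 1]) simp
    qed
  qed
  \<comment> \<open>The two letters before \<open>n\<close> lie in constant columns, so only the
    letter at \<open>n - 12\<close> remains to be matched for a power with
    \<open>m = 3\<close>.\<close>
  have near: "oddpart (n - k) = oddpart (n - k - 4 * 3)" if "n mod 3 = 0" "1 \<le> k" "k < 3" for k
  proof -
    define p where "p = n div 3 - 5"
    have p: "n = 3 * p + 15" "p \<ge> 1213" using that(1) assms(1) div_mult_mod_eq[of n 3] unfolding p_def by linarith+
    have "k = 1 \<or> k = 2" using that(2,3) by linarith
    thus ?thesis
    proof
      assume "k = 1"
      hence "n - k = 3 * (p + 4) + 2" "n - k - 4 * 3 = 3 * p + 2" using p(1) by simp_all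
      thus ?thesis using oddpart_column_2[of "p + 4"] oddpart_column_2[of p] p(2) by simp
    next
      assume "k = 2"
      hence "n - k = 3 * (p + 4) + 1" "n - k - 4 * 3 = 3 * p + 1" using p(1) by simp_all
      thus ?thesis using oddpart_column_1[of "p + 4"] oddpart_column_1[of p] p(2) by simp
    qed
  qed
  show ?thesis
  proof (cases n rule: oddpart_mod6_cases)
    case 1
    define p where "p = n div 3 - 1"
    have "n - 2 = 3 * p + 2" "p \<ge> 1213" using 1 assms(1) div_mult_mod_eq[of n 3] unfolding p_def by linarith+
    moreover have "c = 0" using assms 1 oddpart_mod3_1 by simp
    ultimately show ?thesis using oddpart_column_2[of p] assms(1) unfolding excluded_def by simp
  next
    case 2
    thus ?thesis using assms oddpart_mod3_2[of n] by simp
  next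
    case 3
    define q where "q = n div 6"
    have q: "n = 6 * q" using 3(2) unfolding q_def .
    hence "q \<ge> 614" using assms(1) by linarith
    define a where "a = q - 2"
    have a: "n = 6 * (a + 2)" "a \<ge> 607" using q \<open>q \<ge> 614\<close> unfolding a_def by simp_all
    show ?thesis
    proof (cases "c < 2")
      case True thus ?thesis using low 3 by simp
    next
      case False
      have "oddpart n \<in> {2, 3}" "oddpart (6 * a) \<in> {2, 3}"
        using a(2) oddpart_column_0[of "a + 2"] oddpart_column_0[of a] unfolding a(1) by auto
      moreover have "oddpart (6 * a) \<noteq> oddpart n"
        using oddpart_column_0_flip[of a 1] a(2) unfolding a(1) by (simp add: add.commute)
      moreover have "n - 4 * 3 = 6 * a" using a(1) by simp
      ultimately have "oddpart (n - 4 * 3) = c" using False assms(2) by auto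
      thus ?thesis using assms(1) near 3(1) unfolding excluded_def blocked_def
        by (intro disjI2 exI[of _ 3]) simp
    qed
  next
    case 4
    define a where "a = n div 6"
    have a: "n = 6 * a + 3" using 4(2) unfolding a_def .
    moreover from this have "a \<ge> 613" using assms(1) by linarith
    ultimately have a: "n = 6 * a + 3" "a \<ge> 613" .
    show ?thesis
    proof (cases "c < 2")
      case True thus ?thesis using low 4 by simp
    next
      case False
      have cn: "oddpart n = core a + 2" using a oddpart_mod6_3 by simp
      define d where "d = c - 2"
      have d: "c = d + 2" "d < core a" using False assms(2) cn unfolding d_def by linarith+
      have "n mod 6 = 3" using a(1) by presburger
      hence "excluded core 607 a d" using IH[of d] d(2) unfolding a_def by simp
      hence "\<exists>m \<ge> 1. 3640 + 5 * m \<le> n + 1 \<and> oddpart (n - 4 * m) = c \<and>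
          (\<forall>k. 1 \<le> k \<and> k < m \<longrightarrow> oddpart (n - k) = oddpart (n - k - 4 * m))"
        unfolding excluded_def
      proof
        assume h: "607 + 2 \<le> a \<and> core (a - 2) = d"
        have "n - 4 * 3 = 6 * (a - 2) + 3" using a by simp
        hence "oddpart (n - 4 * 3) = c" using oddpart_mod6_3[of "a - 2"] h a(2) d(1) by simp
        thus ?thesis using assms(1) near 4(1) by (intro exI[of _ 3]) simp
      next
        assume "blocked core 607 a d"
        then obtain b where b: "b \<ge> 1" "607 + 5 * b \<le> a + 1" "core (a - 4 * b) = d"
          "\<And>k. 1 \<le> k \<Longrightarrow> k < b \<Longrightarrow> core (a - k) = core (a - k - 4 * b)"
          unfolding blocked_def by blast
        have "n - 4 * (6 * b) = 6 * (a - 4 * b) + 3" using a b(2) by simp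
        hence "oddpart (n - 4 * (6 * b)) = c" using oddpart_mod6_3[of "a - 4 * b"] b(1,2,3) d(1) by simp
        moreover have "oddpart (n - k) = oddpart (n - k - 4 * (6 * b))" if k: "1 \<le> k" "k < 6 * b" for k
        proof -
          define t where "t = n - k - 4 * (6 * b)"
          have t: "n - k = t + 24 * b" "t \<ge> 3640" unfolding t_def using a b(2) k by linarith+
          have tm: "(t + 24 * b) mod 3 = t mod 3" "(t + 24 * b) div 6 = t div 6 + 4 * b" by presburger+
          have "oddpart (t + 24 * b) = oddpart t"
          proof (cases t rule: oddpart_mod6_cases)
            case 1 thus ?thesis using oddpart_mod3_1[of t] oddpart_mod3_1[of "t + 24 * b"] t tm by simp
          next
            case 2 thus ?thesis using oddpart_mod3_2[of t] oddpart_mod3_2[of "t + 24 * b"] t tm by simp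
          next
            case 3
            define x where "x = t div 6"
            have x: "t = 6 * x" "x \<ge> 607" using 3 t(2) unfolding x_def by linarith+
            have "t + 24 * b = 6 * (x + 4 * b)" using x by simp
            moreover have "(x + 4 * b) mod 4 = x mod 4" by simp
            ultimately show ?thesis
              using oddpart_mod6_0[of x] oddpart_mod6_0[of "x + 4 * b"] x by simp
          next
            case 4
            define x where "x = t div 6"
            have x: "t = 6 * x + 3" "x \<ge> 606" using 4 t(2) unfolding x_def by linarith+
            have nk: "n - k = 6 * (x + 4 * b) + 3" using x t by simp
            hence "6 * (x + 4 * b) + k = 6 * a" using a(1) by arith
            hence "x + 4 * b < a" "a < x + 5 * b" using k by simp_all
            \<comment> \<open>Between this entry of \<open>core\<close> and the excluded one lie
              fewer than \<open>b\<close> steps, so the equality is part of the blocking power in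
              \<open>core\<close>.\<close>
            moreover define l where "l = a - (x + 4 * b)"
            ultimately have l: "x + 4 * b = a - l" "1 \<le> l" "l < b" by simp_all
            hence "x = a - l - 4 * b" by simp
            hence "core (x + 4 * b) = core x" using b(4)[OF l(2,3)] l(1) by simp
            moreover have "t + 24 * b = 6 * (x + 4 * b) + 3" using x(1) by simp
            ultimately show ?thesis
              using oddpart_mod6_3[of x] oddpart_mod6_3[of "x + 4 * b"] x by (simp only: trans_le_add1)
          qed
          thus ?thesis unfolding t_def[symmetric] unfolding t(1) .
        qed
        moreover have "3640 + 5 * (6 * b) \<le> n + 1" using a b(2) by linarith
        ultimately show ?thesis using b(1) by (intro exI[of _ "6 * b"]) simp
      qed
      thus ?thesis unfolding excluded_def blocked_def by blast
    qed
  qed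
qed

text \<open>The evidence lies from 3640 on, hence after the shift from 10935 on, where
  \<open>core\<close> copies \<open>oddpart\<close>.\<close>

lemma excluded_shift:
  assumes "n \<ge> 10976" "excluded oddpart 3640 (n - 7295) c"
  shows "excluded core 607 n c"
proof -
  have s: "core k = oddpart (k - 7295)" if "k \<ge> 10935" for k using that core_shift by simp
  from assms(2) show ?thesis
    unfolding excluded_def
  proof
    assume h: "3640 + 2 \<le> n - 7295 \<and> oddpart (n - 7295 - 2) = c"
    have "n - 7295 - 2 = n - 2 - 7295" by simp
    moreover have "10935 \<le> n - 2" using assms(1) by simp
    ultimately have "core (n - 2) = c" using s[of "n - 2"] h by metis
    thus "607 + 2 \<le> n \<and> core (n - 2) = c \<or> blocked core 607 n c" using assms(1) by simp
  next
    assume "blocked oddpart 3640 (n - 7295) c"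
    then obtain m where m: "m \<ge> 1" "3640 + 5 * m \<le> n - 7295 + 1" "oddpart (n - 7295 - 4 * m) = c"
      "\<And>k. 1 \<le> k \<Longrightarrow> k < m \<Longrightarrow> oddpart (n - 7295 - k) = oddpart (n - 7295 - k - 4 * m)"
      unfolding blocked_def by blast
    have e: "n - 7295 - k = n - k - 7295" for k by simp
    have "core (n - 4 * m) = c" using m(1,2,3) s[of "n - 4 * m"] e[of "4 * m"] assms(1) by simp
    moreover have "core (n - k) = core (n - k - 4 * m)" if "1 \<le> k" "k < m" for k
    proof -
      have "n - 7295 - k - 4 * m = n - k - 4 * m - 7295" by simp
      thus ?thesis
        using m(4)[OF that] s[of "n - k"] s[of "n - k - 4 * m"] e[of k] m(2) that assms(1) by simp
    qed
    ultimately have "blocked core 607 n c" unfolding blocked_def using m(1,2) assms(1)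
      by (intro exI[of _ m]) simp
    thus "607 + 2 \<le> n \<and> core (n - 2) = c \<or> blocked core 607 n c" by blast
  qed
qed

text \<open>Beyond the checked range \<open>core\<close> at \<open>n\<close> copies
  \<open>oddpart\<close> at \<open>n - 7295\<close>, which refers back to \<open>core\<close> at
  \<open>(n - 7295) div 6\<close>.\<close>

lemma excluded_core: "n \<ge> 613 \<Longrightarrow> c < core n \<Longrightarrow> excluded core 607 n c"
proof (induction n arbitrary: c rule: less_induct)
  case (less n)
  show ?case
  proof (cases "n < 10976")
    case True
    thus ?thesis using check_letters_sound[OF core_letters_1, of n c]
        check_letters_sound[OF core_letters_2, of n c] less.prems by (cases "n < 5600") simp_all
  next
    case False
    have "excluded oddpart 3640 (n - 7295) c"
    proof (rule excluded_core_late)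
      show "c < oddpart (n - 7295)" using less.prems core_shift False by simp
    next
      fix d assume "d < core ((n - 7295) div 6)"
      moreover have "613 \<le> (n - 7295) div 6" "(n - 7295) div 6 < n" using False by linarith+
      ultimately show "excluded core 607 ((n - 7295) div 6) d" using less.IH by blast
    qed (use False in simp)
    thus ?thesis using excluded_shift False by simp
  qed
qed

lemma excluded_mono:
  assumes "excluded f a n c" "b \<le> a" shows "excluded f b n c"
proof -
  have "b + x \<le> y" if "a + x \<le> y" for x y using that assms(2) by simp
  thus ?thesis using assms(1) unfolding excluded_def blocked_def by blast
qed

lemma excluded_oddpart: "c < oddpart n \<Longrightarrow> excluded oddpart 0 n c"
proof (cases "n < 3681")
  case True
  assume "c < oddpart n"
  thus ?thesis using check_letters_sound[OF oddpart_letters, of n c] True by simp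
next
  case False
  assume c: "c < oddpart n"
  have "613 \<le> n div 6" using False by linarith
  hence "excluded oddpart 3640 n c" using excluded_core_late[of n c] excluded_core False c by simp
  thus ?thesis by (rule excluded_mono) simp
qed

theorem w54_interleave: "w54 = interleave oddpart"
  using w54_eqI lex_least_power_freeI interleave_power_free interleave_blocked admissible_oddpart
    excluded_oddpart by metis

section \<open>Upper bound for the rank\<close>

text \<open>At depth 3 the offsets are 0 to 17. The map from \<open>d\<close> to
  \<open>(18 * j + d - 7298) / 6\<close> with \<open>j < 6\<close> sends this interval to the third
  one, the third to the second, the second into the first, and the first into itself; its fixed
  point for \<open>j = 0\<close> is -1459.6. Offsets congruent to 1 modulo 3 are left out because
  \<open>core\<close> vanishes along them.\<close>

definition core_offsets :: "int list" where
  "core_offsets = filter (\<lambda>d. d mod 3 \<noteq> 1) ([-1459..-1435] @ [-1419..-1402] @ [-1216..-1199] @ [0..17])"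

lemma in_core_offsets:
  "d \<in> set core_offsets \<longleftrightarrow> d mod 3 \<noteq> 1 \<and>
    (-1459 \<le> d \<and> d \<le> -1435 \<or> -1419 \<le> d \<and> d \<le> -1402 \<or> -1216 \<le> d \<and> d \<le> -1199 \<or> 0 \<le> d \<and> d \<le> 17)"
  unfolding core_offsets_def set_filter set_append set_upto mem_Collect_eq Un_iff atLeastAtMost_iff
  by blast

lemma length_core_offsets: "length core_offsets = 53"
  by code_simp

text \<open>
  From \<open>i = 115\<close> on all indices \<open>18 i + d\<close> below lie in the range \<open>j \<ge> 606\<close> where the core
  satisfies its recurrence.
\<close>

definition core_along :: "int \<Rightarrow> nat \<Rightarrow> rat" where
  "core_along d = (\<lambda>i. of_nat (core (nat (18 * int i + d))))"

text \<open>The shape of all sections from depth 3 on. Period 4 comes from the multiples of 6 in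
  \<open>oddpart\<close>; the even positions of the word give periodic sections too.\<close>

definition tame :: "(nat \<Rightarrow> rat) \<Rightarrow> bool" where
  "tame f \<longleftrightarrow> (\<exists>p. \<forall>i\<ge>115. f i = p (i mod 4)) \<or>
     (\<exists>d \<in> set core_offsets. \<exists>c. \<forall>i\<ge>115. f i = core_along d i + c)"

lemma core_offsets_ge: "d \<in> set core_offsets \<Longrightarrow> d \<ge> -1459"
  unfolding in_core_offsets by auto

text \<open>A step of 108 stays in one column modulo 6: this gives a constant, a sequence of period
  4, or \<open>core\<close> along step 18. The bound -8754 is \<open>6 * (-1459)\<close>, from the
  least offset.\<close>

lemma tame_oddpart_along:
  assumes f: "\<And>i. i \<ge> 115 \<Longrightarrow> f i = of_nat (oddpart (nat (108 * int i + m))) + c"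
    and m: "m \<ge> -8754" and t: "m mod 6 = 3 \<Longrightarrow> m div 6 mod 3 = 1 \<or> m div 6 \<in> set core_offsets"
  shows "tame f"
proof -
  define t where "t = m div 6"
  define r where "r = nat (m mod 6)"
  have m_eq: "m = 6 * t + int r" unfolding t_def r_def by simp
  have r6: "r < 6" unfolding r_def by simp
  have t_ge: "t \<ge> -1459" using m unfolding t_def by simp
  define a where "a i = nat (18 * int i + t)" for i
  have a: "int (a i) = 18 * int i + t" "a i \<ge> 611" if "i \<ge> 115" for i
    using that t_ge unfolding a_def by simp_all
  have n: "nat (108 * int i + m) = 6 * a i + r" if "i \<ge> 115" for i
  proof -
    have "108 * int i + m = int (6 * a i + r)" using a(1)[OF that] m_eq by simp
    thus ?thesis by (metis nat_int)
  qed
  have f': "f i = of_nat (oddpart (6 * a i + r)) + c" if "i \<ge> 115" for i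
    using f[OF that] n[OF that] by simp
  have const: "tame f" if "\<And>i. i \<ge> 115 \<Longrightarrow> f i = x" for x
    unfolding tame_def using that by (intro disjI1 exI[of _ "\<lambda>_. x"]) simp
  have "r = 0 \<or> r = 3 \<or> r mod 3 = 1 \<or> r mod 3 = 2" using r6 by presburger
  thus ?thesis
  proof (elim disjE)
    assume r: "r = 0"
    define p where "p x = (if (18 * int x + t) mod 4 \<in> {0, 3} then 3 else 2) + c" for x
    have "f i = p (i mod 4)" if "i \<ge> 115" for i
    proof -
      have "int (a i mod 4) = (18 * int (i mod 4) + t) mod 4"
        using a(1)[OF that] by (simp add: zmod_int) (metis mod_add_left_eq mod_mult_right_eq)
      hence "a i mod 4 \<in> {0, 3} \<longleftrightarrow> (18 * int (i mod 4) + t) mod 4 \<in> {0, 3}" by auto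
      thus ?thesis using f'[OF that] oddpart_mod6_0[of "a i"] a(2)[OF that] r unfolding p_def by simp
    qed
    thus ?thesis unfolding tame_def by blast
  next
    assume r: "r = 3"
    hence odd: "f i = of_nat (core (a i)) + (2 + c)" if "i \<ge> 115" for i
      using f'[OF that] oddpart_mod6_3[of "a i"] a(2)[OF that] by simp
    have "m mod 6 = 3" using r unfolding r_def by linarith
    from t[OF this] show ?thesis
    proof
      assume "m div 6 mod 3 = 1"
      hence "f i = 2 + c" if "i \<ge> 115" for i
      proof -
        have "int (a i) mod 3 = 1"
          using a(1)[OF that] \<open>m div 6 mod 3 = 1\<close> unfolding t_def by presburger
        hence "a i mod 3 = 1" by presburger
        thus ?thesis using odd[OF that] core_eq_0[of "a i"] a(2)[OF that] by simp
      qed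
      thus ?thesis by (rule const)
    next
      assume "m div 6 \<in> set core_offsets"
      moreover have "f i = core_along t i + (2 + c)" if "i \<ge> 115" for i
        using odd[OF that] unfolding core_along_def a_def .
      ultimately show ?thesis unfolding tame_def t_def by blast
    qed
  next
    assume "r mod 3 = 1"
    hence "(6 * a i + r) mod 3 = 1" for i by presburger
    hence "f i = 1 + c" if "i \<ge> 115" for i
      using f'[OF that] oddpart_mod3_1[of "6 * a i + r"] a(2)[OF that] by simp
    thus ?thesis by (rule const)
  next
    assume "r mod 3 = 2"
    hence "(6 * a i + r) mod 3 = 2" for i by presburger
    hence "f i = c" if "i \<ge> 115" for i
      using f'[OF that] oddpart_mod3_2[of "6 * a i + r"] a(2)[OF that] by simp
    thus ?thesis by (rule const)
  qed
qed

lemma core_offsets_closed: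
  assumes d: "d \<in> set core_offsets" and j: "0 \<le> j" "j < 6" and m: "(18 * j + d - 7295) mod 6 = 3"
  shows "(18 * j + d - 7295) div 6 mod 3 = 1 \<or> (18 * j + d - 7295) div 6 \<in> set core_offsets"
proof -
  define t where "t = (18 * j + d - 7295) div 6"
  have t: "18 * j + d - 7295 = 6 * t + 3" using m mult_div_mod_eq[of 6 "18 * j + d - 7295"] unfolding t_def by simp
  have "-1459 \<le> t \<and> t \<le> -1435 \<or> -1419 \<le> t \<and> t \<le> -1402 \<or> -1216 \<le> t \<and> t \<le> -1199"
    using d j t unfolding in_core_offsets by linarith
  thus ?thesis unfolding t_def[symmetric] in_core_offsets by blast
qed

text \<open>For \<open>i\<close> from 115 on, the index \<open>18 * (6 * i + j) + d\<close> is at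
  least 10255, so the recurrence turns \<open>core\<close> into \<open>oddpart\<close> along step
  108.\<close>

lemma tame_section:
  assumes "tame f" "j < 6" shows "tame (\<lambda>i. f (6 * i + j))"
  using assms(1) unfolding tame_def[of f]
proof
  assume "\<exists>p. \<forall>i\<ge>115. f i = p (i mod 4)"
  then obtain p where p: "f i = p (i mod 4)" if "i \<ge> 115" for i by blast
  have "f (6 * i + j) = p ((6 * (i mod 4) + j) mod 4)" if "i \<ge> 115" for i
    using p[of "6 * i + j"] that by (metis mod_add_left_eq mod_mult_right_eq trans_le_add1 le_trans
      mult_le_mono2 nat_mult_1 one_le_numeral mult_le_mono1)
  thus ?thesis unfolding tame_def by (intro disjI1 exI[of _ "\<lambda>x. p ((6 * x + j) mod 4)"]) simp
next
  assume "\<exists>d \<in> set core_offsets. \<exists>c. \<forall>i\<ge>115. f i = core_along d i + c"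
  then obtain d c where d: "d \<in> set core_offsets" and f: "\<And>i. i \<ge> 115 \<Longrightarrow> f i = core_along d i + c"
    by blast
  have ge: "d \<ge> -1459" using core_offsets_ge d .
  show ?thesis
  proof (rule tame_oddpart_along[of _ "18 * int j + d - 7295" c])
    fix i :: nat assume i: "i \<ge> 115"
    define k where "k = nat (108 * int i + 18 * int j + d)"
    have k: "int k = 108 * int i + 18 * int j + d" "k \<ge> 10255" using i ge unfolding k_def by simp_all
    have "f (6 * i + j) = of_nat (core k) + c"
      using f[of "6 * i + j"] i unfolding core_along_def k_def by (simp add: algebra_simps)
    moreover have "k - 7295 = nat (108 * int i + (18 * int j + d - 7295))" using k by linarith
    ultimately show "f (6 * i + j) = of_nat (oddpart (nat (108 * int i + (18 * int j + d - 7295)))) + c"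
      using core_shift[OF k(2)] by simp
  next
    show "-8754 \<le> 18 * int j + d - 7295" using ge by simp
  next
    show "(18 * int j + d - 7295) mod 6 = 3 \<Longrightarrow>
      (18 * int j + d - 7295) div 6 mod 3 = 1 \<or> (18 * int j + d - 7295) div 6 \<in> set core_offsets"
      by (rule core_offsets_closed[OF d]) (use assms(2) in simp_all)
  qed
qed

section \<open>Sections of the word and a spanning set\<close>

definition letters :: "nat \<Rightarrow> rat" where
  "letters i = of_nat (interleave oddpart i)"

lemma letters_even:
  "letters (2 * h) = (if h mod 4 < 2 then 0 else 1)"
proof -
  have "2 * h mod 8 < 4 \<longleftrightarrow> h mod 4 < 2" by presburger
  thus ?thesis unfolding letters_def interleave_def by simp
qed

lemma letters_odd: "letters (2 * h + 1) = of_nat (oddpart h)"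
  unfolding letters_def using interleave_odd by simp

lemma tame_level_3:
  assumes "j < 216" shows "tame (\<lambda>i. letters (216 * i + j))"
proof (cases "even j")
  case True
  then obtain h where h: "j = 2 * h" by (elim evenE)
  have "letters (216 * i + j) = (if h mod 4 < 2 then 0 else 1)" for i
  proof -
    have e: "216 * i + j = 2 * (h + 4 * (27 * i))" using h by simp
    show ?thesis unfolding e letters_even by (simp only: mod_mult_self2)
  qed
  thus ?thesis unfolding tame_def by (intro disjI1 exI[of _ "\<lambda>_. if h mod 4 < 2 then 0 else 1"]) simp
next
  case False
  then obtain h where h: "j = 2 * h + 1" by (elim oddE)
  show ?thesis
  proof (rule tame_oddpart_along[of _ "int h" 0])
    fix i :: nat
    have "216 * i + j = 2 * (108 * i + h) + 1" using h by simp
    moreover have "nat (108 * int i + int h) = 108 * i + h" by (simp add: nat_add_distrib nat_mult_distrib)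
    ultimately show "letters (216 * i + j) = of_nat (oddpart (nat (108 * int i + int h))) + 0"
      using letters_odd[of "108 * i + h"] by simp
  next
    have "0 \<le> int h div 6" "int h div 6 \<le> 17" using h assms by simp_all
    thus "int h div 6 mod 3 = 1 \<or> int h div 6 \<in> set core_offsets" unfolding in_core_offsets by blast
  qed simp
qed

lemma tame_level:
  assumes "e \<ge> 3" "j < 6 ^ e" shows "tame (\<lambda>i. letters (6 ^ e * i + j))"
  using assms
proof (induction e arbitrary: j rule: dec_induct)
  case base
  thus ?case using tame_level_3 by simp
next
  case (step e)
  define a b where "a = j div 6 ^ e" and "b = j mod 6 ^ e"
  have "a < 6" "b < 6 ^ e" unfolding a_def b_def using step.prems by (simp_all add: less_mult_imp_div_less)
  moreover have "6 ^ Suc e * i + j = 6 ^ e * (6 * i + a) + b" for i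
    unfolding a_def b_def by (simp add: algebra_simps)
  ultimately show ?case using tame_section[OF step.IH[of b], of a] by simp
qed

definition residue :: "nat \<Rightarrow> nat \<Rightarrow> rat" where
  "residue r = (\<lambda>i. if i mod 4 = r then 1 else 0)"

text \<open>The sections of depth at most 2 not shown to be tame, 1 + 3 + 12 in number, and 4 + 53
  sequences that span the tame ones from 115 on.\<close>

definition upper_basis :: "(nat \<Rightarrow> rat) list" where
  "upper_basis = [letters, \<lambda>i. letters (6 * i + 1), \<lambda>i. letters (6 * i + 3), \<lambda>i. letters (6 * i + 5)] @
     map residue [0, 1, 2, 3] @
     map (\<lambda>j i. letters (36 * i + j)) [1, 3, 7, 9, 13, 15, 19, 21, 25, 27, 31, 33] @
     map core_along core_offsets"

definition nearly_spanned :: "(nat \<Rightarrow> rat) set" where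
  "nearly_spanned = {f. \<exists>g \<in> ratseq.span (set upper_basis). \<forall>i\<ge>115. f i = g i}"

definition unit_seq :: "nat \<Rightarrow> nat \<Rightarrow> rat" where
  "unit_seq k = (\<lambda>i. if i = k then 1 else 0)"

lemma upper_basis_nearly_spanned: "f \<in> set upper_basis \<Longrightarrow> f \<in> nearly_spanned"
  unfolding nearly_spanned_def using ratseq.span_base by blast

lemma tame_nearly_spanned:
  assumes "tame f" shows "f \<in> nearly_spanned"
proof -
  define per where "per p = seq_scale (p 0) (residue 0) + seq_scale (p 1) (residue 1) +
    seq_scale (p 2) (residue 2) + seq_scale (p 3) (residue 3)" for p :: "nat \<Rightarrow> rat"
  have per_eq: "per p i = p (i mod 4)" for p i
  proof -
    have "i mod 4 = 0 \<or> i mod 4 = 1 \<or> i mod 4 = 2 \<or> i mod 4 = 3" by presburger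
    thus ?thesis unfolding per_def seq_scale_def residue_def by (elim disjE) simp_all
  qed
  have "set (map residue [0, 1, 2, 3]) \<subseteq> set upper_basis" unfolding upper_basis_def by auto
  hence "residue r \<in> ratseq.span (set upper_basis)" if "r \<in> {0, 1, 2, 3}" for r
    using that ratseq.span_base by auto
  hence per: "per p \<in> ratseq.span (set upper_basis)" for p
    unfolding per_def by (intro ratseq.span_add ratseq.span_scale) simp_all
  from assms show ?thesis
    unfolding tame_def
  proof
    assume "\<exists>p. \<forall>i\<ge>115. f i = p (i mod 4)"
    then obtain p where "\<forall>i\<ge>115. f i = p (i mod 4)" by blast
    thus ?thesis unfolding nearly_spanned_def by (intro CollectI bexI[OF _ per[of p]]) (simp add: per_eq)
  next
    assume "\<exists>d \<in> set core_offsets. \<exists>c. \<forall>i\<ge>115. f i = core_along d i + c"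
    then obtain d c where d: "d \<in> set core_offsets" and f: "\<forall>i\<ge>115. f i = core_along d i + c" by blast
    have "core_along d \<in> set upper_basis" using d unfolding upper_basis_def by simp
    hence "core_along d + per (\<lambda>_. c) \<in> ratseq.span (set upper_basis)"
      by (intro ratseq.span_add per ratseq.span_base)
    moreover have "(core_along d + per (\<lambda>_. c)) i = core_along d i + c" for i by (simp add: per_eq)
    ultimately show ?thesis unfolding nearly_spanned_def using f
      by (intro CollectI bexI[of _ "core_along d + per (\<lambda>_. c)"]) simp_all
  qed
qed

lemma tame_even_section: "tame (\<lambda>i. letters (2 * (b * i + h)))"
proof -
  have "(b * i + h) mod 4 = (b * (i mod 4) + h) mod 4" for i by (metis mod_add_left_eq mod_mult_right_eq)
  hence "letters (2 * (b * i + h)) = (if (b * (i mod 4) + h) mod 4 < 2 then 0 else 1)" for i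
    unfolding letters_even by simp
  thus ?thesis unfolding tame_def
    by (intro disjI1 exI[of _ "\<lambda>x. if (b * x + h) mod 4 < 2 then 0 else 1"]) simp
qed

text \<open>Such a section reads \<open>oddpart\<close> on the class 2 modulo 3, far beyond 950,
  where it is 0. At depth 1 the index is only 347 for \<open>i = 115\<close>, so that section is put
  into \<open>upper_basis\<close>.\<close>

lemma tame_level_2:
  assumes "j < 36" "j mod 6 = 5" shows "tame (\<lambda>i. letters (36 * i + j))"
proof -
  define k where "k = j div 6"
  have "j = 6 * k + 5" using assms(2) div_mult_mod_eq[of j 6] unfolding k_def by linarith
  hence j: "j = 2 * (3 * k + 2) + 1" by simp
  have "letters (36 * i + j) = 0" if i: "i \<ge> 115" for i
  proof -
    define n where "n = 18 * i + (3 * k + 2)"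
    have n: "36 * i + j = 2 * n + 1" "n mod 3 = 2" "n \<ge> 950" using j i unfolding n_def by (simp, presburger, simp)
    hence "oddpart n = 0"
      using oddpart_mod3_2[of n] check_column_sound[OF column_checks(6), of n] by (cases "n < 3637") auto
    thus ?thesis unfolding n(1) letters_odd by simp
  qed
  thus ?thesis unfolding tame_def by (intro disjI1 exI[of _ "\<lambda>_. 0"]) simp
qed

lemma kernel_nearly_spanned:
  assumes "f \<in> kernel 6 letters" shows "f \<in> nearly_spanned"
proof -
  from assms obtain e j where f: "f = (\<lambda>i. letters (6 ^ e * i + j))" and j: "j < 6 ^ e"
    unfolding kernel_def by blast
  have "e = 0 \<or> e = 1 \<or> e = 2 \<or> e \<ge> 3" by linarith
  thus ?thesis
  proof (elim disjE)
    assume "e = 0"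
    hence "f = letters" using f j by simp
    thus ?thesis by (intro upper_basis_nearly_spanned) (simp add: upper_basis_def)
  next
    assume e: "e = 1"
    show ?thesis
    proof (cases "even j")
      case True
      then obtain h where "j = 2 * h" by (elim evenE)
      hence "f = (\<lambda>i. letters (2 * (3 * i + h)))" using f e by (simp add: algebra_simps)
      thus ?thesis using tame_nearly_spanned[OF tame_even_section[of 3 h]] by simp
    next
      case False
      hence "j = 1 \<or> j = 3 \<or> j = 5" using j e by (simp, presburger)
      thus ?thesis using f e
        by (elim disjE) (simp_all add: upper_basis_nearly_spanned upper_basis_def)
    qed
  next
    assume e: "e = 2"
    have f2: "f = (\<lambda>i. letters (36 * i + j))" "j < 36" using f j e by simp_all
    show ?thesis
    proof (cases "even j")
      case True
      then obtain h where "j = 2 * h" by (elim evenE)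
      hence "f = (\<lambda>i. letters (2 * (18 * i + h)))" using f2 by (simp add: algebra_simps)
      thus ?thesis using tame_nearly_spanned[OF tame_even_section[of 18 h]] by simp
    next
      case False
      hence "j mod 6 = 5 \<or> j \<in> set [1, 3, 7, 9, 13, 15, 19, 21, 25, 27, 31, 33]"
        using f2(2) by (simp, presburger)
      thus ?thesis
      proof
        assume "j mod 6 = 5"
        thus ?thesis using tame_nearly_spanned[OF tame_level_2] f2 by simp
      next
        assume "j \<in> set [1, 3, 7, 9, 13, 15, 19, 21, 25, 27, 31, 33]"
        hence "f \<in> set (map (\<lambda>j i. letters (36 * i + j)) [1, 3, 7, 9, 13, 15, 19, 21, 25, 27, 31, 33])"
          unfolding f2(1) by (simp only: set_map) (rule imageI)
        thus ?thesis by (intro upper_basis_nearly_spanned) (unfold upper_basis_def set_append, blast)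
      qed
    qed
  next
    assume "e \<ge> 3"
    thus ?thesis using tame_nearly_spanned[OF tame_level] f j by simp
  qed
qed

lemma sum_fun_apply: "(\<Sum>k\<in>A. F k) i = (\<Sum>k\<in>A. F k i)" for F :: "'a \<Rightarrow> 'b \<Rightarrow> 'c::comm_monoid_add"
  by (induction A rule: infinite_finite_induct) simp_all

text \<open>The unit sequences absorb the deviation on the first 115 places.\<close>

lemma nearly_spanned_span:
  assumes "f \<in> nearly_spanned"
  shows "f \<in> ratseq.span (set upper_basis \<union> unit_seq ` {..<115})"
proof -
  obtain g where g: "g \<in> ratseq.span (set upper_basis)" "\<And>i. i \<ge> 115 \<Longrightarrow> f i = g i"
    using assms unfolding nearly_spanned_def by blast
  have "f i = (g + (\<Sum>k<115. seq_scale (f k - g k) (unit_seq k))) i" for i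
  proof -
    have "(\<Sum>k<115. seq_scale (f k - g k) (unit_seq k)) i = (\<Sum>k<115. if k = i then f k - g k else 0)"
      unfolding sum_fun_apply by (intro sum.cong) (auto simp: seq_scale_def unit_seq_def)
    also have "\<dots> = (if i < 115 then f i - g i else 0)" by (simp add: sum.delta)
    finally show ?thesis using g(2)[of i] by simp
  qed
  hence "f = g + (\<Sum>k<115. seq_scale (f k - g k) (unit_seq k))" by (rule ext)
  moreover have "g \<in> ratseq.span (set upper_basis \<union> unit_seq ` {..<115})"
    using g(1) ratseq.span_mono[of "set upper_basis"] by blast
  moreover have "(\<Sum>k<115. seq_scale (f k - g k) (unit_seq k)) \<in>
      ratseq.span (set upper_basis \<union> unit_seq ` {..<115})"
    by (intro ratseq.span_sum ratseq.span_scale ratseq.span_base) simp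
  ultimately show ?thesis using ratseq.span_add by metis
qed

lemma card_upper: "card (set upper_basis \<union> unit_seq ` {..<115}) \<le> 188"
proof -
  have "card (set upper_basis) \<le> 73"
    using card_length[of upper_basis] length_core_offsets by (simp add: upper_basis_def)
  moreover have "card (unit_seq ` {..<115}) \<le> 115" using card_image_le[of "{..<115}" unit_seq] by simp
  ultimately show ?thesis using card_Un_le[of "set upper_basis" "unit_seq ` {..<115}"] by linarith
qed

section \<open>Lower bound for the rank\<close>

fun dot :: "int list \<Rightarrow> nat list list \<Rightarrow> nat \<Rightarrow> int" where
  "dot (c # cs) (r # rs) k = c * int (r ! k) + dot cs rs k"
| "dot _ _ _ = 0"

definition axpy3 :: "nat \<Rightarrow> nat \<Rightarrow> nat \<Rightarrow> nat" where
  "axpy3 t x y = (y + t * x) mod 3"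

fun add_row :: "nat \<Rightarrow> nat list \<Rightarrow> nat list \<Rightarrow> nat list" where
  "add_row t (x # xs) (y # ys) = axpy3 t x y # add_row t xs ys"
| "add_row t _ _ = []"

text \<open>Modulo 3 an invertible pivot \<open>x\<close> is its own inverse, so
  \<open>- y / x\<close> is \<open>2 * x * y\<close>. The cleared first column is dropped.\<close>

fun eliminate :: "nat \<Rightarrow> nat list \<Rightarrow> nat list list \<Rightarrow> nat list list" where
  "eliminate x r [] = []"
| "eliminate x r ((y # ys) # rs) = add_row (2 * x * y mod 3) r ys # eliminate x r rs"
| "eliminate x r ([] # rs) = [] # eliminate x r rs"

text \<open>Gaussian elimination modulo 3 without pivot search: all leading minors must be nonzero.\<close>

function full_rank :: "nat list list \<Rightarrow> bool" where
  "full_rank [] = True"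
| "full_rank ([] # rs) = False"
| "full_rank ((x # r) # rs) = (if x mod 3 = 0 then False else full_rank (eliminate x r rs))"
  by pat_completeness auto

lemma length_eliminate: "length (eliminate x r rs) = length rs"
  by (induction x r rs rule: eliminate.induct) auto

termination full_rank
  by (relation "measure length") (auto simp: length_eliminate)

lemma length_add_row: "length xs = length ys \<Longrightarrow> length (add_row t xs ys) = length ys"
  by (induction t xs ys rule: add_row.induct) auto

lemma add_row_nth:
  "length xs = length ys \<Longrightarrow> k < length ys \<Longrightarrow> add_row t xs ys ! k = (ys ! k + t * xs ! k) mod 3"
  by (induction t xs ys arbitrary: k rule: add_row.induct) (auto simp: axpy3_def nth_Cons split: nat.splits)

lemma eliminate_rows:
  "\<forall>ys \<in> set rs. length ys = Suc (length r) \<Longrightarrow> ys \<in> set (eliminate x r rs) \<Longrightarrow> length ys = length r"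
  by (induction x r rs rule: eliminate.induct) (auto simp: length_add_row)

text \<open>Each reduced column is a column of the old rows plus a multiple of column 0, so a
  relation that annihilates the pivot row's columns can be passed on to the reduced rows.\<close>

lemma dot_eliminate:
  assumes "length cs = length rs" "\<forall>ys \<in> set rs. length ys = Suc (length r)" "k < length r"
  shows "dot cs (eliminate x r rs) k mod 3 = (dot cs rs (Suc k) + 2 * int x * int (r ! k) * dot cs rs 0) mod 3"
  using assms
proof (induction x r rs arbitrary: cs rule: eliminate.induct)
  case (2 x r y ys rs)
  then obtain c cs' where cs: "cs = c # cs'" "length cs' = length rs" by (cases cs) auto
  have IH: "dot cs' (eliminate x r rs) k mod 3 =
      (dot cs' rs (Suc k) + 2 * int x * int (r ! k) * dot cs' rs 0) mod 3"
    using 2 cs by simp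
  have "add_row (2 * x * y mod 3) r ys ! k = (ys ! k + 2 * x * y mod 3 * r ! k) mod 3"
    using 2 by (simp add: add_row_nth)
  hence "add_row (2 * x * y mod 3) r ys ! k mod 3 = (ys ! k + 2 * x * y * r ! k) mod 3"
    by (metis mod_add_right_eq mod_mult_left_eq mod_mod_trivial)
  hence "int (add_row (2 * x * y mod 3) r ys ! k mod 3) = int ((ys ! k + 2 * x * y * r ! k) mod 3)" by simp
  hence eq: "int (add_row (2 * x * y mod 3) r ys ! k) mod 3 =
      (int (ys ! k) + 2 * int x * int y * int (r ! k)) mod 3"
    by (simp only: zmod_int of_nat_add of_nat_mult of_nat_numeral)
  have "(c * int (add_row (2 * x * y mod 3) r ys ! k) + dot cs' (eliminate x r rs) k) mod 3 =
      (c * (int (ys ! k) + 2 * int x * int y * int (r ! k)) +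
       (dot cs' rs (Suc k) + 2 * int x * int (r ! k) * dot cs' rs 0)) mod 3"
    by (rule mod_add_cong[OF mod_mult_cong[OF refl eq] IH])
  thus ?case using cs by (simp add: algebra_simps)
qed auto

text \<open>By induction the coefficients of the reduced rows vanish modulo 3. In column 0 only the
  pivot term is left, and the pivot is invertible.\<close>

lemma full_rank_sound:
  assumes "full_rank rows" "\<forall>r \<in> set rows. length r = n" "length cs = length rows"
    and "\<And>k. k < n \<Longrightarrow> dot cs rows k mod 3 = 0"
  shows "\<forall>c \<in> set cs. c mod 3 = 0"
  using assms
proof (induction rows arbitrary: cs n rule: full_rank.induct)
  case (3 x r rs)
  then obtain c cs' where cs: "cs = c # cs'" "length cs' = length rs" by (cases cs) auto
  have n: "n = Suc (length r)" "\<forall>ys \<in> set rs. length ys = Suc (length r)" using "3.prems"(2) by auto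
  have x: "x mod 3 \<noteq> 0" "full_rank (eliminate x r rs)" using "3.prems"(1) by (auto split: if_splits)
  have "int x mod 3 = 1 \<or> int x mod 3 = 2" using x(1) by presburger
  hence xx: "int x * int x mod 3 = 1" by (auto simp: mod_mult_eq[symmetric, of "int x" "int x" 3])
  have col0: "(c * int x + dot cs' rs 0) mod 3 = 0" using "3.prems"(4)[of 0] n cs by simp
  have "dot cs' (eliminate x r rs) k mod 3 = 0" if k: "k < length r" for k
  proof -
    have "(c * int (r ! k) + dot cs' rs (Suc k)) mod 3 = 0" using "3.prems"(4)[of "Suc k"] n cs k by simp
    then obtain u where u: "dot cs' rs (Suc k) = 3 * u - c * int (r ! k)"
      by (metis add.commute add_diff_cancel_right' mod_0_imp_dvd dvdE)
    obtain v where v: "dot cs' rs 0 = 3 * v - c * int x"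
      using col0 by (metis add.commute add_diff_cancel_right' mod_0_imp_dvd dvdE)
    obtain q where q: "int x * int x = 3 * q + 1" using xx by (metis mult_div_mod_eq)
    have "dot cs' rs (Suc k) + 2 * int x * int (r ! k) * dot cs' rs 0 =
        3 * u + 6 * int x * int (r ! k) * v - c * int (r ! k) - 2 * c * int (r ! k) * (int x * int x)"
      unfolding u v by (simp add: algebra_simps)
    also have "\<dots> = 3 * (u + 2 * int x * int (r ! k) * v - c * int (r ! k) - 2 * c * int (r ! k) * q)"
      unfolding q by (simp add: algebra_simps)
    finally show ?thesis using dot_eliminate[of cs' rs r k x] n(2) cs(2) k by simp
  qed
  hence cs': "\<forall>c \<in> set cs'. c mod 3 = 0"
    using "3.IH"[of "length r" cs'] x eliminate_rows[OF n(2)] cs(2) by (auto simp: length_eliminate)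
  hence "dot cs' rs 0 mod 3 = 0"
  proof (induction cs' rs "0::nat" rule: dot.induct)
    case (1 c cs r rs)
    hence "c mod 3 = 0" "dot cs rs 0 mod 3 = 0" by simp_all
    thus ?case by (simp add: mod_eq_0_iff_dvd)
  qed auto
  hence "c * int x mod 3 = 0" using col0 by (simp add: mod_eq_0_iff_dvd dvd_add_left_iff)
  hence "c * int x * int x mod 3 = 0" by (metis mod_mult_left_eq mult_zero_left mod_0)
  hence "c mod 3 = 0" by (metis mod_mult_right_eq mult.assoc mult.right_neutral xx)
  thus ?case using cs' cs by simp
qed auto

section \<open>The matrix of sampled sections\<close>

definition sections :: "(nat \<times> nat) list" where
  "sections =
    [(1, 0), (6, 0), (6, 1), (6, 2), (6, 3), (6, 4), (6, 5), (36, 0), (36, 1), (36, 7), (36, 13),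
    (36, 19), (36, 25), (36, 31), (36, 3), (36, 9), (36, 15), (36, 21), (36, 27), (36, 33), (36,
    5), (36, 11), (36, 17), (36, 23), (36, 29), (36, 35), (216, 1), (216, 37), (216, 73), (216,
    109), (216, 145), (216, 181), (216, 7), (216, 43), (216, 79), (216, 115), (216, 151), (216,
    187), (216, 13), (216, 49), (216, 85), (216, 121), (216, 157), (216, 193), (216, 19), (216,
    55), (216, 91), (216, 127), (216, 163), (216, 199), (216, 25), (216, 61), (216, 97), (216,
    133), (216, 169), (216, 205), (216, 31), (216, 67), (216, 103), (216, 139), (216, 175), (216,
    211), (216, 3), (216, 39), (216, 75), (216, 111), (216, 147), (216, 183), (216, 9), (216, 45),
    (216, 81), (216, 117), (1296, 7), (1296, 223), (1296, 439), (1296, 655), (1296, 871), (1296,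
    1087), (1296, 43), (1296, 259), (1296, 475), (1296, 691), (1296, 907), (1296, 1123), (1296,
    79), (1296, 295), (1296, 511), (1296, 727), (1296, 943), (1296, 1159), (1296, 115), (1296,
    331), (1296, 547), (1296, 763), (1296, 979), (1296, 1195), (1296, 151), (1296, 367), (1296,
    583), (1296, 799), (1296, 1015), (1296, 1231), (1296, 187), (1296, 403), (1296, 619), (1296,
    835), (1296, 1051), (1296, 1267), (1296, 31), (1296, 247), (1296, 463), (1296, 679), (1296,
    895), (1296, 1111), (1296, 67), (1296, 283), (1296, 499), (1296, 715), (1296, 931), (1296,
    1147), (1296, 103), (1296, 319), (1296, 535), (1296, 751), (1296, 967), (1296, 1183), (1296,
    139), (1296, 355), (1296, 571), (1296, 787), (1296, 1003), (1296, 1219), (1296, 175), (1296,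
    391), (1296, 607), (1296, 823), (1296, 1039), (1296, 1255), (1296, 211), (1296, 427), (1296,
    643), (1296, 859), (1296, 1075), (1296, 1291), (7776, 31), (7776, 1327), (7776, 2623), (7776,
    3919), (7776, 5215), (7776, 6511), (7776, 247), (7776, 1543), (7776, 2839), (7776, 4135),
    (7776, 5431), (7776, 6727), (7776, 463), (7776, 1759), (7776, 3055), (7776, 4351), (7776,
    5647), (7776, 6943), (7776, 1975), (7776, 895), (7776, 2191), (7776, 3487), (7776, 4783),
    (7776, 6079), (7776, 7375), (46656, 895), (46656, 8671), (46656, 2191), (46656, 9967), (46656,
    17743), (46656, 25519), (46656, 33295), (46656, 41071), (46656, 7375), (46656, 15151), (46656,
    22927), (46656, 30703), (46656, 38479), (46656, 46255), (279936, 7375), (279936, 54031),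
    (279936, 38479), (279936, 85135), (1679616, 38479)]"

text \<open>The order is matched to that of \<open>sections\<close> so that elimination never meets
  a zero pivot, as \<open>full_rank\<close> does not exchange rows or columns.\<close>

definition sample_points :: "nat list" where
  "sample_points =
    [4, 1, 2, 3, 5, 0, 6, 7, 52, 8, 55, 54, 51, 53, 10, 9, 11, 14, 12, 13, 15, 16, 17, 21, 18, 19,
    23, 20, 24, 22, 25, 27, 28, 26, 30, 29, 31, 32, 35, 33, 34, 36, 40, 38, 39, 41, 37, 42, 43,
    45, 44, 46, 47, 48, 49, 59, 50, 57, 60, 56, 58, 61, 64, 62, 63, 65, 66, 68, 70, 67, 69, 310,
    71, 73, 72, 74, 75, 79, 76, 77, 80, 78, 81, 82, 83, 84, 85, 86, 87, 88, 89, 90, 92, 91, 95,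
    93, 94, 96, 97, 98, 99, 100, 103, 101, 104, 102, 106, 108, 107, 105, 109, 111, 110, 112, 113,
    117, 114, 116, 115, 118, 120, 122, 119, 123, 124, 121, 126, 127, 128, 125, 130, 129, 131, 133,
    132, 134, 135, 136, 137, 138, 140, 139, 142, 141, 143, 144, 145, 146, 147, 149, 148, 154, 155,
    150, 151, 152, 153, 156, 157, 158, 159, 162, 160, 163, 161, 164, 165, 166, 168, 167, 169, 170,
    171, 173, 172, 174, 177, 175, 176, 180, 178, 181, 183, 179, 184, 182, 185, 186]"

section \<open>Computing the matrix entries by rewriting\<close>

fun section_row :: "nat \<Rightarrow> nat \<Rightarrow> nat list \<Rightarrow> nat list" where
  "section_row a j [] = []"
| "section_row a j (p # ps) = interleave oddpart (a * p + j) mod 3 # section_row a j ps"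

fun section_rows :: "(nat \<times> nat) list \<Rightarrow> nat list \<Rightarrow> nat list list" where
  "section_rows [] ps = []"
| "section_rows ((a, j) # gs) ps = section_row a j ps # section_rows gs ps"

lemma section_row_map: "section_row a j ps = map (\<lambda>p. interleave oddpart (a * p + j) mod 3) ps"
  by (induction ps) simp_all

lemma section_rows_map: "section_rows gs ps = map (\<lambda>g. section_row (fst g) (snd g) ps) gs"
  by (induction gs) auto

text \<open>Division of a numeral by 6 follows its binary digits by Horner's scheme, with
  \<open>shift0\<close> and \<open>shift1\<close> for the digits; rewriting then needs only a case
  table for the six remainders.\<close>

definition divmod6 :: "nat \<Rightarrow> nat \<times> nat" where
  "divmod6 n = (n div 6, n mod 6)"

definition twice :: "nat \<Rightarrow> nat" where "twice q = 2 * q"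

definition Suc_twice :: "nat \<Rightarrow> nat" where "Suc_twice q = 2 * q + 1"

fun shift0 :: "nat \<times> nat \<Rightarrow> nat \<times> nat" where
  "shift0 (q, r) = ((2 * (6 * q + r)) div 6, (2 * (6 * q + r)) mod 6)"

fun shift1 :: "nat \<times> nat \<Rightarrow> nat \<times> nat" where
  "shift1 (q, r) = ((2 * (6 * q + r) + 1) div 6, (2 * (6 * q + r) + 1) mod 6)"

lemma shift_simps:
  "shift0 (q, r) = (2 * q + 2 * r div 6, 2 * r mod 6)"
  "shift1 (q, r) = (2 * q + (2 * r + 1) div 6, (2 * r + 1) mod 6)"
proof -
  have "2 * (6 * q + r) = 2 * r + 6 * (2 * q)" "2 * (6 * q + r) + 1 = 2 * r + 1 + 6 * (2 * q)" by simp_all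
  thus "shift0 (q, r) = (2 * q + 2 * r div 6, 2 * r mod 6)"
    "shift1 (q, r) = (2 * q + (2 * r + 1) div 6, (2 * r + 1) mod 6)"
    unfolding shift0.simps shift1.simps by (simp_all only: mod_mult_self2) simp_all
qed

lemma shift_divmod6: "shift0 (divmod6 n) = divmod6 (2 * n)" "shift1 (divmod6 n) = divmod6 (2 * n + 1)"
  by (simp_all only: divmod6_def shift0.simps shift1.simps mult_div_mod_eq)

lemma divmod6_eval:
  "divmod6 0 = (0, 0)" "divmod6 1 = (0, 1)"
  "divmod6 (numeral (num.Bit0 n)) = shift0 (divmod6 (numeral n))"
  "divmod6 (numeral (num.Bit1 n)) = shift1 (divmod6 (numeral n))"
  "shift0 (q, 0) = (twice q, 0)" "shift0 (q, 1) = (twice q, 2)" "shift0 (q, 2) = (twice q, 4)"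
  "shift0 (q, 3) = (Suc_twice q, 0)" "shift0 (q, 4) = (Suc_twice q, 2)" "shift0 (q, 5) = (Suc_twice q, 4)"
  "shift1 (q, 0) = (twice q, 1)" "shift1 (q, 1) = (twice q, 3)" "shift1 (q, 2) = (twice q, 5)"
  "shift1 (q, 3) = (Suc_twice q, 1)" "shift1 (q, 4) = (Suc_twice q, 3)" "shift1 (q, 5) = (Suc_twice q, 5)"
  "twice 0 = 0" "twice 1 = 2" "twice (numeral k) = numeral (num.Bit0 k)"
  "Suc_twice 0 = 1" "Suc_twice 1 = 3" "Suc_twice (numeral k) = numeral (num.Bit1 k)"
  unfolding shift_divmod6 shift_simps
  by (simp_all add: divmod6_def twice_def Suc_twice_def)

text \<open>Synonyms that keep the recursive evaluation apart from the table lookup.\<close>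

definition oddpart_eval :: "nat \<Rightarrow> nat" where "oddpart_eval = oddpart"

definition core_eval :: "nat \<Rightarrow> nat" where "core_eval = core"

fun oddpart_column :: "nat \<times> nat \<Rightarrow> nat" where
  "oddpart_column (a, r) = (if r = 0 then column_0 a else if r = 3 then core_eval a + 2
     else if r = 1 \<or> r = 4 then 1 else 0)"

text \<open>Below 9396 the letters are listed; above, the column rules lead to \<open>core\<close>
  at about a sixth of the index.\<close>

lemma oddpart_eval: "oddpart_eval n = (if n < 9396 then oddpart n else oddpart_column (divmod6 n))"
proof (cases "n < 9396")
  case False
  define a r where "a = n div 6" and "r = n mod 6"
  have n: "n = 6 * a + r" "r < 6" "a \<ge> 607" unfolding a_def r_def using False by simp_all
  have m: "(6 * a + 1) mod 3 = 1" "(6 * a + 2) mod 3 = 2" "(6 * a + 4) mod 3 = 1" "(6 * a + 5) mod 3 = 2"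
    by presburger+
  have big: "6 * a + i \<ge> 3637" for i using n(3) by simp
  have "r = 0 \<or> r = 1 \<or> r = 2 \<or> r = 3 \<or> r = 4 \<or> r = 5" using n(2) by linarith
  hence "oddpart (6 * a + r) = oddpart_column (a, r)"
  proof (elim disjE)
    assume "r = 0" thus ?thesis using oddpart_mod6_0[OF n(3)] by simp
  next
    assume "r = 1" thus ?thesis using oddpart_mod3_1[OF big m(1)] by simp
  next
    assume "r = 2" thus ?thesis using oddpart_mod3_2[OF big m(2)] by simp
  next
    assume "r = 3" thus ?thesis using oddpart_mod6_3[of a] n(3) by (simp add: core_eval_def)
  next
    assume "r = 4" thus ?thesis using oddpart_mod3_1[OF big m(3)] by simp
  next
    assume "r = 5" thus ?thesis using oddpart_mod3_2[OF big m(4)] by simp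
  qed
  thus ?thesis using False n(1) unfolding oddpart_eval_def divmod6_def a_def r_def by simp
qed (simp add: oddpart_eval_def)

lemma core_eval: "core_eval a = (if a < 13811 then core a else oddpart_eval (a - 7295))"
  by (simp add: core_eval_def oddpart_eval_def core_shift)

lemma numeral_bits:
  "numeral (num.Bit0 n) = 2 * (numeral n :: nat)" "numeral (num.Bit1 n) = 2 * (numeral n :: nat) + 1"
  by simp_all

lemma oddpart_column_eval:
  "oddpart_column (numeral (num.Bit0 (num.Bit0 n)), 0) = 3"
  "oddpart_column (numeral (num.Bit1 (num.Bit0 n)), 0) = 2"
  "oddpart_column (numeral (num.Bit0 (num.Bit1 n)), 0) = 2"
  "oddpart_column (numeral (num.Bit1 (num.Bit1 n)), 0) = 3"
  "oddpart_column (a, 1) = 1" "oddpart_column (a, 2) = 0" "oddpart_column (a, 3) = core_eval a + 2"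
  "oddpart_column (a, 4) = 1" "oddpart_column (a, 5) = 0"
proof -
  have "4 * x mod 4 = 0" "(4 * x + 1) mod 4 = 1" "(4 * x + 2) mod 4 = 2" "(4 * x + 3) mod 4 = 3" for x :: nat
    by presburger+
  hence c: "oddpart_column (4 * x, 0) = 3" "oddpart_column (4 * x + 1, 0) = 2"
    "oddpart_column (4 * x + 2, 0) = 2" "oddpart_column (4 * x + 3, 0) = 3" for x
    by simp_all
  have dist: "2 * (2 * x) = 4 * x" "2 * (2 * x) + 1 = 4 * x + 1" "2 * (2 * x + 1) = 4 * x + 2"
    "2 * (2 * x + 1) + 1 = 4 * x + 3" for x :: nat
    by simp_all
  have "(numeral (num.Bit0 (num.Bit0 n)) :: nat) = 4 * numeral n"
    "(numeral (num.Bit1 (num.Bit0 n)) :: nat) = 4 * numeral n + 1"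
    "(numeral (num.Bit0 (num.Bit1 n)) :: nat) = 4 * numeral n + 2"
    "(numeral (num.Bit1 (num.Bit1 n)) :: nat) = 4 * numeral n + 3"
    by (simp_all only: numeral_bits[of n] numeral_bits[of "num.Bit0 n"] numeral_bits[of "num.Bit1 n"] dist)
  thus "oddpart_column (numeral (num.Bit0 (num.Bit0 n)), 0) = 3"
    "oddpart_column (numeral (num.Bit1 (num.Bit0 n)), 0) = 2"
    "oddpart_column (numeral (num.Bit0 (num.Bit1 n)), 0) = 2"
    "oddpart_column (numeral (num.Bit1 (num.Bit1 n)), 0) = 3"
    by (simp_all only: c)
qed simp_all

text \<open>The last binary digit separates odd from even positions; for even ones the next two
  digits determine the class modulo 8.\<close>

lemma interleave_eval:
  "interleave oddpart 0 = 0" "interleave oddpart 1 = oddpart_eval 0"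
  "interleave oddpart (numeral (num.Bit1 n)) = oddpart_eval (numeral n)"
  "interleave oddpart (numeral (num.Bit0 num.One)) = 0"
  "interleave oddpart (numeral (num.Bit0 (num.Bit0 num.One))) = 1"
  "interleave oddpart (numeral (num.Bit0 (num.Bit1 num.One))) = 1"
  "interleave oddpart (numeral (num.Bit0 (num.Bit0 (num.Bit0 n)))) = 0"
  "interleave oddpart (numeral (num.Bit0 (num.Bit1 (num.Bit0 n)))) = 0"
  "interleave oddpart (numeral (num.Bit0 (num.Bit0 (num.Bit1 n)))) = 1"
  "interleave oddpart (numeral (num.Bit0 (num.Bit1 (num.Bit1 n)))) = 1"
proof -
  have "even (8 * x)" "even (8 * x + 2)" "even (8 * x + 4)" "even (8 * x + 6)" "8 * x mod 8 = 0"
    "(8 * x + 2) mod 8 = 2" "(8 * x + 4) mod 8 = 4" "(8 * x + 6) mod 8 = 6" for x :: nat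
    by presburger+
  hence c: "interleave oddpart (8 * x) = 0" "interleave oddpart (8 * x + 2) = 0"
    "interleave oddpart (8 * x + 4) = 1" "interleave oddpart (8 * x + 6) = 1" for x
    unfolding interleave_def by simp_all
  have dist: "2 * (2 * (2 * x)) = 8 * x" "2 * (2 * (2 * x) + 1) = 8 * x + 2" "2 * (2 * (2 * x + 1)) = 8 * x + 4"
    "2 * (2 * (2 * x + 1) + 1) = 8 * x + 6" for x :: nat
    by simp_all
  have "(numeral (num.Bit0 (num.Bit0 (num.Bit0 n))) :: nat) = 8 * numeral n"
    "(numeral (num.Bit0 (num.Bit1 (num.Bit0 n))) :: nat) = 8 * numeral n + 2"
    "(numeral (num.Bit0 (num.Bit0 (num.Bit1 n))) :: nat) = 8 * numeral n + 4"
    "(numeral (num.Bit0 (num.Bit1 (num.Bit1 n))) :: nat) = 8 * numeral n + 6"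
    by (simp_all only: numeral_bits[of n] numeral_bits[of "num.Bit0 n"] numeral_bits[of "num.Bit1 n"]
        numeral_bits[of "num.Bit0 (num.Bit0 n)"] numeral_bits[of "num.Bit0 (num.Bit1 n)"]
        numeral_bits[of "num.Bit1 (num.Bit0 n)"] numeral_bits[of "num.Bit1 (num.Bit1 n)"] dist)
  thus "interleave oddpart (numeral (num.Bit0 (num.Bit0 (num.Bit0 n)))) = 0"
    "interleave oddpart (numeral (num.Bit0 (num.Bit1 (num.Bit0 n)))) = 0"
    "interleave oddpart (numeral (num.Bit0 (num.Bit0 (num.Bit1 n)))) = 1"
    "interleave oddpart (numeral (num.Bit0 (num.Bit1 (num.Bit1 n)))) = 1"
    by (simp_all only: c)
  have "(numeral (num.Bit1 n) :: nat) = 2 * numeral n + 1" by simp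
  thus "interleave oddpart (numeral (num.Bit1 n)) = oddpart_eval (numeral n)"
    unfolding oddpart_eval_def by (simp only: interleave_odd)
qed (simp_all add: interleave_def oddpart_eval_def)

lemma mod3_eval:
  "0 mod 3 = (0::nat)" "1 mod 3 = (1::nat)" "2 mod 3 = (2::nat)" "3 mod 3 = (0::nat)" "4 mod 3 = (1::nat)" "5 mod 3 = (2::nat)" "6 mod 3 = (0::nat)" "7 mod 3 = (1::nat)" "8 mod 3 = (2::nat)"
  "9 mod 3 = (0::nat)" "10 mod 3 = (1::nat)" "11 mod 3 = (2::nat)" "12 mod 3 = (0::nat)" "13 mod 3 = (1::nat)" "14 mod 3 = (2::nat)" "15 mod 3 = (0::nat)" "16 mod 3 = (1::nat)"
  by simp_all

lemma axpy3_eval: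
  "axpy3 0 0 0 = 0" "axpy3 0 0 1 = 1" "axpy3 0 0 2 = 2"
  "axpy3 0 1 0 = 0" "axpy3 0 1 1 = 1" "axpy3 0 1 2 = 2"
  "axpy3 0 2 0 = 0" "axpy3 0 2 1 = 1" "axpy3 0 2 2 = 2"
  "axpy3 1 0 0 = 0" "axpy3 1 0 1 = 1" "axpy3 1 0 2 = 2"
  "axpy3 1 1 0 = 1" "axpy3 1 1 1 = 2" "axpy3 1 1 2 = 0"
  "axpy3 1 2 0 = 2" "axpy3 1 2 1 = 0" "axpy3 1 2 2 = 1"
  "axpy3 2 0 0 = 0" "axpy3 2 0 1 = 1" "axpy3 2 0 2 = 2"
  "axpy3 2 1 0 = 2" "axpy3 2 1 1 = 0" "axpy3 2 1 2 = 1"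
  "axpy3 2 2 0 = 1" "axpy3 2 2 1 = 2" "axpy3 2 2 2 = 0"
  by (simp_all add: axpy3_def)

lemmas section_eval = section_rows.simps section_row.simps interleave_eval oddpart_eval core_eval
  oddpart_column_eval divmod6_eval letter_values minus_eval numeral_eval mult_zero_right mult_zero_left
  mod3_eval axpy3_eval add_row.simps eliminate.simps full_rank.simps

lemma full_rank_sections: "full_rank (section_rows sections sample_points)"
  by (simp only: sections_def sample_points_def section_eval cong: if_weak_cong)

lemma length_sections: "length sections = 188"
  by (simp add: sections_def)

section \<open>From full rank modulo 3 to independence over the rationals\<close>

lemma dot_sum: "length cs = length rs \<Longrightarrow> dot cs rs k = (\<Sum>i<length rs. cs ! i * int (rs ! i ! k))"
proof (induction cs rs k rule: dot.induct)
  case (1 c cs r rs k)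
  thus ?case by (simp add: sum.lessThan_Suc_shift del: sum.lessThan_Suc)
qed auto

definition section_at :: "nat \<Rightarrow> nat \<Rightarrow> nat" where
  "section_at i p = interleave oddpart (fst (sections ! i) * p + snd (sections ! i))"

lemma relation_divisible:
  assumes rel: "\<And>p. (\<Sum>i<188. c i * int (section_at i p)) = 0" and "i < 188"
  shows "3 dvd c i"
proof -
  let ?rows = "section_rows sections sample_points"
  let ?cs = "map c [0..<188]"
  have len: "length ?rows = 188" by (simp add: section_rows_map length_sections)
  have rows: "?rows ! i ! k = section_at i (sample_points ! k) mod 3"
    if "i < 188" "k < length sample_points" for i k
    using that by (simp add: section_rows_map section_row_map length_sections section_at_def)
  have "\<forall>x \<in> set ?cs. x mod 3 = 0"
  proof (rule full_rank_sound[OF full_rank_sections, of "length sample_points"])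
    show "\<forall>r \<in> set ?rows. length r = length sample_points"
      by (auto simp: section_rows_map section_row_map)
    show "length ?cs = length ?rows" by (simp add: len)
  next
    fix k assume k: "k < length sample_points"
    have "dot ?cs ?rows k = (\<Sum>i<188. c i * int (section_at i (sample_points ! k) mod 3))"
      using k by (subst dot_sum) (auto simp: len rows intro!: sum.cong)
    also have "\<dots> mod 3 = (\<Sum>i<188. c i * int (section_at i (sample_points ! k))) mod 3"
      by (subst (1 2) mod_sum_eq[symmetric]) (simp add: zmod_int mod_mult_right_eq)
    finally show "dot ?cs ?rows k mod 3 = 0" using rel by simp
  qed
  thus ?thesis using \<open>i < 188\<close> by (auto simp: dvd_eq_mod_eq_0)
qed

text \<open>All coefficients are divisible by 3, and the quotients satisfy the same relation, so the
  argument can be repeated.\<close>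

lemma relation_divisible_power:
  assumes "\<And>p. (\<Sum>i<188. c i * int (section_at i p)) = 0" "i < 188"
  shows "3 ^ k dvd c i"
  using assms
proof (induction k arbitrary: c)
  case (Suc k)
  have dvd: "3 dvd c i" if "i < 188" for i using relation_divisible[of c i] Suc.prems(1) that by blast
  have "3 * (\<Sum>i<188. c i div 3 * int (section_at i p)) = (\<Sum>i<188. c i * int (section_at i p))" for p
    unfolding sum_distrib_left using dvd by (intro sum.cong) auto
  hence "3 * (\<Sum>i<188. c i div 3 * int (section_at i p)) = 0" for p unfolding Suc.prems(1) .
  moreover have "x = 0" if "3 * x = 0" for x :: int using that by simp
  ultimately have "(\<Sum>i<188. c i div 3 * int (section_at i p)) = 0" for p by blast
  hence "3 ^ k dvd c i div 3" using Suc.IH[of "\<lambda>i. c i div 3"] Suc.prems(2) by blast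
  moreover have "c i = 3 * (c i div 3)" using dvd[OF Suc.prems(2)] by simp
  ultimately show ?case by (metis mult_dvd_mono dvd_refl power_Suc)
qed simp

lemma int_relation_trivial:
  fixes c :: "nat \<Rightarrow> int"
  assumes "\<And>p. (\<Sum>i<188. c i * int (section_at i p)) = 0" "i < 188"
  shows "c i = 0"
proof (rule ccontr)
  assume "c i \<noteq> 0"
  \<comment> \<open>The exponent is chosen so that the power exceeds the coefficient that it
    divides.\<close>
  moreover have "3 ^ nat \<bar>c i\<bar> dvd c i" using relation_divisible_power[of c i] assms by blast
  ultimately have "\<bar>3 ^ nat \<bar>c i\<bar>\<bar> \<le> \<bar>c i\<bar>" by (rule dvd_imp_le_int)
  moreover have "int n < 3 ^ n" for n
    using less_le_trans[OF of_nat_less_two_power power_mono[of 2 "3::int" n]] by simp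
  from this[of "nat \<bar>c i\<bar>"] have "\<bar>c i\<bar> < 3 ^ nat \<bar>c i\<bar>" by simp
  ultimately show False by simp
qed

lemma common_denominator:
  fixes a :: "nat \<Rightarrow> rat"
  shows "\<exists>d::int. d > 0 \<and> (\<forall>i<n. \<exists>z::int. a i * of_int d = of_int z)"
proof (induction n)
  case (Suc n)
  then obtain d :: int where d: "d > 0" "\<And>i. i < n \<Longrightarrow> \<exists>z::int. a i * of_int d = of_int z" by blast
  obtain u v where uv: "quotient_of (a n) = (u, v)" by fastforce
  hence v: "v > 0" "a n = of_int u / of_int v" using quotient_of_denom_pos quotient_of_div by blast+
  have "\<exists>z::int. a i * of_int (d * v) = of_int z" if i: "i < Suc n" for i
  proof (cases "i = n")
    case True
    thus ?thesis using v by (intro exI[of _ "u * d"]) simp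
  next
    case False
    then obtain z :: int where "a i * of_int d = of_int z" using d(2)[of i] i by auto
    thus ?thesis by (intro exI[of _ "z * v"]) (simp add: mult.assoc[symmetric])
  qed
  thus ?case using d(1) v(1) by (intro exI[of _ "d * v"]) simp
qed (auto intro: exI[of _ 1])

definition section_seq :: "nat \<Rightarrow> nat \<Rightarrow> rat" where
  "section_seq i p = of_nat (section_at i p)"

lemma relation_trivial:
  assumes rel: "\<And>p. (\<Sum>i<188. a i * section_seq i p) = 0" and "i < 188"
  shows "a i = 0"
proof -
  obtain d :: int where d: "d > 0" "\<And>i. i < 188 \<Longrightarrow> \<exists>z::int. a i * of_int d = of_int z"
    using common_denominator[of 188 a] by blast
  then obtain c :: "nat \<Rightarrow> int" where c: "\<And>i. i < 188 \<Longrightarrow> a i * of_int d = of_int (c i)" by metis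
  have "(\<Sum>i<188. c i * int (section_at i p)) = 0" for p
  proof -
    have "(of_int (\<Sum>i<188. c i * int (section_at i p)) :: rat) = (\<Sum>i<188. a i * of_int d * section_seq i p)"
      by (simp add: c section_seq_def)
    also have "\<dots> = of_int d * (\<Sum>i<188. a i * section_seq i p)"
      by (simp add: sum_distrib_left mult.commute mult.left_commute)
    also have "\<dots> = 0" using rel[of p] by (simp only: mult_zero_right)
    finally show ?thesis by (simp only: of_int_eq_0_iff)
  qed
  hence "c i = 0" using int_relation_trivial \<open>i < 188\<close> by blast
  thus ?thesis using c[OF \<open>i < 188\<close>] d(1) by simp
qed

text \<open>Two equal sequences would satisfy a relation with coefficients 1 and -1. Injectivity
  allows passing from the indexed family to its image, to which independence and cardinality
  refer.\<close>

lemma inj_section_seq: "inj_on section_seq {..<188}"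
proof (rule inj_onI, rule ccontr)
  fix x y assume xy: "x \<in> {..<188}" "y \<in> {..<188}" "section_seq x = section_seq y" "x \<noteq> y"
  define a :: "nat \<Rightarrow> rat" where "a i = (if i = x then 1 else 0) - (if i = y then 1 else 0)" for i
  have "(\<Sum>i<188. a i * section_seq i p) = 0" for p
  proof -
    have "(\<Sum>i<188. a i * section_seq i p) =
        (\<Sum>i<188. if i = x then section_seq i p else 0) - (\<Sum>i<188. if i = y then section_seq i p else 0)"
      unfolding sum_subtractf[symmetric] by (intro sum.cong) (auto simp: a_def)
    also have "\<dots> = 0" using xy by simp
    finally show ?thesis .
  qed
  hence "a x = 0" using relation_trivial xy(1) by blast
  thus False using xy(4) by (simp add: a_def)
qed

lemma independent_sections: "ratseq.independent (section_seq ` {..<188})"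
proof
  assume "ratseq.dependent (section_seq ` {..<188})"
  then obtain u where u: "\<exists>v \<in> section_seq ` {..<188}. u v \<noteq> 0"
    "(\<Sum>v \<in> section_seq ` {..<188}. seq_scale (u v) v) = 0"
    using ratseq.dependent_finite[of "section_seq ` {..<188}"] by auto
  have zero: "(\<Sum>i<188. seq_scale (u (section_seq i)) (section_seq i)) = 0"
    using u(2) sum.reindex[OF inj_section_seq, of "\<lambda>v. seq_scale (u v) v"] by (simp add: o_def)
  have "(\<Sum>i<188. u (section_seq i) * section_seq i p) =
      (\<Sum>i<188. seq_scale (u (section_seq i)) (section_seq i)) p" for p
    by (simp add: sum_fun_apply seq_scale_def)
  hence "(\<Sum>i<188. u (section_seq i) * section_seq i p) = 0" for p unfolding zero by simp
  hence "u (section_seq i) = 0" if "i < 188" for i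
    using relation_trivial[of "\<lambda>i. u (section_seq i)" i] that by blast
  thus False using u(1) by auto
qed

lemma sections_in_kernel: "section_seq ` {..<188} \<subseteq> kernel 6 letters"
proof
  have sections: "\<forall>g \<in> set sections. fst g \<in> {1, 6, 36, 216, 1296, 7776, 46656, 279936, 1679616} \<and>
      snd g < fst g"
    by (simp only: sections_def list.set ball_simps insert_iff empty_iff fst_conv snd_conv numeral_eval)
  have pow: "\<exists>e. a = 6 ^ e" if "a \<in> {1, 6, 36, 216, 1296, 7776, 46656, 279936, 1679616}" for a :: nat
  proof -
    have "a = 6 ^ 0 \<or> a = 6 ^ 1 \<or> a = 6 ^ 2 \<or> a = 6 ^ 3 \<or> a = 6 ^ 4 \<or> a = 6 ^ 5 \<or> a = 6 ^ 6 \<or>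
        a = 6 ^ 7 \<or> a = 6 ^ 8"
      using that by simp
    thus ?thesis by blast
  qed
  fix f assume "f \<in> section_seq ` {..<188}"
  then obtain i where i: "i < 188" "f = section_seq i" by blast
  obtain e where "fst (sections ! i) = 6 ^ e" "snd (sections ! i) < fst (sections ! i)"
    using pow sections nth_mem[of i sections] i(1) length_sections by metis
  thus "f \<in> kernel 6 letters" unfolding kernel_def i(2)
    by (intro CollectI exI[of _ e] exI[of _ "snd (sections ! i)"])
      (auto simp: section_seq_def section_at_def letters_def fun_eq_iff)
qed

text \<open>The set \<open>?B\<close> only serves as a dimension bound, so its elements are not
  claimed to lie in the span of the kernel. A kernel sequence outside the span of \<open>?G\<close>
  would make 189 independent sequences in a space spanned by at most 188.\<close>

lemma span_kernel: "ratseq.span (kernel 6 letters) = ratseq.span (section_seq ` {..<188})"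
proof
  let ?G = "section_seq ` {..<188}" and ?B = "set upper_basis \<union> unit_seq ` {..<115}"
  have B: "kernel 6 letters \<subseteq> ratseq.span ?B" using kernel_nearly_spanned nearly_spanned_span by blast
  have "kernel 6 letters \<subseteq> ratseq.span ?G"
  proof
    fix f assume f: "f \<in> kernel 6 letters"
    show "f \<in> ratseq.span ?G"
    proof (rule ccontr)
      assume n: "f \<notin> ratseq.span ?G"
      hence "f \<notin> ?G" by (rule contrapos_nn[OF _ ratseq.span_base])
      moreover have "ratseq.independent (insert f ?G)"
        using ratseq.independent_insert[of f ?G] independent_sections n by simp
      moreover have "insert f ?G \<subseteq> ratseq.span ?B" using B f sections_in_kernel by blast
      ultimately have "card (insert f ?G) \<le> card ?B"
        using ratseq.independent_span_bound[of ?B "insert f ?G"] by simp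
      moreover have "card (insert f ?G) = 189"
        using \<open>f \<notin> ?G\<close> card_image[OF inj_section_seq] by simp
      ultimately show False using card_upper by simp
    qed
  qed
  thus "ratseq.span (kernel 6 letters) \<subseteq> ratseq.span ?G" by (rule ratseq.span_minimal) simp
  show "ratseq.span ?G \<subseteq> ratseq.span (kernel 6 letters)" using sections_in_kernel by (rule ratseq.span_mono)
qed

theorem theorem7p5:
  shows "regular 6 (\<lambda>i. of_nat (w54 i)) \<and> rank 6 (\<lambda>i. of_nat (w54 i)) = 188"
proof -
  have w: "(\<lambda>i. of_nat (w54 i)) = letters" unfolding w54_interleave letters_def by simp
  have "regular 6 letters" unfolding regular_def
    using span_kernel by (intro conjI exI[of _ "section_seq ` {..<188}"]) simp_all
  moreover have "rank 6 letters = 188"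
    unfolding rank_def span_kernel
    using ratseq.dim_span_eq_card_independent[OF independent_sections] card_image[OF inj_section_seq] by simp
  ultimately show ?thesis unfolding w by simp
qed

end
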